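(* $\mathrm{para}\text{-}\mathrm{FO}=\mathrm{X}\mathrm{FO}_{\mathrm{qr}}$; that is, a parameterized problem is first-order definable after a precomputation if and only if it is slicewise definable in $\mathrm{FO}_q$ for some $q\in\mathbb N$.
   Context: For $n\in\mathbb N$ let $[n]=\{0,\dots,n-1\}$ with natural order and $+^{[n]}=\{(a,b,c)\in[n]^3:c=a+b\}$, $\times^{[n]}=\{(a,b,c)\in[n]^3:c=ab\}$. For relational vocabularies containing binary $<$ and ternary $+,\times$, a finite $\tau$-structure has built-in addition and multiplication if its $\{<,+,\times\}$-reduct is isomorphic to $([n],<^{[n]},+^{[n]},\times^{[n]})$; $\mathrm{ARITHM}[\tau]$ is the class of these. $C(m)=\{\overline\ell:\ell<m\}$ are new constants, and $\mathbf A_{C(m)}$ interprets $\overline\ell$ as the element corresponding to $\ell$ if $\ell<|A|$, else to $|A|-1$. $\mathrm{FO}_q$ is the set of first-order sentences of quantifier rank at most $q$. A parameterized problem is a class $Q\subseteq\mathrm{ARITHM}[\tau]\times\mathbb N$ with slices $Q_k=\{\mathbf A:(\mathbf A,k)\in Q\}$ closed under isomorphism. $Q$ is slicewise definable in $\mathrm{FO}_q$ if there are computable $h$ and $f$ with $f(k)$ an $\mathrm{FO}_q[\tau\cup C(h(k))]$-sentence such that $(\mathbf A,k)\in Q\iff\mathbf A_{C(h(k))}\models f(k)$; $\mathrm{X}\mathrm{FO}_{\mathrm{qr}}$ is the class of problems slicewise definable in $\mathrm{FO}_q$ for some $q$. For $\mathbf A\in\mathrm{ARITHM}[\tau]$,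 $\mathbf A'\in\mathrm{ARITHM}[\tau']$ with $A\cap A'=\emptyset$ and $\tau\cap\tau'=\{<,+,\times\}$, and a new unary symbol $U$, let $\tau\uplus\tau'=\tau\cup\tau'\cup\{U\}$ and $\mathbf A\uplus\mathbf A'$ the $\tau\uplus\tau'$-structure with universe $A\cup A'$, $U$ interpreted as $A'$, $<$ interpreted as $<^{\mathbf A}\cup<^{\mathbf A'}\cup(A\times A')$, each $R\in\tau\setminus\{<\}$ interpreted as $R^{\mathbf A}$ and each $R\in\tau'\setminus\{<\}$ interpreted as $R^{\mathbf A'}$ (in particular $+$ and $\times$ are interpreted as $+^{\mathbf A}\cup+^{\mathbf A'}$, $\times^{\mathbf A}\cup\times^{\mathbf A'}$ as in the definition "$R^{\mathbf B}=R^{\mathbf A}$ for $R\in\tau$, $R^{\mathbf B}=R^{\mathbf A'}$ for $R\in\tau'$"); if $A\cap A'\neq\emptyset$ one first passes to isomorphic copies with disjoint universes. $Q\subseteq\mathrm{ARITHM}[\tau]\times\mathbb N$ is in $\mathrm{para}\text{-}\mathrm{FO}$ if for some vocabulary $\tau'$ there are a computable function $\mathit{pre}:\mathbb N\to\mathrm{ARITHM}[\tau']$ and a first-order $\tau\uplus\tau'$-sentence $\varphi$ such that for all $(\mathbf A,k)$: $(\mathbf A,k)\in Q\iff\mathbf A\uplus\mathit{pre}(k)\models\varphi$.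
   Formalization: In A⊎A', + and × are taken as the built-in addition and multiplication of the whole ordered universe, not as the unions of those of A and A'; with unions a fixed sentence defines only finitely many slices, so the claim fails for {(A,k): k+1<|A|}. *)

theory Defs
  imports Main "HOL-Library.Nat_Bijection"
begin

section \<open>Computable functions\<close>

text \<open>
  Total recursive functions of arity \<open>n\<close>: the closure of the initial functions under composition,
  primitive recursion and minimisation of regular functions. An \<open>n\<close>-ary function is represented on
  argument lists; its values on lists of length other than \<open>n\<close> are irrelevant.
\<close>

inductive recursive_fn :: "nat \<Rightarrow> (nat list \<Rightarrow> nat) \<Rightarrow> bool" where
  zero: "recursive_fn n (\<lambda>xs. 0)"
| succ: "recursive_fn 1 (\<lambda>xs. Suc (xs ! 0))"
| proj: "i < n \<Longrightarrow> recursive_fn n (\<lambda>xs. xs ! i)"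
| comp: "recursive_fn (length gs) f \<Longrightarrow> \<forall>g\<in>set gs. recursive_fn n g \<Longrightarrow>
    recursive_fn n (\<lambda>xs. f (map (\<lambda>g. g xs) gs))"
| prim_rec: "recursive_fn n f \<Longrightarrow> recursive_fn (Suc (Suc n)) g \<Longrightarrow>
    recursive_fn (Suc n) (\<lambda>xs. rec_nat (f (tl xs)) (\<lambda>i r. g (i # r # tl xs)) (hd xs))"
| minimise: "recursive_fn (Suc n) f \<Longrightarrow> \<forall>xs. length xs = n \<longrightarrow> (\<exists>y. f (y # xs) = 0) \<Longrightarrow>
    recursive_fn n (\<lambda>xs. LEAST y. f (y # xs) = 0)"

definition computable :: "(nat \<Rightarrow> nat) \<Rightarrow> bool" where
  "computable h \<longleftrightarrow> (\<exists>f. recursive_fn 1 f \<and> (\<forall>k. h k = f [k]))"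


section \<open>Vocabularies and structures\<close>

text \<open>\<open>Sym r i\<close> is the \<open>i\<close>-th relation symbol of arity \<open>r\<close>.\<close>

datatype symb = Less | Add | Mult | Sym nat nat

fun arity :: "symb \<Rightarrow> nat" where
  "arity Less = 2"
| "arity Add = 3"
| "arity Mult = 3"
| "arity (Sym r i) = r"

definition arith_voc :: "symb set" where
  "arith_voc = {Less, Add, Mult}"

definition vocabulary :: "symb set \<Rightarrow> bool" where
  "vocabulary \<tau> \<longleftrightarrow> finite \<tau> \<and> arith_voc \<subseteq> \<tau>"

text \<open>
  The field \<open>con\<close> interprets the constants: \<open>con A l\<close> is the value of the \<open>l\<close>-th constant,
  or \<open>None\<close> if that constant does not belong to the vocabulary of \<open>A\<close>.
\<close>

record 'a struct =
  universe :: "'a set"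
  rel :: "symb \<Rightarrow> 'a list set"
  con :: "nat \<rightharpoonup> 'a"

text \<open>
  Symbols outside \<open>\<tau>\<close> are required to have the empty interpretation, so that a \<open>\<tau>\<close>-structure is
  determined by its universe and its interpretation of \<open>\<tau>\<close>.
\<close>

definition structures :: "symb set \<Rightarrow> 'a struct set" where
  "structures \<tau> = {A. finite (universe A) \<and> universe A \<noteq> {} \<and> con A = Map.empty \<and>
     (\<forall>R\<in>\<tau>. rel A R \<subseteq> {xs. length xs = arity R \<and> set xs \<subseteq> universe A}) \<and>
     (\<forall>R. R \<notin> \<tau> \<longrightarrow> rel A R = {})}"

definition reduct :: "symb set \<Rightarrow> 'a struct \<Rightarrow> 'a struct" where
  "reduct \<sigma> A = A\<lparr>rel := (\<lambda>R. if R \<in> \<sigma> then rel A R else {})\<rparr>"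

definition struct_iso :: "('a \<Rightarrow> 'b) \<Rightarrow> 'a struct \<Rightarrow> 'b struct \<Rightarrow> bool" where
  "struct_iso \<pi> A B \<longleftrightarrow> bij_betw \<pi> (universe A) (universe B) \<and>
     (\<forall>R xs. set xs \<subseteq> universe A \<longrightarrow> (xs \<in> rel A R \<longleftrightarrow> map \<pi> xs \<in> rel B R)) \<and>
     (\<forall>l. con B l = map_option \<pi> (con A l))"

definition isomorphic :: "'a struct \<Rightarrow> 'b struct \<Rightarrow> bool" where
  "isomorphic A B \<longleftrightarrow> (\<exists>\<pi>. struct_iso \<pi> A B)"

definition arith :: "nat \<Rightarrow> nat struct" where
  "arith n = \<lparr>universe = {..<n},
     rel = (\<lambda>R. case R of
         Less \<Rightarrow> {[a, b] | a b. a < n \<and> b < n \<and> a < b}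
       | Add \<Rightarrow> {[a, b, c] | a b c. a < n \<and> b < n \<and> c < n \<and> c = a + b}
       | Mult \<Rightarrow> {[a, b, c] | a b c. a < n \<and> b < n \<and> c < n \<and> c = a * b}
       | Sym r i \<Rightarrow> {}),
     con = Map.empty\<rparr>"

definition ARITHM :: "symb set \<Rightarrow> 'a struct set" where
  "ARITHM \<tau> = {A \<in> structures \<tau>. \<exists>n. isomorphic (reduct arith_voc A) (arith n)}"

definition arith_elem :: "'a struct \<Rightarrow> nat \<Rightarrow> 'a" where
  "arith_elem A l = (THE a. a \<in> universe A \<and>
     (\<exists>\<pi>. struct_iso \<pi> (reduct arith_voc A) (arith (card (universe A))) \<and> \<pi> a = l))"

lemma arith_iso_less:
  assumes iso: "struct_iso \<pi> (reduct arith_voc A) (arith n)" and ab: "a \<in> universe A" "b \<in> universe A"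
  shows "[a, b] \<in> rel A Less \<longleftrightarrow> \<pi> a < \<pi> b"
proof -
  have "set xs \<subseteq> universe A \<longrightarrow>
      (xs \<in> rel (reduct arith_voc A) R \<longleftrightarrow> map \<pi> xs \<in> rel (arith n) R)" for xs R
    using iso unfolding struct_iso_def by (simp add: reduct_def)
  from this[of "[a, b]" Less] ab
  have "[a, b] \<in> rel A Less \<longleftrightarrow> [\<pi> a, \<pi> b] \<in> rel (arith n) Less"
    by (simp add: reduct_def arith_voc_def)
  moreover have "bij_betw \<pi> (universe A) {..<n}"
    using iso unfolding struct_iso_def by (simp add: reduct_def arith_def)
  then have "\<pi> a < n" "\<pi> b < n" using ab by (auto dest!: bij_betwE)
  ultimately show ?thesis by (simp add: arith_def)
qed

lemma arith_iso_pos: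
  assumes iso: "struct_iso \<pi> (reduct arith_voc A) (arith n)" and a: "a \<in> universe A"
  shows "\<pi> a = card {b \<in> universe A. [b, a] \<in> rel A Less}"
proof -
  have bij: "bij_betw \<pi> (universe A) {..<n}"
    using iso unfolding struct_iso_def by (simp add: reduct_def arith_def)
  have "{b \<in> universe A. [b, a] \<in> rel A Less} = {b \<in> universe A. \<pi> b < \<pi> a}"
    using arith_iso_less[OF iso _ a] by blast
  moreover have "\<pi> ` {b \<in> universe A. \<pi> b < \<pi> a} = {..<\<pi> a}"
  proof -
    have im: "\<pi> ` universe A = {..<n}" using bij by (simp add: bij_betw_def)
    then have "\<pi> a < n" using a by blast
    then have "{..<\<pi> a} \<subseteq> \<pi> ` universe A" unfolding im by simp
    then show ?thesis by blast
  qed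
  moreover have "inj_on \<pi> {b \<in> universe A. \<pi> b < \<pi> a}"
    using bij unfolding bij_betw_def by (rule inj_on_subset[OF conjunct1]) blast
  ultimately show ?thesis using card_image by fastforce
qed

lemma arith_iso_card:
  assumes "struct_iso \<pi> (reduct arith_voc A) (arith n)"
  shows "n = card (universe A)"
  using assms bij_betw_same_card[of \<pi> "universe A" "{..<n}"]
  by (simp add: struct_iso_def reduct_def arith_def)

lemma arith_elem_eq:
  assumes iso: "struct_iso \<pi> (reduct arith_voc A) (arith n)" and a: "a \<in> universe A"
  shows "arith_elem A (\<pi> a) = a"
  unfolding arith_elem_def
proof (rule the_equality)
  show "a \<in> universe A \<and>
    (\<exists>\<rho>. struct_iso \<rho> (reduct arith_voc A) (arith (card (universe A))) \<and> \<rho> a = \<pi> a)"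
    using a iso unfolding arith_iso_card[OF iso] by blast
next
  fix b assume b: "b \<in> universe A \<and>
    (\<exists>\<rho>. struct_iso \<rho> (reduct arith_voc A) (arith (card (universe A))) \<and> \<rho> b = \<pi> a)"
  then obtain \<rho> where \<rho>: "struct_iso \<rho> (reduct arith_voc A) (arith (card (universe A)))" "\<rho> b = \<pi> a"
    by blast
  have "\<pi> b = \<pi> a" using arith_iso_pos[OF iso] arith_iso_pos[OF \<rho>(1)] \<rho>(2) b by simp
  moreover have "inj_on \<pi> (universe A)"
    using iso by (simp add: struct_iso_def reduct_def bij_betw_def)
  ultimately show "b = a" using a b by (auto dest: inj_onD)
qed

definition expand_consts :: "nat \<Rightarrow> 'a struct \<Rightarrow> 'a struct" where
  "expand_consts m A = A\<lparr>con := (\<lambda>l. if l < m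
     then Some (arith_elem A (if l < card (universe A) then l else card (universe A) - 1))
     else None)\<rparr>"


section \<open>First-order logic\<close>

text \<open>The remaining connectives and the universal quantifier are the usual abbreviations.\<close>

datatype tm = Var nat | Const nat

datatype fm =
    Eq tm tm
  | Rel symb "tm list"
  | Neg fm
  | Or fm fm
  | Ex nat fm

fun tm_vars :: "tm \<Rightarrow> nat set" where
  "tm_vars (Var x) = {x}"
| "tm_vars (Const l) = {}"

fun tm_consts :: "tm \<Rightarrow> nat set" where
  "tm_consts (Var x) = {}"
| "tm_consts (Const l) = {l}"

fun free_vars :: "fm \<Rightarrow> nat set" where
  "free_vars (Eq s t) = tm_vars s \<union> tm_vars t"
| "free_vars (Rel R ts) = (\<Union>t\<in>set ts. tm_vars t)"
| "free_vars (Neg \<phi>) = free_vars \<phi>"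
| "free_vars (Or \<phi> \<psi>) = free_vars \<phi> \<union> free_vars \<psi>"
| "free_vars (Ex x \<phi>) = free_vars \<phi> - {x}"

fun quantifier_rank :: "fm \<Rightarrow> nat" where
  "quantifier_rank (Eq s t) = 0"
| "quantifier_rank (Rel R ts) = 0"
| "quantifier_rank (Neg \<phi>) = quantifier_rank \<phi>"
| "quantifier_rank (Or \<phi> \<psi>) = max (quantifier_rank \<phi>) (quantifier_rank \<psi>)"
| "quantifier_rank (Ex x \<phi>) = Suc (quantifier_rank \<phi>)"

text \<open>Formulas over the vocabulary \<open>\<tau>\<close> together with the constants \<open>Const l\<close>, \<open>l < m\<close>.\<close>

fun fm_over :: "symb set \<Rightarrow> nat \<Rightarrow> fm \<Rightarrow> bool" where
  "fm_over \<tau> m (Eq s t) \<longleftrightarrow> tm_consts s \<union> tm_consts t \<subseteq> {..<m}"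
| "fm_over \<tau> m (Rel R ts) \<longleftrightarrow>
     R \<in> \<tau> \<and> length ts = arity R \<and> (\<Union>t\<in>set ts. tm_consts t) \<subseteq> {..<m}"
| "fm_over \<tau> m (Neg \<phi>) \<longleftrightarrow> fm_over \<tau> m \<phi>"
| "fm_over \<tau> m (Or \<phi> \<psi>) \<longleftrightarrow> fm_over \<tau> m \<phi> \<and> fm_over \<tau> m \<psi>"
| "fm_over \<tau> m (Ex x \<phi>) \<longleftrightarrow> fm_over \<tau> m \<phi>"

definition sentences :: "symb set \<Rightarrow> nat \<Rightarrow> fm set" where
  "sentences \<tau> m = {\<phi>. fm_over \<tau> m \<phi> \<and> free_vars \<phi> = {}}"

definition FO_rank :: "nat \<Rightarrow> symb set \<Rightarrow> nat \<Rightarrow> fm set" where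
  "FO_rank q \<tau> m = {\<phi> \<in> sentences \<tau> m. quantifier_rank \<phi> \<le> q}"

fun tm_val :: "'a struct \<Rightarrow> (nat \<Rightarrow> 'a) \<Rightarrow> tm \<Rightarrow> 'a" where
  "tm_val A s (Var x) = s x"
| "tm_val A s (Const l) = the (con A l)"

fun sat :: "'a struct \<Rightarrow> (nat \<Rightarrow> 'a) \<Rightarrow> fm \<Rightarrow> bool" where
  "sat A s (Eq t u) \<longleftrightarrow> tm_val A s t = tm_val A s u"
| "sat A s (Rel R ts) \<longleftrightarrow> map (tm_val A s) ts \<in> rel A R"
| "sat A s (Neg \<phi>) \<longleftrightarrow> \<not> sat A s \<phi>"
| "sat A s (Or \<phi> \<psi>) \<longleftrightarrow> sat A s \<phi> \<or> sat A s \<psi>"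
| "sat A s (Ex x \<phi>) \<longleftrightarrow> (\<exists>a\<in>universe A. sat A (s(x := a)) \<phi>)"

definition models :: "'a struct \<Rightarrow> fm \<Rightarrow> bool" where
  "models A \<phi> \<longleftrightarrow> (\<forall>s. range s \<subseteq> universe A \<longrightarrow> sat A s \<phi>)"


section \<open>Codes of formulas and structures\<close>

fun symb_encode :: "symb \<Rightarrow> nat" where
  "symb_encode Less = 0"
| "symb_encode Add = 1"
| "symb_encode Mult = 2"
| "symb_encode (Sym r i) = 3 + prod_encode (r, i)"

fun tm_encode :: "tm \<Rightarrow> nat" where
  "tm_encode (Var x) = 2 * x"
| "tm_encode (Const l) = 2 * l + 1"

fun fm_encode :: "fm \<Rightarrow> nat" where
  "fm_encode (Eq s t) = prod_encode (0, prod_encode (tm_encode s, tm_encode t))"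
| "fm_encode (Rel R ts) = prod_encode (1, prod_encode (symb_encode R, list_encode (map tm_encode ts)))"
| "fm_encode (Neg \<phi>) = prod_encode (2, fm_encode \<phi>)"
| "fm_encode (Or \<phi> \<psi>) = prod_encode (3, prod_encode (fm_encode \<phi>, fm_encode \<psi>))"
| "fm_encode (Ex x \<phi>) = prod_encode (4, prod_encode (x, fm_encode \<phi>))"

text \<open>Used for structures without constants, over a finite vocabulary.\<close>

definition struct_encode :: "nat struct \<Rightarrow> nat" where
  "struct_encode A = prod_encode (set_encode (universe A),
     set_encode {prod_encode (symb_encode R, list_encode xs) | R xs. xs \<in> rel A R})"


section \<open>Parameterized problems\<close>

text \<open>
  The universes of the finite structures in a problem are subsets of \<open>nat\<close>; up to isomorphism,
  these are all finite structures.
\<close>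

definition param_problem :: "symb set \<Rightarrow> (nat struct \<times> nat) set \<Rightarrow> bool" where
  "param_problem \<tau> Q \<longleftrightarrow> vocabulary \<tau> \<and> Q \<subseteq> ARITHM \<tau> \<times> UNIV \<and>
     (\<forall>k. \<forall>A\<in>ARITHM \<tau>. \<forall>B\<in>ARITHM \<tau>. isomorphic A B \<longrightarrow> (A, k) \<in> Q \<longrightarrow> (B, k) \<in> Q)"

definition slicewise_definable :: "nat \<Rightarrow> symb set \<Rightarrow> (nat struct \<times> nat) set \<Rightarrow> bool" where
  "slicewise_definable q \<tau> Q \<longleftrightarrow> (\<exists>h f. computable h \<and> computable (\<lambda>k. fm_encode (f k)) \<and>
     (\<forall>k. f k \<in> FO_rank q \<tau> (h k)) \<and>
     (\<forall>A\<in>ARITHM \<tau>. \<forall>k. (A, k) \<in> Q \<longleftrightarrow> models (expand_consts (h k) A) (f k)))"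

definition XFO_qr :: "(symb set \<times> (nat struct \<times> nat) set) set" where
  "XFO_qr = {(\<tau>, Q). param_problem \<tau> Q \<and> (\<exists>q. slicewise_definable q \<tau> Q)}"

text \<open>
  The ordered sum of \<open>A\<close> and \<open>A'\<close>, with the elements of \<open>A\<close> first and the new unary symbol \<open>U\<close>
  marking \<open>A'\<close>; the sum type provides the disjoint copies of the universes.

  Addition and multiplication are the built-in ones of the ordered universe of the sum, so that the
  sum again has built-in addition and multiplication (see \<open>struct_sum_ARITHM\<close> below). With the mere
  unions of the two additions and of the two multiplications, the two parts would not interact: by
  a Feferman--Vaught argument, a fixed sentence could define only finitely many distinct slices, in
  contrast to \<open>XFO_qr\<close>, which contains the problem with slices \<open>{A. k < |A|}\<close>.

  Each \<open>Sym r i\<close> belongs to at most one of the two vocabularies, hence at most one of the two sets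
  in the last union is nonempty.
\<close>

definition sum_univ :: "'a struct \<Rightarrow> 'b struct \<Rightarrow> ('a + 'b) set" where
  "sum_univ A A' = Inl ` universe A \<union> Inr ` universe A'"

definition sum_less :: "'a struct \<Rightarrow> 'b struct \<Rightarrow> ('a + 'b) list set" where
  "sum_less A A' = map Inl ` rel A Less \<union> map Inr ` rel A' Less \<union>
     {[Inl a, Inr b] | a b. a \<in> universe A \<and> b \<in> universe A'}"

definition sum_pos :: "'a struct \<Rightarrow> 'b struct \<Rightarrow> 'a + 'b \<Rightarrow> nat" where
  "sum_pos A A' x = card {y \<in> sum_univ A A'. [y, x] \<in> sum_less A A'}"

definition struct_sum :: "symb \<Rightarrow> 'a struct \<Rightarrow> 'b struct \<Rightarrow> ('a + 'b) struct" where
  "struct_sum U A A' = \<lparr>universe = sum_univ A A',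
     rel = (\<lambda>R. if R = U then {[Inr b] | b. b \<in> universe A'} else
       (case R of
         Less \<Rightarrow> sum_less A A'
       | Add \<Rightarrow> {[x, y, z] | x y z. {x, y, z} \<subseteq> sum_univ A A' \<and>
           sum_pos A A' z = sum_pos A A' x + sum_pos A A' y}
       | Mult \<Rightarrow> {[x, y, z] | x y z. {x, y, z} \<subseteq> sum_univ A A' \<and>
           sum_pos A A' z = sum_pos A A' x * sum_pos A A' y}
       | Sym r i \<Rightarrow> map Inl ` rel A R \<union> map Inr ` rel A' R)),
     con = Map.empty\<rparr>"

lemma struct_sum_ARITHM:
  assumes A: "A \<in> ARITHM \<tau>" and A': "A' \<in> ARITHM \<tau>'"
    and voc: "\<tau> \<inter> \<tau>' = arith_voc" and U: "arity U = 1"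
  shows "struct_sum U A A' \<in> ARITHM (\<tau> \<union> \<tau>' \<union> {U})"
proof -
  obtain n \<pi> where \<pi>: "struct_iso \<pi> (reduct arith_voc A) (arith n)"
    using A by (auto simp: ARITHM_def isomorphic_def)
  obtain n' \<pi>' where \<pi>': "struct_iso \<pi>' (reduct arith_voc A') (arith n')"
    using A' by (auto simp: ARITHM_def isomorphic_def)
  have st: "A \<in> structures \<tau>" "A' \<in> structures \<tau>'" using A A' by (auto simp: ARITHM_def)
  have fin: "finite (universe A)" "finite (universe A')" using st by (auto simp: structures_def)
  have U': "U \<noteq> Less" "U \<noteq> Add" "U \<noteq> Mult" using U by auto
  have in_voc: "Less \<in> \<tau>" "Add \<in> \<tau>" "Mult \<in> \<tau>" "Less \<in> \<tau>'" "Add \<in> \<tau>'" "Mult \<in> \<tau>'"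
    using voc by (auto simp: arith_voc_def)
  have bij: "bij_betw \<pi> (universe A) {..<n}" "bij_betw \<pi>' (universe A') {..<n'}"
    using \<pi> \<pi>' by (simp_all add: struct_iso_def reduct_def arith_def)
  have lenL: "length xs = 2 \<and> set xs \<subseteq> universe A" if "xs \<in> rel A Less" for xs
    using st(1) in_voc that unfolding structures_def by (auto dest!: bspec[of \<tau> _ Less])
  have lenL': "length xs = 2 \<and> set xs \<subseteq> universe A'" if "xs \<in> rel A' Less" for xs
    using st(2) in_voc that unfolding structures_def by (auto dest!: bspec[of \<tau>' _ Less])
  define p where "p = case_sum \<pi> (\<lambda>b. n + \<pi>' b)"
  have less_Inl_Inl: "[Inl a, Inl b] \<in> sum_less A A' \<longleftrightarrow> [a, b] \<in> rel A Less" for a b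
    by (auto simp: sum_less_def map_eq_Cons_conv Cons_eq_map_conv image_iff)
  have less_Inr_Inr: "[Inr a, Inr b] \<in> sum_less A A' \<longleftrightarrow> [a, b] \<in> rel A' Less" for a b
    by (auto simp: sum_less_def map_eq_Cons_conv Cons_eq_map_conv image_iff)
  have less_Inl_Inr: "[Inl a, Inr b] \<in> sum_less A A' \<longleftrightarrow> a \<in> universe A \<and> b \<in> universe A'" for a b
    by (auto simp: sum_less_def map_eq_Cons_conv Cons_eq_map_conv image_iff)
  have less_Inr_Inl: "[Inr b, Inl a] \<notin> sum_less A A'" for a b
    by (auto simp: sum_less_def map_eq_Cons_conv Cons_eq_map_conv image_iff)
  have pos: "sum_pos A A' x = p x" if x: "x \<in> sum_univ A A'" for x
  proof (cases x)
    case (Inl a)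
    then have a: "a \<in> universe A" using x by (auto simp: sum_univ_def)
    have "{y \<in> sum_univ A A'. [y, x] \<in> sum_less A A'} = Inl ` {b \<in> universe A. [b, a] \<in> rel A Less}"
      unfolding Inl sum_univ_def
      using less_Inl_Inl less_Inr_Inl by auto
    then show ?thesis
      using arith_iso_pos[OF \<pi> a] by (simp add: sum_pos_def p_def Inl card_image)
  next
    case (Inr a)
    then have a: "a \<in> universe A'" using x by (auto simp: sum_univ_def)
    have "{y \<in> sum_univ A A'. [y, x] \<in> sum_less A A'} =
        Inl ` universe A \<union> Inr ` {b \<in> universe A'. [b, a] \<in> rel A' Less}"
      unfolding Inr sum_univ_def
      using less_Inr_Inr less_Inl_Inr a by auto
    moreover have "card (Inl ` universe A \<union> Inr ` {b \<in> universe A'. [b, a] \<in> rel A' Less}) =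
        card (universe A) + card {b \<in> universe A'. [b, a] \<in> rel A' Less}"
      using fin by (subst card_Un_disjoint) (auto simp: card_image)
    ultimately show ?thesis
      using arith_iso_pos[OF \<pi>' a] arith_iso_card[OF \<pi>] by (simp add: sum_pos_def p_def Inr)
  qed
  have less: "[x, y] \<in> sum_less A A' \<longleftrightarrow> p x < p y"
    if "x \<in> sum_univ A A'" "y \<in> sum_univ A A'" for x y
  proof -
    have lt: "\<pi> a < n" "\<pi> a < n + i" "\<pi> a \<le> n + i" if "a \<in> universe A" for a i
      using bij(1) that by (auto dest!: bij_betwE)
    show ?thesis
      using that arith_iso_less[OF \<pi>] arith_iso_less[OF \<pi>'] lt
      by (cases x; cases y) (auto simp: sum_univ_def p_def less_Inl_Inl less_Inr_Inr
          less_Inl_Inr less_Inr_Inl not_less)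
  qed
  have p_bij: "bij_betw p (sum_univ A A') {..<n + n'}"
  proof -
    have "bij_betw p (Inl ` universe A) {..<n}"
      using bij(1) by (auto simp: bij_betw_def inj_on_def p_def image_image)
    moreover have "bij_betw p (Inr ` universe A') {n..<n + n'}"
    proof -
      have "p ` Inr ` universe A' = (+) n ` \<pi>' ` universe A'" by (simp add: p_def image_image)
      also have "\<dots> = {n..<n + n'}"
        using bij(2) by (simp add: bij_betw_def lessThan_atLeast0 add.commute)
      finally show ?thesis using bij(2) by (auto simp: bij_betw_def inj_on_def p_def)
    qed
    ultimately have "bij_betw p (Inl ` universe A \<union> Inr ` universe A') ({..<n} \<union> {n..<n + n'})"
      by (rule bij_betw_combine) auto
    moreover have "{..<n} \<union> {n..<n + n'} = {..<n + n'}" by auto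
    ultimately show ?thesis by (simp add: sum_univ_def)
  qed
  let ?B = "struct_sum U A A'"
  have p_lt: "p x < n + n'" if "x \<in> sum_univ A A'" for x
    using p_bij that by (auto dest: bij_betwE)
  have "struct_iso p (reduct arith_voc ?B) (arith (n + n'))"
    unfolding struct_iso_def
  proof (intro conjI allI impI)
    show "bij_betw p (universe (reduct arith_voc ?B)) (universe (arith (n + n')))"
      using p_bij by (simp add: reduct_def arith_def struct_sum_def)
    show "con (arith (n + n')) l = map_option p (con (reduct arith_voc ?B) l)" for l
      by (simp add: reduct_def arith_def struct_sum_def)
    fix R xs assume "set xs \<subseteq> universe (reduct arith_voc ?B)"
    then have xs: "set xs \<subseteq> sum_univ A A'" by (simp add: reduct_def struct_sum_def)
    then have map_p: "set (map p xs) \<subseteq> {..<n + n'}" using p_lt by auto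
    show "xs \<in> rel (reduct arith_voc ?B) R \<longleftrightarrow> map p xs \<in> rel (arith (n + n')) R"
    proof (cases R)
      case Less
      have len: "\<exists>x y. xs = [x, y]" if "xs \<in> sum_less A A'"
      proof -
        have "length xs = 2" using that lenL lenL' unfolding sum_less_def by auto
        then show ?thesis by (auto simp: numeral_2_eq_2 length_Suc_conv)
      qed
      have "xs \<in> sum_less A A' \<longleftrightarrow> (\<exists>x y. xs = [x, y] \<and> p x < p y)"
      proof (cases "\<exists>x y. xs = [x, y]")
        case True
        then show ?thesis using less xs by auto
      qed (use len in auto)
      also have "\<dots> \<longleftrightarrow> (\<exists>i j. map p xs = [i, j] \<and> i < j)"
        by (auto simp: map_eq_Cons_conv)
      also have "\<dots> \<longleftrightarrow> map p xs \<in> rel (arith (n + n')) R"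
        using map_p Less by (auto simp: arith_def)
      finally show ?thesis using U' Less by (simp add: reduct_def arith_voc_def struct_sum_def)
    next
      case Add
      have "rel (reduct arith_voc ?B) R = {[x, y, z] | x y z. {x, y, z} \<subseteq> sum_univ A A' \<and>
          sum_pos A A' z = sum_pos A A' x + sum_pos A A' y}"
        using U' Add by (simp add: reduct_def arith_voc_def struct_sum_def)
      then have "xs \<in> rel (reduct arith_voc ?B) R \<longleftrightarrow> (\<exists>x y z. xs = [x, y, z] \<and> p z = p x + p y)"
        using xs pos by auto
      also have "\<dots> \<longleftrightarrow> (\<exists>i j k. map p xs = [i, j, k] \<and> k = i + j)"
        by (auto simp: map_eq_Cons_conv)
      also have "\<dots> \<longleftrightarrow> map p xs \<in> rel (arith (n + n')) R"
        using map_p Add by (auto simp: arith_def)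
      finally show ?thesis .
    next
      case Mult
      have "rel (reduct arith_voc ?B) R = {[x, y, z] | x y z. {x, y, z} \<subseteq> sum_univ A A' \<and>
          sum_pos A A' z = sum_pos A A' x * sum_pos A A' y}"
        using U' Mult by (simp add: reduct_def arith_voc_def struct_sum_def)
      then have "xs \<in> rel (reduct arith_voc ?B) R \<longleftrightarrow> (\<exists>x y z. xs = [x, y, z] \<and> p z = p x * p y)"
        using xs pos by auto
      also have "\<dots> \<longleftrightarrow> (\<exists>i j k. map p xs = [i, j, k] \<and> k = i * j)"
        by (auto simp: map_eq_Cons_conv)
      also have "\<dots> \<longleftrightarrow> map p xs \<in> rel (arith (n + n')) R"
        using map_p Mult by (auto simp: arith_def)
      finally show ?thesis .
    next
      case (Sym r i)
      then show ?thesis by (simp add: reduct_def arith_voc_def arith_def)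
    qed
  qed
  moreover have "?B \<in> structures (\<tau> \<union> \<tau>' \<union> {U})"
  proof -
    have rel: "xs \<in> rel ?B R \<Longrightarrow> R \<in> \<tau> \<union> \<tau>' \<union> {U} \<and> length xs = arity R \<and> set xs \<subseteq> sum_univ A A'"
      for R xs
    proof -
      assume xs: "xs \<in> rel ?B R"
      have relA: "R \<in> \<tau> \<and> length ys = arity R \<and> set ys \<subseteq> universe A" if "ys \<in> rel A R" for ys
        using st(1) that by (cases "R \<in> \<tau>") (auto simp: structures_def)
      have relA': "R \<in> \<tau>' \<and> length ys = arity R \<and> set ys \<subseteq> universe A'" if "ys \<in> rel A' R" for ys
        using st(2) that by (cases "R \<in> \<tau>'") (auto simp: structures_def)
      show ?thesis
      proof (cases "R = U")
        case True then show ?thesis using xs U by (auto simp: struct_sum_def sum_univ_def)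
      next
        case False
        note F = False
        show ?thesis
        proof (cases R)
          case Less
          then have "xs \<in> sum_less A A'" using xs F by (simp add: struct_sum_def)
          then consider ys where "ys \<in> rel A Less" "xs = map Inl ys"
            | ys where "ys \<in> rel A' Less" "xs = map Inr ys"
            | a b where "a \<in> universe A" "b \<in> universe A'" "xs = [Inl a, Inr b]"
            by (auto simp: sum_less_def)
          then show ?thesis
          proof cases
            case 1
            with lenL[of ys] Less in_voc show ?thesis by (auto simp: sum_univ_def)
          next
            case 2
            with lenL'[of ys] Less in_voc show ?thesis by (auto simp: sum_univ_def)
          next
            case 3
            with Less in_voc show ?thesis by (auto simp: sum_univ_def)
          qed
        next
          case (Sym r i)
          then have "xs \<in> map Inl ` rel A R \<union> map Inr ` rel A' R"
            using xs F by (simp add: struct_sum_def)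
          then consider ys where "ys \<in> rel A R" "xs = map Inl ys"
            | ys where "ys \<in> rel A' R" "xs = map Inr ys" by blast
          then show ?thesis
          proof cases
            case 1
            with relA[of ys] show ?thesis by (auto simp: sum_univ_def)
          next
            case 2
            with relA'[of ys] show ?thesis by (auto simp: sum_univ_def)
          qed
        qed (use xs F in_voc in \<open>auto simp: struct_sum_def\<close>)
      qed
    qed
    have 1: "finite (sum_univ A A')" "sum_univ A A' \<noteq> {}"
      using fin st by (auto simp: structures_def sum_univ_def)
    have 2: "universe ?B = sum_univ A A'" "con ?B = Map.empty"
      by (simp_all add: struct_sum_def)
    show ?thesis unfolding structures_def mem_Collect_eq 2
    proof (intro conjI ballI allI impI subsetI)
      fix R xs assume "xs \<in> rel ?B R"
      from rel[OF this] show "xs \<in> {xs. length xs = arity R \<and> set xs \<subseteq> sum_univ A A'}" by blast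
    next
      fix R assume "R \<notin> \<tau> \<union> \<tau>' \<union> {U}"
      with rel show "rel ?B R = {}" by blast
    qed (use 1 in simp_all)
  qed
  ultimately show ?thesis by (auto simp: ARITHM_def isomorphic_def)
qed

definition para_FO :: "(symb set \<times> (nat struct \<times> nat) set) set" where
  "para_FO = {(\<tau>, Q). param_problem \<tau> Q \<and>
     (\<exists>\<tau>' U (pre :: nat \<Rightarrow> nat struct) \<phi>.
        vocabulary \<tau>' \<and> \<tau> \<inter> \<tau>' = arith_voc \<and> arity U = 1 \<and> U \<notin> \<tau> \<union> \<tau>' \<and>
        (\<forall>k. pre k \<in> ARITHM \<tau>') \<and> computable (\<lambda>k. struct_encode (pre k)) \<and>
        \<phi> \<in> sentences (\<tau> \<union> \<tau>' \<union> {U}) 0 \<and>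
        (\<forall>A\<in>ARITHM \<tau>. \<forall>k. (A, k) \<in> Q \<longleftrightarrow> models (struct_sum U A (pre k)) \<phi>))}"

end

theory Submission
  imports Defs
begin

text \<open>
  From a precomputation to slices: quantifiers over the precomputed structure \<open>pre k\<close> become finite
  disjunctions, which do not raise the quantifier rank. The arithmetic of the sum that leaves the range
  of \<open>A\<close> is expressed inside \<open>A\<close> with boundedly many quantifiers once \<open>|A|\<close> is quadratically larger than
  \<open>pre k\<close>; for each of the finitely many smaller sizes every element of \<open>A\<close> is named by a constant, and
  the sentence is expanded into a quantifier-free one.

  Conversely, let \<open>c\<close> be the code of the sentence \<open>f k\<close> of rank at most \<open>q\<close>. The precomputed structure has
  the universe \<open>[2 ^ (c + 1)]\<close>, whose elements code all sets of (codes of) subformulas, and it marks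
  the sets that respect negation and disjunction. To evaluate a formula of rank \<open>i + 1\<close> under an assignment, a fixed
  formula guesses such a set and checks it on the atoms and, recursively for rank \<open>i\<close>, on the existential
  subformulas. Thus \<open>q\<close> nested guesses suffice, however deep the Boolean structure of \<open>f k\<close> is.
\<close>

section \<open>Closure properties of the recursive functions\<close>

text \<open>Only the values on argument lists of length \<open>n\<close> matter. In the closure rules below a bound variable is
  the head of the argument list, and the parameters of the surrounding context are its tail.\<close>

definition rec :: "nat \<Rightarrow> (nat list \<Rightarrow> nat) \<Rightarrow> bool" where
  "rec n g \<longleftrightarrow> (\<exists>f. recursive_fn n f \<and> (\<forall>xs. length xs = n \<longrightarrow> f xs = g xs))"

lemma recI: "recursive_fn n f \<Longrightarrow> (\<And>xs. length xs = n \<Longrightarrow> f xs = g xs) \<Longrightarrow> rec n g"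
  unfolding rec_def by blast

lemma rec_cong: "rec n f \<Longrightarrow> (\<And>xs. length xs = n \<Longrightarrow> f xs = g xs) \<Longrightarrow> rec n g"
  unfolding rec_def by auto

lemma computable_iff_rec: "computable h \<longleftrightarrow> rec 1 (\<lambda>xs. h (xs ! 0))"
proof
  assume "computable h"
  then obtain f where f: "recursive_fn 1 f" "\<And>k. h k = f [k]" unfolding computable_def by blast
  show "rec 1 (\<lambda>xs. h (xs ! 0))"
    by (rule recI[OF f(1)]) (auto simp: f(2) length_Suc_conv)
next
  assume "rec 1 (\<lambda>xs. h (xs ! 0))"
  then show "computable h" unfolding rec_def computable_def by force
qed

lemma rec_comp:
  assumes f: "rec (length gs) f" and gs: "\<And>g. g \<in> set gs \<Longrightarrow> rec n g"
  shows "rec n (\<lambda>xs. f (map (\<lambda>g. g xs) gs))"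
proof -
  obtain f' where f': "recursive_fn (length gs) f'" "\<And>xs. length xs = length gs \<Longrightarrow> f' xs = f xs"
    using f unfolding rec_def by blast
  define r where "r g = (SOME g'. recursive_fn n g' \<and> (\<forall>xs. length xs = n \<longrightarrow> g' xs = g xs))" for g
  have r: "recursive_fn n (r g)" "length xs = n \<Longrightarrow> r g xs = g xs" if "g \<in> set gs" for g xs
    using someI_ex[OF gs[OF that, unfolded rec_def]] unfolding r_def by blast+
  have "recursive_fn n (\<lambda>xs. f' (map (\<lambda>g. g xs) (map r gs)))"
    by (rule recursive_fn.comp) (use f' r in auto)
  then show ?thesis
  proof (rule recI)
    fix xs :: "nat list" assume "length xs = n"
    then have "map (\<lambda>g. g xs) (map r gs) = map (\<lambda>g. g xs) gs" using r by simp
    then show "f' (map (\<lambda>g. g xs) (map r gs)) = f (map (\<lambda>g. g xs) gs)"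
      using f'(2)[of "map (\<lambda>g. g xs) gs"] by (simp del: map_map)
  qed
qed

lemma rec_nth: "i < n \<Longrightarrow> rec n (\<lambda>xs. xs ! i)"
  by (rule recI[OF recursive_fn.proj]) auto

lemma rec_hd: "rec (Suc n) hd"
  by (rule rec_cong[OF rec_nth[of 0]]) (auto simp: hd_conv_nth[symmetric] length_Suc_conv)

lemma rec_subst_drop:
  assumes g: "rec (Suc n) (\<lambda>ys. g (hd ys) (tl ys))" and b: "rec (d + n) b"
  shows "rec (d + n) (\<lambda>xs. g (b xs) (drop d xs))"
proof -
  let ?gs = "b # map (\<lambda>i xs. xs ! (d + i)) [0..<n]"
  have "rec (d + n) (\<lambda>xs. (\<lambda>ys. g (hd ys) (tl ys)) (map (\<lambda>g. g xs) ?gs))"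
    by (rule rec_comp) (use assms rec_nth in auto)
  then show ?thesis
  proof (rule rec_cong)
    fix xs :: "nat list" assume "length xs = d + n"
    then have "map (\<lambda>g. g xs) (map (\<lambda>i xs. xs ! (d + i)) [0..<n]) = drop d xs"
      by (intro nth_equalityI) auto
    then show "(\<lambda>ys. g (hd ys) (tl ys)) (map (\<lambda>g. g xs) ?gs) = g (b xs) (drop d xs)" by simp
  qed
qed

lemma rec_subst:
  "rec (Suc n) (\<lambda>ys. g (hd ys) (tl ys)) \<Longrightarrow> rec n b \<Longrightarrow> rec n (\<lambda>xs. g (b xs) xs)"
  using rec_subst_drop[of n g 0 b] by simp

lemma rec_weaken:
  assumes "rec n g" shows "rec (Suc n) (\<lambda>ys. g (tl ys))"
proof -
  have "rec (Suc n) (\<lambda>xs. g (map (\<lambda>g. g xs) (map (\<lambda>i xs. xs ! Suc i) [0..<n])))"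
    by (rule rec_comp) (use assms rec_nth in auto)
  then show ?thesis
  proof (rule rec_cong)
    fix xs :: "nat list" assume "length xs = Suc n"
    then have "map (\<lambda>g. g xs) (map (\<lambda>i xs. xs ! Suc i) [0..<n]) = tl xs"
      by (intro nth_equalityI) (auto simp: nth_tl)
    then show "g (map (\<lambda>g. g xs) (map (\<lambda>i xs. xs ! Suc i) [0..<n])) = g (tl xs)" by simp
  qed
qed

lemma rec_prim_rec:
  assumes f: "rec n f" and g: "rec (Suc (Suc n)) (\<lambda>ys. g (hd ys) (hd (tl ys)) (tl (tl ys)))"
    and b: "rec n b"
  shows "rec n (\<lambda>xs. rec_nat (f xs) (\<lambda>i r. g i r xs) (b xs))"
proof -
  obtain f' where f': "recursive_fn n f'" "\<And>xs. length xs = n \<Longrightarrow> f' xs = f xs"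
    using f unfolding rec_def by blast
  obtain g' where g': "recursive_fn (Suc (Suc n)) g'"
    "\<And>ys. length ys = Suc (Suc n) \<Longrightarrow> g' ys = g (hd ys) (hd (tl ys)) (tl (tl ys))"
    using g unfolding rec_def by blast
  have "rec (Suc n) (\<lambda>ys. rec_nat (f (tl ys)) (\<lambda>i r. g i r (tl ys)) (hd ys))"
  proof (rule recI[OF recursive_fn.prim_rec[OF f'(1) g'(1)]])
    fix ys :: "nat list" assume l: "length ys = Suc n"
    have "(\<lambda>i r. g' (i # r # tl ys)) = (\<lambda>i r. g i r (tl ys))"
      using l by (simp add: g'(2))
    then show "rec_nat (f' (tl ys)) (\<lambda>i r. g' (i # r # tl ys)) (hd ys) =
        rec_nat (f (tl ys)) (\<lambda>i r. g i r (tl ys)) (hd ys)" using l by (simp add: f'(2))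
  qed
  from rec_subst[OF this b] show ?thesis .
qed

lemma rec_zero: "rec n (\<lambda>xs. 0)"
  by (rule recI[OF recursive_fn.zero]) auto

lemma rec_computable:
  assumes "computable h" "rec n a" shows "rec n (\<lambda>xs. h (a xs))"
proof -
  have "rec (length [a]) (\<lambda>xs. h (xs ! 0))" using assms(1) by (simp add: computable_iff_rec)
  from rec_comp[OF this, of n] assms(2) show ?thesis by simp
qed

lemma rec_Suc:
  assumes "rec n a" shows "rec n (\<lambda>xs. Suc (a xs))"
proof -
  have "computable Suc" unfolding computable_def using recursive_fn.succ by fastforce
  then show ?thesis using assms by (rule rec_computable)
qed

lemma rec_const: "rec n (\<lambda>xs. c)"
  by (induction c) (simp_all add: rec_zero rec_Suc)

lemma rec_add:
  assumes "rec n a" "rec n b" shows "rec n (\<lambda>xs. a xs + b xs)"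
proof -
  have "rec n (\<lambda>xs. rec_nat (a xs) (\<lambda>i r. Suc r) (b xs))"
    by (intro rec_prim_rec assms rec_Suc rec_weaken rec_hd)
  moreover have "rec_nat x (\<lambda>i r. Suc r) y = x + y" for x y :: nat by (induction y) auto
  ultimately show ?thesis by simp
qed

lemma rec_mult:
  assumes "rec n a" "rec n b" shows "rec n (\<lambda>xs. a xs * b xs)"
proof -
  have "rec n (\<lambda>xs. rec_nat 0 (\<lambda>i r. r + a xs) (b xs))"
    by (intro rec_prim_rec assms rec_add rec_zero rec_weaken rec_hd)
  moreover have "rec_nat 0 (\<lambda>i r. r + x) y = x * y" for x y :: nat by (induction y) auto
  ultimately show ?thesis by simp
qed

lemma rec_diff:
  assumes "rec n a" "rec n b" shows "rec n (\<lambda>xs. a xs - b xs)"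
proof -
  have pred: "rec m (\<lambda>xs. c xs - 1)" if "rec m c" for m c
  proof -
    have "rec m (\<lambda>xs. rec_nat 0 (\<lambda>i r. i) (c xs))"
      by (rule rec_prim_rec) (auto intro: that rec_zero rec_hd)
    moreover have "rec_nat 0 (\<lambda>i r. i) y = y - 1" for y :: nat by (cases y) auto
    ultimately show ?thesis by simp
  qed
  have "rec n (\<lambda>xs. rec_nat (a xs) (\<lambda>i r. r - 1) (b xs))"
    by (intro rec_prim_rec assms pred rec_weaken rec_hd)
  moreover have "rec_nat x (\<lambda>i r. r - 1) y = x - y" for x y :: nat by (induction y) auto
  ultimately show ?thesis by simp
qed

lemma rec_power2:
  assumes "rec n a" shows "rec n (\<lambda>xs. 2 ^ a xs)"
proof -
  have "rec n (\<lambda>xs. rec_nat 1 (\<lambda>i r. r + r) (a xs))"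
    by (intro rec_prim_rec assms rec_add rec_const rec_weaken rec_hd)
  moreover have "rec_nat 1 (\<lambda>i r. r + r) y = (2 :: nat) ^ y" for y by (induction y) auto
  ultimately show ?thesis by simp
qed

lemma rec_fold:
  assumes "rec (Suc n) (\<lambda>ys. g (hd ys) (tl ys))" "rec n b" "rec n z"
    and "rec (Suc (Suc 0)) (\<lambda>xs. op (hd xs) (hd (tl xs)))"
  shows "rec n (\<lambda>xs. rec_nat (z xs) (\<lambda>i r. op (g i xs) r) (b xs))"
proof -
  have g: "rec (Suc (Suc n)) (\<lambda>zs. g (hd zs) (tl (tl zs)))"
    using rec_subst_drop[OF assms(1), of 2 hd] rec_hd[of "Suc n"] by (simp add: drop_Suc numeral_2_eq_2)
  have r: "rec (Suc (Suc n)) (\<lambda>zs. hd (tl zs))" by (rule rec_weaken[OF rec_hd])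
  have "rec (Suc (Suc n)) (\<lambda>zs. op (g (hd zs) (tl (tl zs))) (hd (tl zs)))"
    using rec_comp[where gs = "[\<lambda>zs. g (hd zs) (tl (tl zs)), \<lambda>zs. hd (tl zs)]"
        and f = "\<lambda>xs. op (hd xs) (hd (tl xs))" and n = "Suc (Suc n)"] g r assms(4)
    by auto
  then show ?thesis by (intro rec_prim_rec assms)
qed

lemma rec_sum:
  assumes "rec (Suc n) (\<lambda>ys. g (hd ys) (tl ys))" "rec n b"
  shows "rec n (\<lambda>xs. \<Sum>i<b xs. g i xs)"
proof -
  have "rec n (\<lambda>xs. rec_nat 0 (\<lambda>i r. g i xs + r) (b xs))"
    by (intro rec_fold assms rec_zero rec_add rec_hd rec_weaken)
  moreover have "rec_nat 0 (\<lambda>i r. h i + r) y = (\<Sum>i<y. h i)" for y and h :: "nat \<Rightarrow> nat"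
    by (induction y) auto
  ultimately show ?thesis by simp
qed

definition recp :: "nat \<Rightarrow> (nat list \<Rightarrow> bool) \<Rightarrow> bool" where
  "recp n P \<longleftrightarrow> rec n (\<lambda>xs. of_bool (P xs))"

lemma recp_less: "rec n a \<Longrightarrow> rec n b \<Longrightarrow> recp n (\<lambda>xs. a xs < b xs)"
proof -
  assume "rec n a" "rec n b"
  then have "rec n (\<lambda>xs. 1 - (1 - (b xs - a xs)))" by (intro rec_diff rec_const)
  then show ?thesis unfolding recp_def by (rule rec_cong) auto
qed

lemma recp_not: "recp n P \<Longrightarrow> recp n (\<lambda>xs. \<not> P xs)"
proof -
  assume "recp n P"
  then have "rec n (\<lambda>xs. 1 - of_bool (P xs))" unfolding recp_def by (intro rec_diff rec_const)
  then show ?thesis unfolding recp_def by (rule rec_cong) auto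
qed

lemma recp_conj: "recp n P \<Longrightarrow> recp n Q \<Longrightarrow> recp n (\<lambda>xs. P xs \<and> Q xs)"
proof -
  assume "recp n P" "recp n Q"
  then have "rec n (\<lambda>xs. of_bool (P xs) * of_bool (Q xs))" unfolding recp_def by (rule rec_mult)
  then show ?thesis unfolding recp_def by (rule rec_cong) auto
qed

lemma recp_disj: "recp n P \<Longrightarrow> recp n Q \<Longrightarrow> recp n (\<lambda>xs. P xs \<or> Q xs)"
  using recp_not[OF recp_conj[OF recp_not recp_not], of n P Q] by simp

lemma recp_imp: "recp n P \<Longrightarrow> recp n Q \<Longrightarrow> recp n (\<lambda>xs. P xs \<longrightarrow> Q xs)"
  unfolding imp_conv_disj by (intro recp_disj recp_not)

lemma recp_iff: "recp n P \<Longrightarrow> recp n Q \<Longrightarrow> recp n (\<lambda>xs. P xs \<longleftrightarrow> Q xs)"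
  unfolding iff_conv_conj_imp by (intro recp_conj recp_imp)

lemma recp_le: "rec n a \<Longrightarrow> rec n b \<Longrightarrow> recp n (\<lambda>xs. a xs \<le> b xs)"
  using recp_not[OF recp_less, of n b a] by (simp add: not_less)

lemma recp_eq: "rec n a \<Longrightarrow> rec n b \<Longrightarrow> recp n (\<lambda>xs. a xs = b xs)"
  using recp_conj[OF recp_le recp_le, of n a b b a] by (simp add: eq_iff)

lemma recp_const: "recp n (\<lambda>xs. P)"
  unfolding recp_def by (rule rec_const)

lemma recp_ex:
  assumes "recp (Suc n) (\<lambda>ys. P (hd ys) (tl ys))" "rec n b"
  shows "recp n (\<lambda>xs. \<exists>i<b xs. P i xs)"
proof -
  have "recp n (\<lambda>xs. 0 < (\<Sum>i<b xs. of_bool (P i xs) :: nat))"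
    using assms(1)[unfolded recp_def] by (intro recp_less rec_zero rec_sum assms(2))
  moreover have "0 < (\<Sum>i<m. of_bool (Q i) :: nat) \<longleftrightarrow> (\<exists>i<m. Q i)" for Q and m :: nat
    by (auto simp: card_gt_0_iff)
  ultimately show ?thesis by simp
qed

lemma recp_all:
  assumes "recp (Suc n) (\<lambda>ys. P (hd ys) (tl ys))" "rec n b"
  shows "recp n (\<lambda>xs. \<forall>i<b xs. P i xs)"
  using recp_not[OF recp_ex[OF recp_not[OF assms(1)] assms(2)]] by simp

lemma recp_finite_ex:
  assumes "finite S" "\<And>j. j \<in> S \<Longrightarrow> recp n (P j)" shows "recp n (\<lambda>xs. \<exists>j\<in>S. P j xs)"
  using assms by (induction S) (simp_all add: recp_const recp_disj)

lemma rec_if: "recp n P \<Longrightarrow> rec n a \<Longrightarrow> rec n b \<Longrightarrow> rec n (\<lambda>xs. if P xs then a xs else b xs)"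
proof -
  assume "recp n P" "rec n a" "rec n b"
  moreover from this have "recp n (\<lambda>xs. \<not> P xs)" by (intro recp_not)
  ultimately have "rec n (\<lambda>xs. of_bool (P xs) * a xs + of_bool (\<not> P xs) * b xs)"
    unfolding recp_def by (intro rec_add rec_mult)
  then show ?thesis by (rule rec_cong) auto
qed

lemma rec_prod_encode:
  assumes "rec n a" "rec n b" shows "rec n (\<lambda>xs. prod_encode (a xs, b xs))"
proof -
  have "triangle m = (\<Sum>i<Suc m. i)" for m by (induction m) (auto simp: triangle_def)
  moreover have "rec n (\<lambda>xs. (\<Sum>i<Suc (a xs + b xs). i) + a xs)"
    by (intro rec_add rec_sum rec_hd rec_Suc assms)
  ultimately show ?thesis by (simp add: prod_encode_def)
qed

lemma prod_encode_ge: "a \<le> prod_encode (a, b)" "b \<le> prod_encode (a, b)"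
  by (auto simp: le_prod_encode_1 le_prod_encode_2)

lemma prod_decode_bound: "fst (prod_decode z) \<le> z" "snd (prod_decode z) \<le> z"
  using prod_encode_ge(1)[of "fst (prod_decode z)" "snd (prod_decode z)"]
    prod_encode_ge(2)[of "snd (prod_decode z)" "fst (prod_decode z)"] by simp_all

text \<open>Sums stand in for bounded search: exactly one summand is nonzero.\<close>

lemma rec_fst_decode:
  assumes "rec n a" shows "rec n (\<lambda>xs. fst (prod_decode (a xs)))"
proof -
  have "rec n (\<lambda>xs. \<Sum>i<Suc (a xs). if \<exists>j<Suc (a xs). prod_encode (i, j) = a xs then i else 0)"
    by (intro rec_sum rec_if recp_ex recp_eq rec_prod_encode rec_Suc assms rec_hd rec_zero rec_weaken)
  moreover have "(\<Sum>i<Suc z. if \<exists>j<Suc z. prod_encode (i, j) = z then i else 0) = fst (prod_decode z)" for z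
  proof -
    have "(\<Sum>i<Suc z. if \<exists>j<Suc z. prod_encode (i, j) = z then i else 0)
        = (\<Sum>i<Suc z. if i = fst (prod_decode z) then i else 0)"
    proof (rule sum.cong[OF refl], rule if_cong)
      fix i
      have "prod_encode (i, j) = z \<longleftrightarrow> (i, j) = prod_decode z" for j
        by (metis prod_decode_inverse prod_encode_inverse)
      then show "(\<exists>j<Suc z. prod_encode (i, j) = z) \<longleftrightarrow> i = fst (prod_decode z)"
        using prod_decode_bound[of z] by (auto simp: prod_eq_iff less_Suc_eq_le)
    qed auto
    also have "\<dots> = fst (prod_decode z)"
      using prod_decode_bound[of z] by (simp add: less_Suc_eq_le)
    finally show ?thesis .
  qed
  ultimately show ?thesis by simp
qed

lemma rec_snd_decode:
  assumes "rec n a" shows "rec n (\<lambda>xs. snd (prod_decode (a xs)))"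
proof -
  have "rec n (\<lambda>xs. \<Sum>i<Suc (a xs). if prod_encode (fst (prod_decode (a xs)), i) = a xs then i else 0)"
    by (intro rec_sum rec_if recp_eq rec_prod_encode rec_Suc assms rec_hd rec_zero rec_weaken rec_fst_decode)
  moreover have "(\<Sum>i<Suc z. if prod_encode (fst (prod_decode z), i) = z then i else 0) = snd (prod_decode z)" for z
  proof -
    have "prod_encode (fst (prod_decode z), i) = z \<longleftrightarrow> i = snd (prod_decode z)" for i
      by (metis prod_decode_inverse prod_encode_inverse prod.collapse snd_conv)
    then show ?thesis using prod_decode_bound[of z] by (simp add: less_Suc_eq_le)
  qed
  ultimately show ?thesis by simp
qed

lemma recp_set_decode:
  assumes "rec n a" "rec n b" shows "recp n (\<lambda>xs. a xs \<in> set_decode (b xs))"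
proof -
  have "x \<in> set_decode y \<longleftrightarrow> (\<exists>q<Suc y. \<exists>r<2 ^ x. y = (2 * q + 1) * 2 ^ x + r)" (is "_ \<longleftrightarrow> ?R") for x y :: nat
  proof
    assume "x \<in> set_decode y"
    then have "odd (y div 2 ^ x)" by (simp add: set_decode_def)
    then obtain q where q: "y div 2 ^ x = 2 * q + 1" by (auto elim: oddE)
    then have "y = (2 * q + 1) * 2 ^ x + y mod 2 ^ x" using div_mult_mod_eq[of y "2 ^ x"] by simp
    moreover have "q < Suc y" using q div_le_dividend[of y "2 ^ x"] by simp
    ultimately show ?R by (intro exI[of _ q] exI[of _ "y mod 2 ^ x"] conjI) auto
  next
    assume ?R
    then obtain q r where "r < 2 ^ x" "y = (2 * q + 1) * 2 ^ x + r" by blast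
    then have "y div 2 ^ x = 2 * q + 1" using div_mult_self3[of "2 ^ x" "2 * q + 1" r] by simp
    then show "x \<in> set_decode y" by (simp add: set_decode_def)
  qed
  moreover have "recp n (\<lambda>xs. \<exists>q<Suc (b xs). \<exists>r<2 ^ a xs. b xs = (2 * q + 1) * 2 ^ a xs + r)"
    by (intro recp_ex recp_eq rec_add rec_mult rec_const rec_power2 rec_Suc assms rec_hd rec_weaken)
  ultimately show ?thesis by simp
qed

lemma recp_finite_all:
  assumes "\<And>x. x \<in> set ys \<Longrightarrow> recp n (P x)" shows "recp n (\<lambda>xs. \<forall>x\<in>set ys. P x xs)"
  using assms by (induction ys) (simp_all add: recp_const recp_conj)

lemma rec_list_encode:
  assumes "\<And>a. a \<in> set as \<Longrightarrow> rec n a" shows "rec n (\<lambda>xs. list_encode (map (\<lambda>a. a xs) as))"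
  using assms by (induction as) (simp_all add: rec_zero rec_Suc rec_prod_encode)

lemmas rec_intros = rec_hd rec_const rec_add rec_mult rec_diff rec_power2 rec_sum rec_Suc
  rec_prod_encode rec_fst_decode rec_snd_decode
  recp_less recp_le recp_eq recp_not recp_conj recp_disj recp_imp recp_iff recp_const
  recp_ex recp_all recp_set_decode rec_if

section \<open>Structures with built-in arithmetic and their ordered sums\<close>

text \<open>Meant for variables only; the formulas over the sum contain no constants.\<close>

fun tvar :: "tm \<Rightarrow> nat" where
  "tvar (Var x) = x"
| "tvar (Const l) = 0"

lemma sat_cong: "(\<And>x. x \<in> free_vars \<phi> \<Longrightarrow> s x = s' x) \<Longrightarrow> sat A s \<phi> \<longleftrightarrow> sat A s' \<phi>"
proof (induction \<phi> arbitrary: s s')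
  case (Eq t u)
  have "tm_val A s v = tm_val A s' v" if "tm_vars v \<subseteq> free_vars (Eq t u)" for v
    using Eq that by (cases v) auto
  from this[of t] this[of u] show ?case by simp
next
  case (Rel R ts)
  have "tm_val A s t = tm_val A s' t" if "t \<in> set ts" for t
  proof (cases t)
    case (Var x)
    then have "x \<in> free_vars (Rel R ts)" using that by (auto intro!: bexI[of _ "Var x"])
    then show ?thesis using Rel Var by simp
  qed simp
  then have "map (tm_val A s) ts = map (tm_val A s') ts" by simp
  then show ?case by (simp del: map_eq_conv)
next
  case (Neg \<phi>)
  have "sat A s \<phi> \<longleftrightarrow> sat A s' \<phi>" by (rule Neg.IH) (simp add: Neg.prems)
  then show ?case by simp
next
  case (Or \<phi> \<psi>)
  have "sat A s \<phi> \<longleftrightarrow> sat A s' \<phi>" by (rule Or.IH) (simp add: Or.prems)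
  moreover have "sat A s \<psi> \<longleftrightarrow> sat A s' \<psi>" by (rule Or.IH) (simp add: Or.prems)
  ultimately show ?case by simp
next
  case (Ex x \<phi>)
  have "sat A (s(x := a)) \<phi> \<longleftrightarrow> sat A (s'(x := a)) \<phi>" for a
    by (rule Ex.IH) (simp add: Ex.prems)
  then show ?case by simp
qed

lemma models_iff_sat:
  assumes "free_vars \<phi> = {}" "universe A \<noteq> {}"
  shows "models A \<phi> \<longleftrightarrow> sat A s \<phi>"
proof -
  obtain a where "a \<in> universe A" using assms(2) by blast
  then have "range (\<lambda>x::nat. a) \<subseteq> universe A" by auto
  moreover have "sat A s \<phi> \<longleftrightarrow> sat A s' \<phi>" for s' by (rule sat_cong) (simp add: assms)
  ultimately show ?thesis unfolding models_def by blast
qed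

definition arith_pos :: "'a struct \<Rightarrow> 'a \<Rightarrow> nat" where
  "arith_pos A a = card {b \<in> universe A. [b, a] \<in> rel A Less}"

lemma ARITHM_iso:
  assumes "A \<in> ARITHM \<tau>"
  obtains \<pi> where "struct_iso \<pi> (reduct arith_voc A) (arith (card (universe A)))"
    "\<And>a. a \<in> universe A \<Longrightarrow> \<pi> a = arith_pos A a"
proof -
  obtain n \<pi> where \<pi>: "struct_iso \<pi> (reduct arith_voc A) (arith n)"
    using assms by (auto simp: ARITHM_def isomorphic_def)
  from that[of \<pi>] show ?thesis
    using \<pi> arith_iso_card[OF \<pi>] arith_iso_pos[OF \<pi>] by (simp add: arith_pos_def)
qed

lemma ARITHM_universe: "A \<in> ARITHM \<tau> \<Longrightarrow> finite (universe A)" "A \<in> ARITHM \<tau> \<Longrightarrow> universe A \<noteq> {}"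
  by (auto simp: ARITHM_def structures_def)

lemma ARITHM_rel: "A \<in> ARITHM \<tau> \<Longrightarrow> xs \<in> rel A R \<Longrightarrow> R \<in> \<tau> \<and> length xs = arity R \<and> set xs \<subseteq> universe A"
  by (cases "R \<in> \<tau>") (auto simp: ARITHM_def structures_def)

lemma arith_pos_bij:
  assumes "A \<in> ARITHM \<tau>"
  shows "bij_betw (arith_pos A) (universe A) {..<card (universe A)}"
proof -
  obtain \<pi> where \<pi>: "struct_iso \<pi> (reduct arith_voc A) (arith (card (universe A)))"
    "\<And>a. a \<in> universe A \<Longrightarrow> \<pi> a = arith_pos A a" using ARITHM_iso[OF assms] by blast
  then have "bij_betw \<pi> (universe A) {..<card (universe A)}"
    by (simp add: struct_iso_def reduct_def arith_def)
  then show ?thesis using bij_betw_cong[of "universe A" \<pi> "arith_pos A"] \<pi>(2) by blast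
qed

lemma arith_pos_less: "A \<in> ARITHM \<tau> \<Longrightarrow> a \<in> universe A \<Longrightarrow> arith_pos A a < card (universe A)"
  using arith_pos_bij[of A \<tau>] by (auto dest: bij_betwE)

lemma arith_rel_iff:
  assumes A: "A \<in> ARITHM \<tau>" and a: "a \<in> universe A" "b \<in> universe A"
  shows "[a, b] \<in> rel A Less \<longleftrightarrow> arith_pos A a < arith_pos A b"
    and "c \<in> universe A \<Longrightarrow> [a, b, c] \<in> rel A Add \<longleftrightarrow> arith_pos A c = arith_pos A a + arith_pos A b"
    and "c \<in> universe A \<Longrightarrow> [a, b, c] \<in> rel A Mult \<longleftrightarrow> arith_pos A c = arith_pos A a * arith_pos A b"
proof -
  obtain \<pi> where \<pi>: "struct_iso \<pi> (reduct arith_voc A) (arith (card (universe A)))"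
    "\<And>a. a \<in> universe A \<Longrightarrow> \<pi> a = arith_pos A a" using ARITHM_iso[OF A] by blast
  have rel: "xs \<in> rel A R \<longleftrightarrow> map \<pi> xs \<in> rel (arith (card (universe A))) R"
    if "R \<in> arith_voc" "set xs \<subseteq> universe A" for xs R
  proof -
    have "xs \<in> rel (reduct arith_voc A) R \<longleftrightarrow> map \<pi> xs \<in> rel (arith (card (universe A))) R"
      using \<pi>(1) that(2) unfolding struct_iso_def by (simp add: reduct_def)
    then show ?thesis using that(1) by (simp add: reduct_def)
  qed
  note lt = arith_pos_less[OF A]
  show "[a, b] \<in> rel A Less \<longleftrightarrow> arith_pos A a < arith_pos A b"
    using a lt by (subst rel) (auto simp: arith_voc_def arith_def \<pi>(2))
  show "[a, b, c] \<in> rel A Add \<longleftrightarrow> arith_pos A c = arith_pos A a + arith_pos A b"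
    if "c \<in> universe A" using a that lt[of a] lt[of b] lt[of c]
    by (subst rel) (auto simp: arith_voc_def arith_def \<pi>(2))
  show "[a, b, c] \<in> rel A Mult \<longleftrightarrow> arith_pos A c = arith_pos A a * arith_pos A b"
    if "c \<in> universe A" using a that lt[of a] lt[of b] lt[of c]
    by (subst rel) (auto simp: arith_voc_def arith_def \<pi>(2))
qed

lemma arith_elem_pos:
  assumes "A \<in> ARITHM \<tau>" "a \<in> universe A" shows "arith_elem A (arith_pos A a) = a"
  using ARITHM_iso[OF assms(1)] arith_elem_eq assms(2) by metis

lemma arith_elem_in:
  assumes "A \<in> ARITHM \<tau>" "i < card (universe A)"
  shows "arith_elem A i \<in> universe A" "arith_pos A (arith_elem A i) = i"
proof -
  have "i \<in> arith_pos A ` universe A"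
    using arith_pos_bij[OF assms(1)] assms(2) by (simp add: bij_betw_def)
  then obtain a where "a \<in> universe A" "arith_pos A a = i" by blast
  then show "arith_elem A i \<in> universe A" "arith_pos A (arith_elem A i) = i"
    using arith_elem_pos[OF assms(1)] by auto
qed

lemma bex_universe_iff:
  assumes "A \<in> ARITHM \<tau>"
  shows "(\<exists>a\<in>universe A. Q a) \<longleftrightarrow> (\<exists>i<card (universe A). Q (arith_elem A i))"
  using arith_elem_in[OF assms] arith_elem_pos[OF assms] arith_pos_less[OF assms] by metis

lemma sum_less_iff:
  "[Inl a, Inl b] \<in> sum_less A A' \<longleftrightarrow> [a, b] \<in> rel A Less"
  "[Inr c, Inr d] \<in> sum_less A A' \<longleftrightarrow> [c, d] \<in> rel A' Less"
  "[Inl a, Inr d] \<in> sum_less A A' \<longleftrightarrow> a \<in> universe A \<and> d \<in> universe A'"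
  "[Inr d, Inl a] \<notin> sum_less A A'"
  by (auto simp: sum_less_def map_eq_Cons_conv Cons_eq_map_conv image_iff)

lemma sum_pos_Inl: "sum_pos A A' (Inl a) = arith_pos A a"
proof -
  have "{y \<in> sum_univ A A'. [y, Inl a] \<in> sum_less A A'} = Inl ` {b \<in> universe A. [b, a] \<in> rel A Less}"
    by (auto simp: sum_univ_def sum_less_iff)
  then show ?thesis by (simp add: sum_pos_def arith_pos_def card_image)
qed

lemma sum_pos_Inr:
  assumes "finite (universe A)" "finite (universe A')" "b \<in> universe A'"
  shows "sum_pos A A' (Inr b) = card (universe A) + arith_pos A' b"
proof -
  have "{y \<in> sum_univ A A'. [y, Inr b] \<in> sum_less A A'} =
      Inl ` universe A \<union> Inr ` {c \<in> universe A'. [c, b] \<in> rel A' Less}"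
    using assms by (auto simp: sum_univ_def sum_less_iff)
  moreover have "card (Inl ` universe A \<union> Inr ` {c \<in> universe A'. [c, b] \<in> rel A' Less}) =
      card (universe A) + arith_pos A' b"
    using assms by (subst card_Un_disjoint) (auto simp: card_image arith_pos_def)
  ultimately show ?thesis by (simp add: sum_pos_def)
qed

lemma struct_sum_simps:
  "universe (struct_sum U A A') = sum_univ A A'"
  "rel (struct_sum U A A') U = {[Inr b] | b. b \<in> universe A'}"
  "Sym r i \<noteq> U \<Longrightarrow> rel (struct_sum U A A') (Sym r i) = map Inl ` rel A (Sym r i) \<union> map Inr ` rel A' (Sym r i)"
  by (auto simp: struct_sum_def)

lemma struct_sum_arith_rel:
  assumes A: "A \<in> ARITHM \<tau>" and A': "A' \<in> ARITHM \<tau>'"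
    and voc: "\<tau> \<inter> \<tau>' = arith_voc" and U: "arity U = 1"
    and x: "x \<in> sum_univ A A'" "y \<in> sum_univ A A'"
  shows "[x, y] \<in> rel (struct_sum U A A') Less \<longleftrightarrow> sum_pos A A' x < sum_pos A A' y"
    and "z \<in> sum_univ A A' \<Longrightarrow>
      [x, y, z] \<in> rel (struct_sum U A A') Add \<longleftrightarrow> sum_pos A A' z = sum_pos A A' x + sum_pos A A' y"
    and "z \<in> sum_univ A A' \<Longrightarrow>
      [x, y, z] \<in> rel (struct_sum U A A') Mult \<longleftrightarrow> sum_pos A A' z = sum_pos A A' x * sum_pos A A' y"
proof -
  have "Less \<noteq> U" using U by auto
  then have "sum_pos A A' = arith_pos (struct_sum U A A')"
    by (auto simp: fun_eq_iff sum_pos_def arith_pos_def struct_sum_def)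
  then show "[x, y] \<in> rel (struct_sum U A A') Less \<longleftrightarrow> sum_pos A A' x < sum_pos A A' y"
    "z \<in> sum_univ A A' \<Longrightarrow>
      [x, y, z] \<in> rel (struct_sum U A A') Add \<longleftrightarrow> sum_pos A A' z = sum_pos A A' x + sum_pos A A' y"
    "z \<in> sum_univ A A' \<Longrightarrow>
      [x, y, z] \<in> rel (struct_sum U A A') Mult \<longleftrightarrow> sum_pos A A' z = sum_pos A A' x * sum_pos A A' y"
    using arith_rel_iff[OF struct_sum_ARITHM[OF A A' voc U], of x y] x by (simp_all add: struct_sum_simps)
qed

lemma expand_consts_simps:
  "universe (expand_consts h A) = universe A" "rel (expand_consts h A) = rel A"
  "l < h \<Longrightarrow> l < card (universe A) \<Longrightarrow> con (expand_consts h A) l = Some (arith_elem A l)"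
  "l < h \<Longrightarrow> card (universe A) \<le> l \<Longrightarrow>
    con (expand_consts h A) l = Some (arith_elem A (card (universe A) - 1))"
  by (auto simp: expand_consts_def)

section \<open>Eliminating the precomputed structure from a sentence\<close>

definition Tru :: fm where "Tru = Eq (Const 0) (Const 0)"
definition decide :: "bool \<Rightarrow> fm" where "decide b = (if b then Tru else Neg Tru)"
definition And :: "fm \<Rightarrow> fm \<Rightarrow> fm" where "And \<phi> \<psi> = Neg (Or (Neg \<phi>) (Neg \<psi>))"
definition BigOr :: "nat \<Rightarrow> (nat \<Rightarrow> fm) \<Rightarrow> fm" where
  "BigOr n F = rec_nat (decide False) (\<lambda>i. Or (F i)) n"

lemma sat_decide [simp]: "sat A s (decide b) \<longleftrightarrow> b"
  by (simp add: decide_def Tru_def)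

lemma sat_And [simp]: "sat A s (And \<phi> \<psi>) \<longleftrightarrow> sat A s \<phi> \<and> sat A s \<psi>"
  by (simp add: And_def)

lemma sat_BigOr [simp]: "sat A s (BigOr n F) \<longleftrightarrow> (\<exists>i<n. sat A s (F i))"
  by (induction n) (auto simp: BigOr_def less_Suc_eq)

lemma quantifier_rank_connectives [simp]:
  "quantifier_rank (decide b) = 0"
  "quantifier_rank (And \<phi> \<psi>) = max (quantifier_rank \<phi>) (quantifier_rank \<psi>)"
  by (auto simp: decide_def Tru_def And_def)

lemma quantifier_rank_BigOr: "(\<And>i. i < n \<Longrightarrow> quantifier_rank (F i) \<le> q) \<Longrightarrow> quantifier_rank (BigOr n F) \<le> q"
  by (induction n) (auto simp: BigOr_def)

lemma free_vars_connectives [simp]: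
  "free_vars (decide b) = {}" "free_vars (And \<phi> \<psi>) = free_vars \<phi> \<union> free_vars \<psi>"
  by (auto simp: decide_def Tru_def And_def)

lemma free_vars_BigOr [simp]: "free_vars (BigOr n F) = (\<Union>i<n. free_vars (F i))"
  by (induction n) (auto simp: BigOr_def lessThan_Suc)

lemma fm_over_connectives [simp]:
  "fm_over \<tau> h (decide b) \<longleftrightarrow> 0 < h"
  "fm_over \<tau> h (And \<phi> \<psi>) \<longleftrightarrow> fm_over \<tau> h \<phi> \<and> fm_over \<tau> h \<psi>"
  by (auto simp: decide_def Tru_def And_def)

lemma fm_over_BigOr [simp]: "fm_over \<tau> h (BigOr n F) \<longleftrightarrow> 0 < h \<and> (\<forall>i<n. fm_over \<tau> h (F i))"
  by (induction n) (auto simp: BigOr_def less_Suc_eq)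

text \<open>In \<open>small\<close>, for a structure with \<open>n\<close> elements, a number \<open>v < n\<close> names the element at position \<open>v\<close>, and
  \<open>n + l\<close> names the element \<open>l\<close> of the precomputed structure \<open>P\<close>. All quantifiers become disjunctions, so
  only atoms over the vocabulary of the input structure survive. The number \<open>u\<close> bounds the universe of \<open>P\<close>.\<close>

definition code_pos :: "nat struct \<Rightarrow> nat \<Rightarrow> nat \<Rightarrow> nat" where
  "code_pos P n v = (if v < n then v else n + arith_pos P (v - n))"

definition small_atom :: "symb set \<Rightarrow> symb \<Rightarrow> nat struct \<Rightarrow> nat \<Rightarrow> symb \<Rightarrow> nat list \<Rightarrow> fm" where
  "small_atom \<tau> U P n R vs = (if R = U then decide (n \<le> vs ! 0) else (case R of
      Less \<Rightarrow> decide (code_pos P n (vs ! 0) < code_pos P n (vs ! 1))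
    | Add \<Rightarrow> decide (code_pos P n (vs ! 2) = code_pos P n (vs ! 0) + code_pos P n (vs ! 1))
    | Mult \<Rightarrow> decide (code_pos P n (vs ! 2) = code_pos P n (vs ! 0) * code_pos P n (vs ! 1))
    | Sym r i \<Rightarrow> Or (if R \<in> \<tau> \<and> (\<forall>v\<in>set vs. v < n) then Rel R (map Const vs) else decide False)
        (decide ((\<forall>v\<in>set vs. n \<le> v) \<and> map (\<lambda>v. v - n) vs \<in> rel P R))))"

fun small :: "symb set \<Rightarrow> symb \<Rightarrow> nat struct \<Rightarrow> nat \<Rightarrow> nat \<Rightarrow> (nat \<Rightarrow> nat) \<Rightarrow> fm \<Rightarrow> fm" where
  "small \<tau> U P u n e (Eq s t) = decide (e (tvar s) = e (tvar t))"
| "small \<tau> U P u n e (Rel R ts) = small_atom \<tau> U P n R (map (\<lambda>t. e (tvar t)) ts)"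
| "small \<tau> U P u n e (Neg \<phi>) = Neg (small \<tau> U P u n e \<phi>)"
| "small \<tau> U P u n e (Or \<phi> \<psi>) = Or (small \<tau> U P u n e \<phi>) (small \<tau> U P u n e \<psi>)"
| "small \<tau> U P u n e (Ex x \<phi>) = Or (BigOr n (\<lambda>v. small \<tau> U P u n (e(x := v)) \<phi>))
     (BigOr u (\<lambda>l. if l \<in> universe P then small \<tau> U P u n (e(x := n + l)) \<phi> else decide False))"

text \<open>In a structure with \<open>n\<close> elements this says \<open>x + y = n + l\<close>, although \<open>n + l\<close> is out of range: there is
  \<open>w\<close> with \<open>y = w + (l + 1)\<close> such that \<open>x + w\<close> is the last element.\<close>

definition sum_formula :: "nat \<Rightarrow> nat \<Rightarrow> nat \<Rightarrow> fm" where
  "sum_formula x y l = (let w = Suc (x + y) in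
     Ex w (And (Rel Add [Var w, Const (Suc l), Var y])
       (Ex (w + 1) (And (Rel Add [Var x, Var w, Var (w + 1)])
         (Neg (Ex (w + 2) (Rel Less [Var (w + 1), Var (w + 2)])))))))"

text \<open>This says \<open>x * y = n + l\<close> via \<open>x * (y - 1) + x\<close>, provided that \<open>x * (y - 1) < n\<close>. That proviso holds for
  \<open>(x, y)\<close> or for \<open>(y, x)\<close> as soon as \<open>n > l * l\<close>.\<close>

definition prod_formula :: "nat \<Rightarrow> nat \<Rightarrow> nat \<Rightarrow> fm" where
  "prod_formula x y l = (let w = Suc (x + y) in
     Ex w (And (Rel Add [Var w, Const 1, Var y])
       (Ex (w + 1) (And (Rel Mult [Var x, Var w, Var (w + 1)]) (sum_formula (w + 1) x l)))))"

text \<open>In \<open>big\<close>, which is correct only for large structures, \<open>e x = 0\<close> means that \<open>x\<close> ranges over the input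
  structure, and \<open>e x = l + 1\<close> that \<open>x\<close> has been replaced by the element \<open>l\<close> of \<open>P\<close>.\<close>

definition big_add :: "nat struct \<Rightarrow> (nat \<Rightarrow> nat) \<Rightarrow> nat \<Rightarrow> nat \<Rightarrow> nat \<Rightarrow> fm" where
  "big_add P e x y z = (let p = (\<lambda>v. arith_pos P (e v - 1)) in
     if e x = 0 \<and> e y = 0 \<and> e z = 0 then Rel Add [Var x, Var y, Var z]
     else if e x = 0 \<and> e y = 0 then sum_formula x y (p z)
     else if e x = 0 \<and> e z \<noteq> 0 \<and> p y \<le> p z then Eq (Var x) (Const (p z - p y))
     else if e y = 0 \<and> e z \<noteq> 0 \<and> p x \<le> p z then Eq (Var y) (Const (p z - p x))
     else decide False)"

definition big_mult :: "nat struct \<Rightarrow> (nat \<Rightarrow> nat) \<Rightarrow> nat \<Rightarrow> nat \<Rightarrow> nat \<Rightarrow> fm" where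
  "big_mult P e x y z = (let p = (\<lambda>v. arith_pos P (e v - 1)) in
     if e x = 0 \<and> e y = 0 \<and> e z = 0 then Rel Mult [Var x, Var y, Var z]
     else if e x = 0 \<and> e y = 0 then Or (prod_formula x y (p z)) (prod_formula y x (p z))
     else if e x = 0 \<and> e z \<noteq> 0 then And (Eq (Var x) (Const 1)) (decide (p y = p z))
     else if e y = 0 \<and> e z \<noteq> 0 then And (Eq (Var y) (Const 1)) (decide (p x = p z))
     else if e x = 0 then And (Eq (Var x) (Const 0)) (Eq (Var z) (Const 0))
     else if e y = 0 then And (Eq (Var y) (Const 0)) (Eq (Var z) (Const 0))
     else decide False)"

definition big_atom :: "symb set \<Rightarrow> symb \<Rightarrow> nat struct \<Rightarrow> (nat \<Rightarrow> nat) \<Rightarrow> symb \<Rightarrow> nat list \<Rightarrow> fm" where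
  "big_atom \<tau> U P e R xs = (if R = U then decide (e (xs ! 0) \<noteq> 0) else (case R of
      Less \<Rightarrow> if e (xs ! 0) = 0 \<and> e (xs ! 1) = 0 then Rel Less [Var (xs ! 0), Var (xs ! 1)]
        else decide (e (xs ! 1) \<noteq> 0 \<and>
          (e (xs ! 0) = 0 \<or> arith_pos P (e (xs ! 0) - 1) < arith_pos P (e (xs ! 1) - 1)))
    | Add \<Rightarrow> big_add P e (xs ! 0) (xs ! 1) (xs ! 2)
    | Mult \<Rightarrow> big_mult P e (xs ! 0) (xs ! 1) (xs ! 2)
    | Sym r i \<Rightarrow> Or (if R \<in> \<tau> \<and> (\<forall>x\<in>set xs. e x = 0) then Rel R (map Var xs) else decide False)
        (decide ((\<forall>x\<in>set xs. e x \<noteq> 0) \<and> map (\<lambda>x. e x - 1) xs \<in> rel P R))))"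

fun big :: "symb set \<Rightarrow> symb \<Rightarrow> nat struct \<Rightarrow> nat \<Rightarrow> (nat \<Rightarrow> nat) \<Rightarrow> fm \<Rightarrow> fm" where
  "big \<tau> U P u e (Eq s t) = (if e (tvar s) = 0 \<and> e (tvar t) = 0 then Eq (Var (tvar s)) (Var (tvar t))
     else decide (e (tvar s) = e (tvar t)))"
| "big \<tau> U P u e (Rel R ts) = big_atom \<tau> U P e R (map tvar ts)"
| "big \<tau> U P u e (Neg \<phi>) = Neg (big \<tau> U P u e \<phi>)"
| "big \<tau> U P u e (Or \<phi> \<psi>) = Or (big \<tau> U P u e \<phi>) (big \<tau> U P u e \<psi>)"
| "big \<tau> U P u e (Ex x \<phi>) = Or (Ex x (big \<tau> U P u (e(x := 0)) \<phi>))
     (BigOr u (\<lambda>l. if l \<in> universe P then big \<tau> U P u (e(x := Suc l)) \<phi> else decide False))"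

lemma quantifier_rank_formulas [simp]:
  "quantifier_rank (sum_formula x y l) = 3" "quantifier_rank (prod_formula x y l) = 5"
  by (auto simp: sum_formula_def prod_formula_def Let_def)

lemma free_vars_formulas [simp]:
  "free_vars (sum_formula x y l) = {x, y}" "free_vars (prod_formula x y l) = {x, y}"
  by (auto simp: sum_formula_def prod_formula_def Let_def)

lemma fm_over_formulas:
  assumes "arith_voc \<subseteq> \<tau>" "Suc l < h"
  shows "fm_over \<tau> h (sum_formula x y l)" "fm_over \<tau> h (prod_formula x y l)"
  using assms by (auto simp: sum_formula_def prod_formula_def Let_def arith_voc_def)

lemma fm_over_tm: "fm_over \<sigma> 0 (Rel R ts) \<Longrightarrow> t \<in> set ts \<Longrightarrow> t = Var (tvar t)"
  by (cases t) auto

lemma fm_over_Eq: "fm_over \<sigma> 0 (Eq s t) \<Longrightarrow> s = Var (tvar s) \<and> t = Var (tvar t)"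
  by (cases s; cases t) auto

lemma quantifier_rank_small: "quantifier_rank (small \<tau> U P u n e \<phi>) = 0"
proof (induction \<phi> arbitrary: e)
  case (Rel R ts)
  then show ?case by (auto simp: small_atom_def split: symb.split)
next
  case (Ex x \<phi>)
  then show ?case using quantifier_rank_BigOr[where q = 0] by auto
qed auto

lemma free_vars_small: "free_vars (small \<tau> U P u n e \<phi>) = {}"
proof (induction \<phi> arbitrary: e)
  case (Rel R ts)
  then show ?case by (auto simp: small_atom_def split: symb.split if_splits)
next
  case (Ex x \<phi>)
  then show ?case by (auto split: if_splits)
qed auto

lemma fm_over_small:
  assumes "fm_over \<sigma> 0 \<phi>" "n < h" shows "fm_over \<tau> h (small \<tau> U P u n e \<phi>)"
  using assms
proof (induction \<phi> arbitrary: e)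
  case (Rel R ts)
  let ?vs = "map (\<lambda>t. e (tvar t)) ts"
  have "(\<Union>t\<in>set (map Const ?vs). tm_consts t) \<subseteq> {..<h}" if "\<forall>v\<in>set ?vs. v < n"
    using that Rel(2) by auto
  moreover have "length ?vs = arity R" using Rel(1) by simp
  ultimately have "R \<in> \<tau> \<and> (\<forall>v\<in>set ?vs. v < n) \<Longrightarrow> fm_over \<tau> h (Rel R (map Const ?vs))"
    by simp
  moreover have "0 < h" using Rel(2) by simp
  ultimately show ?case by (cases R) (simp_all add: small_atom_def)
next
  case (Ex x \<phi>)
  then show ?case by auto
qed auto

lemma quantifier_rank_big: "quantifier_rank (big \<tau> U P u e \<phi>) \<le> quantifier_rank \<phi> + 5"
proof (induction \<phi> arbitrary: e)
  case (Rel R ts)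
  then show ?case by (auto simp: big_atom_def big_add_def big_mult_def Let_def split: symb.split)
next
  case (Or \<phi> \<psi>)
  show ?case using Or(1)[of e] Or(2)[of e] by (simp add: max_def)
next
  case (Ex x \<phi>)
  have "quantifier_rank (BigOr u (\<lambda>l. if l \<in> universe P then big \<tau> U P u (e(x := Suc l)) \<phi> else decide False))
      \<le> quantifier_rank \<phi> + 5"
    by (rule quantifier_rank_BigOr) (use Ex in auto)
  moreover have "quantifier_rank (big \<tau> U P u (e(x := 0)) \<phi>) \<le> quantifier_rank \<phi> + 5" by (rule Ex)
  ultimately show ?case by simp
qed auto

lemma free_vars_big:
  assumes "fm_over (\<tau> \<union> \<tau>' \<union> {U}) 0 \<phi>"
  shows "free_vars (big \<tau> U P u e \<phi>) \<subseteq> {x \<in> free_vars \<phi>. e x = 0}"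
  using assms
proof (induction \<phi> arbitrary: e)
  case (Eq s t)
  then show ?case by (cases s; cases t) auto
next
  case (Rel R ts)
  define xs where "xs = map tvar ts"
  have ts: "ts = map Var xs" using fm_over_tm[OF Rel] by (simp add: xs_def list_eq_iff_nth_eq)
  have len: "length xs = arity R" using Rel by (simp add: ts)
  have "free_vars (big_atom \<tau> U P e R xs) \<subseteq> {x \<in> set xs. e x = 0}"
  proof (cases R)
    case Less
    then obtain x y where "xs = [x, y]" using len by (auto simp: numeral_2_eq_2 length_Suc_conv)
    then show ?thesis using Less by (auto simp: big_atom_def)
  next
    case Add
    then obtain x y z where "xs = [x, y, z]" using len by (auto simp: numeral_3_eq_3 length_Suc_conv)
    then show ?thesis using Add by (auto simp: big_atom_def big_add_def Let_def)
  next
    case Mult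
    then obtain x y z where "xs = [x, y, z]" using len by (auto simp: numeral_3_eq_3 length_Suc_conv)
    then show ?thesis using Mult by (auto simp: big_atom_def big_mult_def Let_def)
  next
    case (Sym r i)
    then show ?thesis by (auto simp: big_atom_def)
  qed
  then show ?case by (simp add: ts comp_def)
next
  case (Ex x \<phi>)
  have IH: "y \<in> free_vars \<phi> \<and> (e(x := v)) y = 0" if "y \<in> free_vars (big \<tau> U P u (e(x := v)) \<phi>)" for v y
  proof -
    have "fm_over (\<tau> \<union> \<tau>' \<union> {U}) 0 \<phi>" using Ex.prems by simp
    from subsetD[OF Ex.IH[OF this] that] show ?thesis by blast
  qed
  show ?case
  proof
    fix y assume "y \<in> free_vars (big \<tau> U P u e (Ex x \<phi>))"
    then consider "y \<in> free_vars (big \<tau> U P u (e(x := 0)) \<phi>)" "y \<noteq> x"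
      | l where "y \<in> free_vars (big \<tau> U P u (e(x := Suc l)) \<phi>)" by (auto split: if_splits)
    then show "y \<in> {y \<in> free_vars (Ex x \<phi>). e y = 0}"
    proof cases
      case 1
      then show ?thesis using IH[of y 0] by auto
    next
      case 2
      then show ?thesis using IH[of y "Suc l"] by (cases "y = x") auto
    qed
  qed
next
  case (Neg \<phi>)
  then show ?case by simp
next
  case (Or \<phi> \<psi>)
  then show ?case using Or.IH(1)[of e] Or.IH(2)[of e] by auto
qed

lemma fm_over_big:
  assumes "fm_over (\<tau> \<union> \<tau>' \<union> {U}) 0 \<phi>" "arith_voc \<subseteq> \<tau>"
    "\<And>l. l \<in> universe P \<Longrightarrow> arith_pos P l < u" "Suc u < h" "\<And>x. e x \<noteq> 0 \<Longrightarrow> e x - 1 \<in> universe P"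
  shows "fm_over \<tau> h (big \<tau> U P u e \<phi>)"
  using assms(1,5)
proof (induction \<phi> arbitrary: e)
  case (Rel R ts)
  define xs where "xs = map tvar ts"
  have ts: "ts = map Var xs" using fm_over_tm[OF Rel(1)] by (simp add: xs_def list_eq_iff_nth_eq)
  have len: "length xs = arity R" using Rel by (simp add: ts)
  have p: "arith_pos P (e x - 1) < u" if "e x \<noteq> 0" for x using Rel(2) assms(3) that by blast
  have p': "Suc (arith_pos P (e x - 1)) < h" "arith_pos P (e x - 1) - i < h" if "e x \<noteq> 0" for x i
    using p[OF that] assms(4) by auto
  note av = assms(2)[unfolded arith_voc_def]
  have "fm_over \<tau> h (big_atom \<tau> U P e R xs)"
  proof (cases R)
    case Less
    then obtain x y where "xs = [x, y]" using len by (auto simp: numeral_2_eq_2 length_Suc_conv)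
    then show ?thesis using Less av assms(4) by (auto simp: big_atom_def)
  next
    case Add
    then obtain x y z where "xs = [x, y, z]" using len by (auto simp: numeral_3_eq_3 length_Suc_conv)
    then show ?thesis using Add av assms(4) p' fm_over_formulas[OF assms(2)]
      by (auto simp: big_atom_def big_add_def Let_def)
  next
    case Mult
    then obtain x y z where "xs = [x, y, z]" using len by (auto simp: numeral_3_eq_3 length_Suc_conv)
    then show ?thesis using Mult av assms(4) p' fm_over_formulas[OF assms(2)]
      by (auto simp: big_atom_def big_mult_def Let_def)
  next
    case (Sym r i)
    then show ?thesis using assms(4) len by (auto simp: big_atom_def)
  qed
  then show ?case by (simp add: ts comp_def)
next
  case (Ex x \<phi>)
  have "fm_over \<tau> h (big \<tau> U P u (e(x := v)) \<phi>)" if "v = 0 \<or> v - 1 \<in> universe P" for v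
    using Ex.prems that by (intro Ex.IH) auto
  then show ?case using assms(4) by auto
qed (use assms(4) in auto)

lemma sat_sum_formula:
  assumes A: "A \<in> ARITHM \<tau>" and s: "s x \<in> universe A" "s y \<in> universe A"
    and l: "Suc l < card (universe A)" "Suc l < h"
  shows "sat (expand_consts h A) s (sum_formula x y l) \<longleftrightarrow>
    arith_pos A (s x) + arith_pos A (s y) = card (universe A) + l"
proof -
  let ?n = "card (universe A)"
  note el = arith_elem_in[OF A]
  have lt: "arith_pos A (s x) < ?n" "arith_pos A (s y) < ?n" using arith_pos_less[OF A] s by auto
  have "sat (expand_consts h A) s (sum_formula x y l) \<longleftrightarrow>
      (\<exists>i<?n. arith_pos A (s y) = i + Suc l \<and>
        (\<exists>j<?n. j = arith_pos A (s x) + i \<and> \<not> (\<exists>m<?n. j < m)))"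
    using s l by (simp add: sum_formula_def Let_def expand_consts_simps bex_universe_iff[OF A]
        arith_rel_iff[OF A] el cong: conj_cong)
  also have "\<dots> \<longleftrightarrow> arith_pos A (s x) + arith_pos A (s y) = ?n + l" (is "?L \<longleftrightarrow> ?R")
  proof
    assume ?L
    then obtain i where i: "arith_pos A (s y) = i + Suc l" "arith_pos A (s x) + i < ?n"
      "\<not> (\<exists>m<?n. arith_pos A (s x) + i < m)" by blast
    have "arith_pos A (s x) + i = ?n - 1"
    proof (rule ccontr)
      assume "arith_pos A (s x) + i \<noteq> ?n - 1"
      then have "arith_pos A (s x) + i < ?n - 1" "?n - 1 < ?n" using i(2) by linarith+
      then show False using i(3) by blast
    qed
    then show ?R using i by linarith
  next
    assume r: ?R
    then show ?L using lt
      by (intro exI[of _ "arith_pos A (s y) - Suc l"] conjI exI[of _ "?n - 1"]) auto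
  qed
  finally show ?thesis .
qed

lemma sat_prod_formula:
  assumes A: "A \<in> ARITHM \<tau>" and s: "s x \<in> universe A" "s y \<in> universe A"
    and l: "Suc l < card (universe A)" "Suc l < h"
  shows "sat (expand_consts h A) s (prod_formula x y l) \<longleftrightarrow>
    (\<exists>j. arith_pos A (s y) = Suc j \<and> arith_pos A (s x) * j < card (universe A) \<and>
      arith_pos A (s x) * arith_pos A (s y) = card (universe A) + l)"
proof -
  let ?n = "card (universe A)"
  note el = arith_elem_in[OF A]
  have lt: "arith_pos A (s x) < ?n" "arith_pos A (s y) < ?n" using arith_pos_less[OF A] s by auto
  let ?w = "Suc (x + y)"
  have sf: "sat (expand_consts h A) (s(?w := arith_elem A i, Suc ?w := arith_elem A j)) (sum_formula (Suc ?w) x l)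
      \<longleftrightarrow> j + arith_pos A (s x) = ?n + l" if "i < ?n" "j < ?n" for i j
    using that s l el by (subst sat_sum_formula[OF A]) auto
  have "sat (expand_consts h A) s (prod_formula x y l) \<longleftrightarrow>
      (\<exists>i<?n. arith_pos A (s y) = i + 1 \<and>
        (\<exists>j<?n. j = arith_pos A (s x) * i \<and> j + arith_pos A (s x) = ?n + l))"
    using s l sf by (simp add: prod_formula_def Let_def expand_consts_simps bex_universe_iff[OF A]
        arith_rel_iff[OF A] el cong: conj_cong)
  also have "\<dots> \<longleftrightarrow> (\<exists>j. arith_pos A (s y) = Suc j \<and> arith_pos A (s x) * j < ?n \<and>
      arith_pos A (s x) * arith_pos A (s y) = ?n + l)"
    using lt by (auto simp: add.commute)
  finally show ?thesis .
qed

lemma sat_prod_formula_disj: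
  assumes A: "A \<in> ARITHM \<tau>" and s: "s x \<in> universe A" "s y \<in> universe A"
    and l: "Suc l < h" "(l + 2) * (l + 2) \<le> card (universe A)"
  shows "sat (expand_consts h A) s (Or (prod_formula x y l) (prod_formula y x l)) \<longleftrightarrow>
    arith_pos A (s x) * arith_pos A (s y) = card (universe A) + l"
proof -
  let ?n = "card (universe A)" and ?a = "arith_pos A (s x)" and ?b = "arith_pos A (s y)"
  have "Suc l < ?n" using l(2) by (simp add: algebra_simps)
  note pf = sat_prod_formula[OF A _ _ this l(1)]
  have "(\<exists>j. ?b = Suc j \<and> ?a * j < ?n) \<or> (\<exists>j. ?a = Suc j \<and> ?b * j < ?n)" if eq: "?a * ?b = ?n + l"
  proof -
    have "?n \<noteq> 0" using \<open>Suc l < ?n\<close> by simp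
    then obtain i j where ij: "?a = Suc i" "?b = Suc j" using eq by (metis mult_0 mult_0_right add_is_0 not0_implies_Suc)
    consider "l < ?a" | "l < ?b" | "?a \<le> l" "?b \<le> l" by linarith
    then show ?thesis
    proof cases
      case 1
      then have "?a * j < ?n" using eq ij by simp
      then show ?thesis using ij by blast
    next
      case 2
      then have "?b * i < ?n" using eq ij by (simp add: algebra_simps)
      then show ?thesis using ij by blast
    next
      case 3
      then have "?a * ?b \<le> l * l" by (rule mult_le_mono)
      also have "l * l < ?n" using l(2) by (simp add: algebra_simps)
      finally show ?thesis using eq by simp
    qed
  qed
  then show ?thesis using pf s by (auto simp: mult.commute)
qed

lemma sat_small:
  assumes A: "A \<in> ARITHM \<tau>" and P: "P \<in> ARITHM \<tau>'" and voc: "\<tau> \<inter> \<tau>' = arith_voc"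
    and U: "arity U = 1" "U \<notin> \<tau> \<union> \<tau>'"
    and n: "n = card (universe A)" "n < h" and u: "universe P \<subseteq> {..<u}"
    and "fm_over (\<tau> \<union> \<tau>' \<union> {U}) 0 \<phi>"
    and "\<And>x. e x < n \<or> n \<le> e x \<and> e x - n \<in> universe P"
  shows "sat (struct_sum U A P) (\<lambda>x. if e x < n then Inl (arith_elem A (e x)) else Inr (e x - n)) \<phi> \<longleftrightarrow>
    sat (expand_consts h A) s (small \<tau> U P u n e \<phi>)"
  using assms(9,10)
proof (induction \<phi> arbitrary: e)
  case (Eq t t')
  then have v: "t = Var (tvar t)" "t' = Var (tvar t')" using fm_over_Eq by auto
  have inj: "arith_elem A i = arith_elem A j \<longleftrightarrow> i = j" if "i < n" "j < n" for i j
    using that arith_elem_in(2)[OF A] unfolding n by metis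
  show ?case using Eq(2)[of "tvar t"] Eq(2)[of "tvar t'"]
    by (subst v, subst v(2)) (auto simp: inj)
next
  case (Rel R ts)
  define xs where "xs = map tvar ts"
  have ts: "ts = map Var xs" using fm_over_tm[OF Rel(1)] by (simp add: xs_def list_eq_iff_nth_eq)
  have len: "length xs = arity R" and R: "R \<in> \<tau> \<union> \<tau>' \<union> {U}" using Rel by (auto simp: ts)
  let ?d = "\<lambda>x. if e x < n then Inl (arith_elem A (e x)) else Inr (e x - n)"
  note fin = ARITHM_universe(1)[OF A] ARITHM_universe(1)[OF P]
  have d: "?d x \<in> sum_univ A P" for x
    using Rel(2)[of x] arith_elem_in[OF A] by (auto simp: sum_univ_def n(1))
  have pos: "sum_pos A P (?d x) = code_pos P n (e x)" for x
    using Rel(2)[of x] arith_elem_in[OF A] fin by (auto simp: n(1) code_pos_def sum_pos_Inl sum_pos_Inr)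
  have "map ?d xs \<in> rel (struct_sum U A P) R \<longleftrightarrow> sat (expand_consts h A) s (small_atom \<tau> U P n R (map e xs))"
  proof (cases "R = U")
    case True
    then obtain x where "xs = [x]" using len U by (auto simp: length_Suc_conv)
    then show ?thesis using True Rel(2)[of x] by (auto simp: small_atom_def struct_sum_simps)
  next
    case False
    note F = False
    show ?thesis
    proof (cases R)
      case Less
      then obtain x y where "xs = [x, y]" using len by (auto simp: numeral_2_eq_2 length_Suc_conv)
      then show ?thesis using F Less struct_sum_arith_rel(1)[OF A P voc U(1) d d]
        by (simp add: small_atom_def pos)
    next
      case Add
      then obtain x y z where "xs = [x, y, z]" using len by (auto simp: numeral_3_eq_3 length_Suc_conv)
      then show ?thesis using F Add struct_sum_arith_rel(2)[OF A P voc U(1) d d d]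
        by (simp add: small_atom_def pos)
    next
      case Mult
      then obtain x y z where "xs = [x, y, z]" using len by (auto simp: numeral_3_eq_3 length_Suc_conv)
      then show ?thesis using F Mult struct_sum_arith_rel(3)[OF A P voc U(1) d d d]
        by (simp add: small_atom_def pos)
    next
      case (Sym r i)
      have 1: "map ?d xs \<in> map Inl ` rel A R \<longleftrightarrow>
          R \<in> \<tau> \<and> (\<forall>x\<in>set xs. e x < n) \<and> map (\<lambda>x. arith_elem A (e x)) xs \<in> rel A R" (is "?L1 \<longleftrightarrow> ?R1")
      proof
        assume ?L1
        then obtain zs where zs: "zs \<in> rel A R" "map ?d xs = map Inl zs" by blast
        have *: "e x < n" if x: "x \<in> set xs" for x
        proof (rule ccontr)
          assume "\<not> e x < n"
          then have "Inr (e x - n) \<in> set (map ?d xs)" using x by force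
          then show False unfolding zs(2) by auto
        qed
        then have "map ?d xs = map Inl (map (\<lambda>x. arith_elem A (e x)) xs)" by simp
        then have "map (\<lambda>x. arith_elem A (e x)) xs = zs"
          unfolding zs(2) by (simp only: inj_map_eq_map[OF inj_Inl])
        then show ?R1 using * zs(1) ARITHM_rel[OF A zs(1)] by blast
      next
        assume r: ?R1
        then have "map ?d xs = map Inl (map (\<lambda>x. arith_elem A (e x)) xs)" by simp
        then show ?L1 using r by blast
      qed
      have 2: "map ?d xs \<in> map Inr ` rel P R \<longleftrightarrow>
          (\<forall>x\<in>set xs. n \<le> e x) \<and> map (\<lambda>x. e x - n) xs \<in> rel P R" (is "?L2 \<longleftrightarrow> ?R2")
      proof
        assume ?L2
        then obtain zs where zs: "zs \<in> rel P R" "map ?d xs = map Inr zs" by blast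
        have *: "\<not> e x < n" if x: "x \<in> set xs" for x
        proof
          assume "e x < n"
          then have "Inl (arith_elem A (e x)) \<in> set (map ?d xs)" using x by force
          then show False unfolding zs(2) by auto
        qed
        then have "map ?d xs = map Inr (map (\<lambda>x. e x - n) xs)" by simp
        then have "map (\<lambda>x. e x - n) xs = zs" unfolding zs(2) by (simp only: inj_map_eq_map[OF inj_Inr])
        then show ?R2 using * zs(1) by (auto simp: not_less)
      next
        assume r: ?R2
        then have "map ?d xs = map Inr (map (\<lambda>x. e x - n) xs)" by (auto simp: not_less)
        then show ?L2 using r by blast
      qed
      have "map (tm_val (expand_consts h A) s) (map Const (map e xs)) = map (\<lambda>x. arith_elem A (e x)) xs"
        if "\<forall>x\<in>set xs. e x < n" using that n by (auto simp: expand_consts_def)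
      then have 3: "sat (expand_consts h A) s (Rel R (map Const (map e xs))) \<longleftrightarrow>
          map (\<lambda>x. arith_elem A (e x)) xs \<in> rel A R" if "\<forall>x\<in>set xs. e x < n"
        using that by (simp only: sat.simps expand_consts_simps)
      have "map ?d xs \<in> rel (struct_sum U A P) R \<longleftrightarrow>
          map ?d xs \<in> map Inl ` rel A R \<or> map ?d xs \<in> map Inr ` rel P R"
        using F Sym by (simp add: struct_sum_simps)
      also have "\<dots> \<longleftrightarrow> sat (expand_consts h A) s (small_atom \<tau> U P n R (map e xs))"
        unfolding 1 2 using F Sym 3
        by (cases "R \<in> \<tau> \<and> (\<forall>x\<in>set xs. e x < n)") (auto simp: small_atom_def comp_def)
      finally show ?thesis .
    qed
  qed
  then show ?case by (simp add: ts comp_def)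
next
  case (Ex x \<phi>)
  let ?d = "\<lambda>e x. if e x < n then Inl (arith_elem A (e x)) else Inr (e x - n)"
  have IH: "sat (struct_sum U A P) ((?d e)(x := ?d (\<lambda>x. v) x)) \<phi> \<longleftrightarrow>
      sat (expand_consts h A) s (small \<tau> U P u n (e(x := v)) \<phi>)"
    if v: "v < n \<or> n \<le> v \<and> v - n \<in> universe P" for v
  proof -
    have "(?d e)(x := ?d (\<lambda>x. v) x) = ?d (e(x := v))" by auto
    moreover have "(e(x := v)) y < n \<or> n \<le> (e(x := v)) y \<and> (e(x := v)) y - n \<in> universe P" for y
      using v Ex.prems(2)[of y] by auto
    moreover have "fm_over (\<tau> \<union> \<tau>' \<union> {U}) 0 \<phi>" using Ex.prems(1) by simp
    ultimately show ?thesis using Ex.IH[of "e(x := v)"] by (simp only:)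
  qed
  have "sat (struct_sum U A P) (?d e) (Ex x \<phi>) \<longleftrightarrow>
      (\<exists>v<n. sat (struct_sum U A P) ((?d e)(x := ?d (\<lambda>x. v) x)) \<phi>) \<or>
      (\<exists>l\<in>universe P. sat (struct_sum U A P) ((?d e)(x := ?d (\<lambda>x. n + l) x)) \<phi>)"
    by (simp add: struct_sum_simps sum_univ_def bex_Un bex_universe_iff[OF A] n(1)[symmetric] cong: conj_cong)
  also have "\<dots> \<longleftrightarrow> (\<exists>v<n. sat (expand_consts h A) s (small \<tau> U P u n (e(x := v)) \<phi>)) \<or>
      (\<exists>l\<in>universe P. sat (expand_consts h A) s (small \<tau> U P u n (e(x := n + l)) \<phi>))"
    by (intro arg_cong2[where f = "(\<or>)"] ex_cong1 conj_cong bex_cong refl; rule IH; simp)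
  also have "\<dots> \<longleftrightarrow> sat (expand_consts h A) s (small \<tau> U P u n e (Ex x \<phi>))"
    using u by (auto split: if_splits)
  finally show ?case .
qed auto

lemma sat_big:
  assumes A: "A \<in> ARITHM \<tau>" and P: "P \<in> ARITHM \<tau>'" and voc: "\<tau> \<inter> \<tau>' = arith_voc"
    and U: "arity U = 1" "U \<notin> \<tau> \<union> \<tau>'"
    and u: "universe P \<subseteq> {..<u}" "\<And>l. l \<in> universe P \<Longrightarrow> arith_pos P l < u"
    and n: "(u + 2) * (u + 2) \<le> card (universe A)" "Suc u < h"
    and "fm_over (\<tau> \<union> \<tau>' \<union> {U}) 0 \<phi>"
    and "\<And>x. e x \<noteq> 0 \<Longrightarrow> e x - 1 \<in> universe P" and "range s \<subseteq> universe A"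
  shows "sat (struct_sum U A P) (\<lambda>x. if e x = 0 then Inl (s x) else Inr (e x - 1)) \<phi> \<longleftrightarrow>
    sat (expand_consts h A) s (big \<tau> U P u e \<phi>)"
  using assms(10-12)
proof (induction \<phi> arbitrary: e s)
  case (Eq t t')
  then have v: "t = Var (tvar t)" "t' = Var (tvar t')" using fm_over_Eq by auto
  show ?case by (subst v, subst v(2)) auto
next
  case (Rel R ts)
  define xs where "xs = map tvar ts"
  have ts: "ts = map Var xs" using fm_over_tm[OF Rel(1)] by (simp add: xs_def list_eq_iff_nth_eq)
  have len: "length xs = arity R" and R: "R \<in> \<tau> \<union> \<tau>' \<union> {U}" using Rel by (auto simp: ts)
  let ?d = "\<lambda>x. if e x = 0 then Inl (s x) else Inr (e x - 1)" and ?n = "card (universe A)"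
  let ?p = "\<lambda>x. arith_pos P (e x - 1)" and ?a = "\<lambda>x. arith_pos A (s x)"
  note fin = ARITHM_universe(1)[OF A] ARITHM_universe(1)[OF P]
  have sx: "s x \<in> universe A" for x using Rel(3) by auto
  have d: "?d x \<in> sum_univ A P" for x
    using Rel(2)[of x] sx by (auto simp: sum_univ_def)
  have pos: "sum_pos A P (?d x) = (if e x = 0 then ?a x else ?n + ?p x)" for x
    using Rel(2)[of x] fin by (simp add: sum_pos_Inl sum_pos_Inr)
  have a: "?a x < ?n" for x using arith_pos_less[OF A sx] .
  have p: "?p x < u" if "e x \<noteq> 0" for x using that Rel(2) u(2) by blast
  have "u + 2 \<le> (u + 2) * (u + 2)" by simp
  then have un: "u + 2 \<le> ?n" using n(1) by linarith
  have el: "s x = arith_elem A i \<longleftrightarrow> ?a x = i" if "i < ?n" for x i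
    using arith_elem_pos[OF A sx] arith_elem_in[OF A that] by metis
  have con: "the (con (expand_consts h A) i) = arith_elem A i" if "i < u + 2" for i
    using that un n(2) by (simp add: expand_consts_simps)
  have eqc: "s x = the (con (expand_consts h A) i) \<longleftrightarrow> ?a x = i" if "i < u + 2" for x i
    using that un by (simp add: con el)
  have "map ?d xs \<in> rel (struct_sum U A P) R \<longleftrightarrow> sat (expand_consts h A) s (big_atom \<tau> U P e R xs)"
  proof (cases "R = U")
    case True
    then obtain x where "xs = [x]" using len U by (auto simp: length_Suc_conv)
    then show ?thesis using True Rel(2)[of x] by (auto simp: big_atom_def struct_sum_simps)
  next
    case False
    note F = False
    show ?thesis
    proof (cases R)
      case Less
      then obtain x y where xy: "xs = [x, y]" using len by (auto simp: numeral_2_eq_2 length_Suc_conv)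
      then have "map ?d xs \<in> rel (struct_sum U A P) R \<longleftrightarrow> sum_pos A P (?d x) < sum_pos A P (?d y)"
        using Less struct_sum_arith_rel(1)[OF A P voc U(1) d d] by simp
      also have "\<dots> \<longleftrightarrow> sat (expand_consts h A) s (big_atom \<tau> U P e R xs)"
        unfolding pos using F Less xy a[of x] a[of y]
        by (auto simp: big_atom_def expand_consts_simps arith_rel_iff[OF A sx sx])
      finally show ?thesis .
    next
      case Add
      then obtain x y z where xyz: "xs = [x, y, z]" using len by (auto simp: numeral_3_eq_3 length_Suc_conv)
      then have "map ?d xs \<in> rel (struct_sum U A P) R \<longleftrightarrow>
          sum_pos A P (?d z) = sum_pos A P (?d x) + sum_pos A P (?d y)"
        using Add struct_sum_arith_rel(2)[OF A P voc U(1) d d d] by simp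
      also have "\<dots> \<longleftrightarrow> sat (expand_consts h A) s (big_add P e x y z)"
      proof -
        have sf: "sat (expand_consts h A) s (sum_formula x y (?p z)) \<longleftrightarrow> ?a x + ?a y = ?n + ?p z" if "e z \<noteq> 0"
          using p[OF that] un n(2) by (intro sat_sum_formula[OF A sx sx]) auto
        have c: "?p z - i < u + 2" if "e z \<noteq> 0" for i using p[OF that] by simp
        show ?thesis unfolding pos using a[of x] a[of y] a[of z] p[of x] p[of y] p[of z] un sf eqc c
          by (auto simp: big_add_def Let_def expand_consts_simps arith_rel_iff(2)[OF A sx sx sx])
      qed
      also have "\<dots> \<longleftrightarrow> sat (expand_consts h A) s (big_atom \<tau> U P e R xs)"
        using F Add by (simp add: xyz big_atom_def)
      finally show ?thesis .
    next
      case Mult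
      then obtain x y z where xyz: "xs = [x, y, z]" using len by (auto simp: numeral_3_eq_3 length_Suc_conv)
      then have "map ?d xs \<in> rel (struct_sum U A P) R \<longleftrightarrow>
          sum_pos A P (?d z) = sum_pos A P (?d x) * sum_pos A P (?d y)"
        using Mult struct_sum_arith_rel(3)[OF A P voc U(1) d d d] by simp
      also have "\<dots> \<longleftrightarrow> sat (expand_consts h A) s (big_mult P e x y z)"
      proof -
        have sf: "sat (expand_consts h A) s (Or (prod_formula x y (?p z)) (prod_formula y x (?p z))) \<longleftrightarrow>
            ?a x * ?a y = ?n + ?p z" if "e z \<noteq> 0"
        proof (rule sat_prod_formula_disj[OF A sx sx])
          show "Suc (?p z) < h" using p[OF that] n(2) by simp
          have "(?p z + 2) * (?p z + 2) \<le> (u + 2) * (u + 2)" by (intro mult_le_mono) (use p[OF that] in auto)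
          then show "(?p z + 2) * (?p z + 2) \<le> ?n" using n(1) by linarith
        qed
        have m1: "?n + j = i * (?n + k) \<longleftrightarrow> i = 1 \<and> j = k" if "j < u" for i j k
        proof
          assume eq: "?n + j = i * (?n + k)"
          consider "i = 0" | "i = 1" | m where "i = Suc (Suc m)" by (metis One_nat_def not0_implies_Suc)
          then show "i = 1 \<and> j = k"
          proof cases
            case 3
            then have "?n + j \<ge> ?n + ?n" using eq by simp
            then show ?thesis using that un by simp
          qed (use eq un in auto)
        qed simp
        have m0: "?a z = i * (?n + k) \<longleftrightarrow> i = 0 \<and> ?a z = 0" for i k
          using a[of z] by (cases i) auto
        have m2: "?a z \<noteq> (?n + j) * (?n + k)" for j k
          using m0[of "?n + j" k] un by simp
        have m3: "?n + i \<noteq> (?n + j) * (?n + k)" if "i < u" for i j k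
          using m1[OF that, of "?n + j" k] un by auto
        have sx0: "0 < u + 2" "1 < u + 2" by simp_all
        show ?thesis
        proof (cases "e x = 0"; cases "e y = 0"; cases "e z = 0")
          assume "e x = 0" "e y = 0" "e z = 0"
          then show ?thesis unfolding pos
            by (simp add: big_mult_def expand_consts_simps arith_rel_iff(3)[OF A sx sx sx])
        next
          assume "e x = 0" "e y = 0" "e z \<noteq> 0"
          then show ?thesis unfolding pos using sf by (auto simp: big_mult_def Let_def)
        next
          assume "e x = 0" "e y \<noteq> 0" "e z = 0"
          then show ?thesis unfolding pos using m0 eqc[OF sx0(1)] by (auto simp: big_mult_def)
        next
          assume "e x = 0" "e y \<noteq> 0" "e z \<noteq> 0"
          then show ?thesis unfolding pos using m1[OF p] eqc[OF sx0(2)]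
            by (auto simp: big_mult_def Let_def)
        next
          assume "e x \<noteq> 0" "e y = 0" "e z = 0"
          then show ?thesis unfolding pos using m0 eqc[OF sx0(1)]
            by (auto simp: big_mult_def mult.commute)
        next
          assume "e x \<noteq> 0" "e y = 0" "e z \<noteq> 0"
          then show ?thesis unfolding pos using m1[OF p] eqc[OF sx0(2)]
            by (auto simp: big_mult_def Let_def mult.commute)
        next
          assume "e x \<noteq> 0" "e y \<noteq> 0" "e z = 0"
          then show ?thesis unfolding pos using m2 by (simp add: big_mult_def)
        next
          assume "e x \<noteq> 0" "e y \<noteq> 0" "e z \<noteq> 0"
          then show ?thesis unfolding pos using m3[OF p] by (simp add: big_mult_def)
        qed
      qed
      also have "\<dots> \<longleftrightarrow> sat (expand_consts h A) s (big_atom \<tau> U P e R xs)"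
        using F Mult by (simp add: xyz big_atom_def)
      finally show ?thesis .
    next
      case (Sym r i)
      have 1: "map ?d xs \<in> map Inl ` rel A R \<longleftrightarrow>
          R \<in> \<tau> \<and> (\<forall>x\<in>set xs. e x = 0) \<and> map s xs \<in> rel A R" (is "?L1 \<longleftrightarrow> ?R1")
      proof
        assume ?L1
        then obtain zs where zs: "zs \<in> rel A R" "map ?d xs = map Inl zs" by blast
        have *: "e x = 0" if x: "x \<in> set xs" for x
        proof (rule ccontr)
          assume "e x \<noteq> 0"
          then have "Inr (e x - 1) \<in> set (map ?d xs)" using x by force
          then show False unfolding zs(2) by auto
        qed
        then have "map ?d xs = map Inl (map s xs)" by simp
        then have "map s xs = zs" unfolding zs(2) by (simp only: inj_map_eq_map[OF inj_Inl])
        then show ?R1 using * zs(1) ARITHM_rel[OF A zs(1)] by blast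
      next
        assume r: ?R1
        then have "map ?d xs = map Inl (map s xs)" by simp
        then show ?L1 using r by blast
      qed
      have 2: "map ?d xs \<in> map Inr ` rel P R \<longleftrightarrow>
          (\<forall>x\<in>set xs. e x \<noteq> 0) \<and> map (\<lambda>x. e x - 1) xs \<in> rel P R" (is "?L2 \<longleftrightarrow> ?R2")
      proof
        assume ?L2
        then obtain zs where zs: "zs \<in> rel P R" "map ?d xs = map Inr zs" by blast
        have *: "e x \<noteq> 0" if x: "x \<in> set xs" for x
        proof
          assume "e x = 0"
          then have "Inl (s x) \<in> set (map ?d xs)" using x by force
          then show False unfolding zs(2) by auto
        qed
        then have "map ?d xs = map Inr (map (\<lambda>x. e x - 1) xs)" by simp
        then have "map (\<lambda>x. e x - 1) xs = zs" unfolding zs(2) by (simp only: inj_map_eq_map[OF inj_Inr])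
        then show ?R2 using * zs(1) by auto
      next
        assume r: ?R2
        then have "map ?d xs = map Inr (map (\<lambda>x. e x - 1) xs)" by auto
        then show ?L2 using r by blast
      qed
      have "map ?d xs \<in> rel (struct_sum U A P) R \<longleftrightarrow>
          map ?d xs \<in> map Inl ` rel A R \<or> map ?d xs \<in> map Inr ` rel P R"
        using F Sym by (simp add: struct_sum_simps)
      also have "\<dots> \<longleftrightarrow> sat (expand_consts h A) s (big_atom \<tau> U P e R xs)"
        unfolding 1 2 using F Sym
        by (cases "R \<in> \<tau> \<and> (\<forall>x\<in>set xs. e x = 0)") (auto simp: big_atom_def comp_def expand_consts_simps)
      finally show ?thesis .
    qed
  qed
  then show ?case by (simp add: ts comp_def)
next
  case (Ex x \<phi>)
  let ?d = "\<lambda>e s x. if e x = 0 then Inl (s x) else Inr (e x - 1)"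
  have IH: "sat (struct_sum U A P) (?d (e(x := v)) (s(x := a))) \<phi> \<longleftrightarrow>
      sat (expand_consts h A) (s(x := a)) (big \<tau> U P u (e(x := v)) \<phi>)"
    if v: "v \<noteq> 0 \<Longrightarrow> v - 1 \<in> universe P" "a \<in> universe A" for v a
  proof (rule Ex.IH)
    show "range (s(x := a)) \<subseteq> universe A" using Ex.prems(3) v(2) by auto
    show "(e(x := v)) y - 1 \<in> universe P" if "(e(x := v)) y \<noteq> 0" for y
      using that v(1) Ex.prems(2)[of y] by (cases "y = x") auto
  qed (use Ex.prems in auto)
  have Inl: "(?d e s)(x := Inl a) = ?d (e(x := 0)) (s(x := a))" for a by auto
  have Inr: "(?d e s)(x := Inr l) = ?d (e(x := Suc l)) (s(x := s x))" for l by auto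
  have sx: "s x \<in> universe A" using Ex.prems(3) by auto
  have "sat (struct_sum U A P) (?d e s) (Ex x \<phi>) \<longleftrightarrow>
      (\<exists>a\<in>universe A. sat (struct_sum U A P) ((?d e s)(x := Inl a)) \<phi>) \<or>
      (\<exists>l\<in>universe P. sat (struct_sum U A P) ((?d e s)(x := Inr l)) \<phi>)"
    by (simp add: struct_sum_simps sum_univ_def bex_Un)
  also have "\<dots> \<longleftrightarrow> (\<exists>a\<in>universe A. sat (expand_consts h A) (s(x := a)) (big \<tau> U P u (e(x := 0)) \<phi>)) \<or>
      (\<exists>l\<in>universe P. sat (expand_consts h A) s (big \<tau> U P u (e(x := Suc l)) \<phi>))"
    unfolding Inl Inr using IH[of 0] IH[OF _ sx] by (intro arg_cong2[where f = "(\<or>)"] bex_cong refl) simp_all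
  also have "\<dots> \<longleftrightarrow> sat (expand_consts h A) s (big \<tau> U P u e (Ex x \<phi>))"
    using u(1) by (auto simp: expand_consts_simps split: if_splits)
  finally show ?case .
qed auto

section \<open>Computability of the translation\<close>

definition recf :: "nat \<Rightarrow> (nat list \<Rightarrow> fm) \<Rightarrow> bool" where
  "recf n F \<longleftrightarrow> rec n (\<lambda>xs. fm_encode (F xs))"

definition rect :: "nat \<Rightarrow> (nat list \<Rightarrow> tm) \<Rightarrow> bool" where
  "rect n T \<longleftrightarrow> rec n (\<lambda>xs. tm_encode (T xs))"

lemma rect_Var: "rect n (\<lambda>xs. Var x)"
  unfolding rect_def by (rule rec_const)

lemma rect_Const: "rec n l \<Longrightarrow> rect n (\<lambda>xs. Const (l xs))"
  unfolding rect_def by (simp add: rec_add rec_mult rec_const rec_Suc)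

lemma recf_const: "recf n (\<lambda>xs. \<phi>)"
  unfolding recf_def by (rule rec_const)

lemma recf_Eq: "rect n s \<Longrightarrow> rect n t \<Longrightarrow> recf n (\<lambda>xs. Eq (s xs) (t xs))"
  unfolding recf_def rect_def by (simp add: rec_prod_encode rec_const)

lemma recf_Rel:
  assumes "\<And>T. T \<in> set Ts \<Longrightarrow> rect n T" shows "recf n (\<lambda>xs. Rel R (map (\<lambda>T. T xs) Ts))"
proof -
  have "rec n (\<lambda>xs. list_encode (map (\<lambda>a. a xs) (map (\<lambda>T xs. tm_encode (T xs)) Ts)))"
    by (rule rec_list_encode) (use assms in \<open>auto simp: rect_def\<close>)
  then show ?thesis unfolding recf_def by (simp add: rec_prod_encode rec_const comp_def)
qed

lemma recf_Rel2: "rect n s \<Longrightarrow> rect n t \<Longrightarrow> recf n (\<lambda>xs. Rel R [s xs, t xs])"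
  using recf_Rel[of "[s, t]" n R] by auto

lemma recf_Rel3: "rect n s \<Longrightarrow> rect n t \<Longrightarrow> rect n v \<Longrightarrow> recf n (\<lambda>xs. Rel R [s xs, t xs, v xs])"
  using recf_Rel[of "[s, t, v]" n R] by auto

lemma recf_Neg: "recf n F \<Longrightarrow> recf n (\<lambda>xs. Neg (F xs))"
  unfolding recf_def by (simp add: rec_prod_encode rec_const)

lemma recf_Or: "recf n F \<Longrightarrow> recf n G \<Longrightarrow> recf n (\<lambda>xs. Or (F xs) (G xs))"
  unfolding recf_def by (simp add: rec_prod_encode rec_const)

lemma recf_Ex: "recf n F \<Longrightarrow> recf n (\<lambda>xs. Ex x (F xs))"
  unfolding recf_def by (simp add: rec_prod_encode rec_const)

lemma recf_And: "recf n F \<Longrightarrow> recf n G \<Longrightarrow> recf n (\<lambda>xs. And (F xs) (G xs))"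
  unfolding And_def by (intro recf_Neg recf_Or)

lemma recf_if: "recp n P \<Longrightarrow> recf n F \<Longrightarrow> recf n G \<Longrightarrow> recf n (\<lambda>xs. if P xs then F xs else G xs)"
  unfolding recf_def if_distrib[of fm_encode] by (rule rec_if)

lemma recf_decide: "recp n P \<Longrightarrow> recf n (\<lambda>xs. decide (P xs))"
  unfolding decide_def by (intro recf_if recf_const)

lemma recf_BigOr:
  assumes "recf (Suc n) (\<lambda>ys. F (hd ys) (tl ys))" "rec n b"
  shows "recf n (\<lambda>xs. BigOr (b xs) (\<lambda>i. F i xs))"
proof -
  let ?op = "\<lambda>a b. prod_encode (3, prod_encode (a, b))"
  have "rec n (\<lambda>xs. rec_nat (fm_encode (decide False)) (\<lambda>i r. ?op (fm_encode (F i xs)) r) (b xs))"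
    by (intro rec_fold rec_const rec_prod_encode rec_hd rec_weaken assms[unfolded recf_def])
  moreover have "rec_nat (fm_encode (decide False)) (\<lambda>i r. ?op (fm_encode (G i)) r) m = fm_encode (BigOr m G)" for m G
    by (induction m) (auto simp: BigOr_def)
  ultimately show ?thesis unfolding recf_def by simp
qed

lemmas recf_intros = recf_Eq recf_Rel2 recf_Rel3 recf_Neg recf_Or recf_Ex recf_And recf_if
  recf_decide recf_const rect_Var rect_Const

lemma inj_symb_encode: "symb_encode R = symb_encode S \<longleftrightarrow> R = S"
  by (cases R; cases S) auto

lemma ARITHM_decode:
  assumes A: "A \<in> ARITHM \<tau>" and \<tau>: "finite \<tau>"
  shows "l \<in> universe A \<longleftrightarrow> l \<in> set_decode (fst (prod_decode (struct_encode A)))"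
    and "xs \<in> rel A R \<longleftrightarrow>
      prod_encode (symb_encode R, list_encode xs) \<in> set_decode (snd (prod_decode (struct_encode A)))"
proof -
  show "l \<in> universe A \<longleftrightarrow> l \<in> set_decode (fst (prod_decode (struct_encode A)))"
    using ARITHM_universe(1)[OF A] by (simp add: struct_encode_def set_encode_inverse)
  let ?C = "{prod_encode (symb_encode R, list_encode xs) | R xs. xs \<in> rel A R}"
  have "?C \<subseteq> (\<Union>R\<in>\<tau>. (\<lambda>xs. prod_encode (symb_encode R, list_encode xs)) `
      {xs. set xs \<subseteq> universe A \<and> length xs = arity R})"
    using ARITHM_rel[OF A] by blast
  moreover have "finite \<dots>" using \<tau> finite_lists_length_eq[OF ARITHM_universe(1)[OF A]] by auto
  ultimately have "finite ?C" by (rule finite_subset)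
  then show "xs \<in> rel A R \<longleftrightarrow>
      prod_encode (symb_encode R, list_encode xs) \<in> set_decode (snd (prod_decode (struct_encode A)))"
    by (auto simp: struct_encode_def set_encode_inverse inj_symb_encode list_encode_eq)
qed

lemma less_set_encode: "finite S \<Longrightarrow> l \<in> S \<Longrightarrow> l < set_encode S"
proof -
  assume "finite S" "l \<in> S"
  then have "set_encode {l} \<le> set_encode S" unfolding set_encode_def by (intro sum_mono2) auto
  moreover have "l < 2 ^ l" by (rule less_exp)
  ultimately show ?thesis by (simp add: set_encode_def del: less_exp)
qed

context
  fixes pre :: "nat \<Rightarrow> nat struct" and \<tau>' :: "symb set"
  assumes pre: "\<And>k. pre k \<in> ARITHM \<tau>'" and finite_voc: "finite \<tau>'"
    and computable_pre: "computable (\<lambda>k. struct_encode (pre k))"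
begin

lemma recp_universe: "rec n K \<Longrightarrow> rec n a \<Longrightarrow> recp n (\<lambda>xs. a xs \<in> universe (pre (K xs)))"
  unfolding ARITHM_decode(1)[OF pre finite_voc]
  by (intro recp_set_decode rec_fst_decode rec_computable[OF computable_pre])

lemma recp_rel:
  assumes "rec n K" "\<And>a. a \<in> set as \<Longrightarrow> rec n a"
  shows "recp n (\<lambda>xs. map (\<lambda>a. a xs) as \<in> rel (pre (K xs)) R)"
  unfolding ARITHM_decode(2)[OF pre finite_voc]
  by (intro recp_set_decode rec_snd_decode rec_prod_encode rec_const rec_list_encode assms
      rec_computable[OF computable_pre])

lemma rec_universe_code: "rec n K \<Longrightarrow> rec n (\<lambda>xs. set_encode (universe (pre (K xs))))"
proof -
  assume "rec n K"
  then have "rec n (\<lambda>xs. fst (prod_decode (struct_encode (pre (K xs)))))"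
    by (intro rec_fst_decode rec_computable[OF computable_pre])
  then show ?thesis by (simp add: struct_encode_def)
qed

lemma rec_arith_pos:
  assumes K: "rec n K" and a: "rec n a"
  shows "rec n (\<lambda>xs. arith_pos (pre (K xs)) (a xs))"
proof -
  have "rec n (\<lambda>xs. \<Sum>b<set_encode (universe (pre (K xs))).
      of_bool (b \<in> universe (pre (K xs)) \<and> map (\<lambda>a. a (b # xs)) [hd, \<lambda>ys. a (tl ys)] \<in> rel (pre (K xs)) Less))"
  proof (rule rec_sum)
    have "recp (Suc n) (\<lambda>ys. hd ys \<in> universe (pre (K (tl ys))) \<and>
        map (\<lambda>a. a ys) [hd, \<lambda>ys. a (tl ys)] \<in> rel (pre (K (tl ys))) Less)"
      by (intro recp_conj recp_universe recp_rel rec_weaken[OF K] rec_hd)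
        (use rec_hd rec_weaken[OF a] in auto)
    then show "rec (Suc n) (\<lambda>ys. of_bool (hd ys \<in> universe (pre (K (tl ys))) \<and>
        map (\<lambda>a. a (hd ys # tl ys)) [hd, \<lambda>ys. a (tl ys)] \<in> rel (pre (K (tl ys))) Less))"
      unfolding recp_def by (rule rec_cong) simp
  qed (rule rec_universe_code[OF K])
  then show ?thesis
  proof (rule rec_cong)
    fix xs :: "nat list"
    let ?P = "pre (K xs)"
    have "{b \<in> universe ?P. [b, a xs] \<in> rel ?P Less} =
        {b \<in> {..<set_encode (universe ?P)}. b \<in> universe ?P \<and> [b, a xs] \<in> rel ?P Less}"
      using less_set_encode[OF ARITHM_universe(1)[OF pre]] by auto
    then show "(\<Sum>b<set_encode (universe ?P). of_bool (b \<in> universe ?P \<and>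
        map (\<lambda>a. a (b # xs)) [hd, \<lambda>ys. a (tl ys)] \<in> rel ?P Less)) = arith_pos ?P (a xs)"
      by (simp add: arith_pos_def Int_def)
  qed
qed

lemma rec_code_pos:
  assumes "rec n K" "rec n N" "rec n a"
  shows "rec n (\<lambda>xs. code_pos (pre (K xs)) (N xs) (a xs))"
  unfolding code_pos_def by (intro rec_if recp_less rec_add rec_arith_pos rec_diff assms)

lemma recf_small:
  assumes "rec n K" "rec n u" "rec n N" "\<And>x. rec n (E x)" "fm_over \<sigma> 0 \<phi>"
  shows "recf n (\<lambda>xs. small \<tau> U (pre (K xs)) (u xs) (N xs) (\<lambda>x. E x xs) \<phi>)"
  using assms
proof (induction \<phi> arbitrary: n K u N E)
  case (Eq s t)
  then show ?case by (auto intro!: recf_decide recp_eq)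
next
  case (Rel R ts)
  note [intro] = Rel(1-4)
  have len: "length ts = arity R" using Rel(5) by simp
  have E: "map (\<lambda>t. E (tvar t) xs) ts ! i = E (tvar (ts ! i)) xs" if "i < arity R" for i xs
    using that len by simp
  have "recf n (\<lambda>xs. small_atom \<tau> U (pre (K xs)) (N xs) R (map (\<lambda>t. E (tvar t) xs) ts))"
  proof (cases "R = U")
    case True
    show ?thesis
    proof (cases "arity R = 0")
      case True
      then show ?thesis using \<open>R = U\<close> len by (auto simp: small_atom_def intro!: recf_decide recp_le rec_const)
    next
      case False
      then show ?thesis using \<open>R = U\<close> by (auto simp: small_atom_def E simp del: nth_map intro!: recf_decide recp_le)
    qed
  next
    case False
    show ?thesis
    proof (cases R)
      case Less
      with False E show ?thesis by (auto simp: small_atom_def simp del: nth_map intro!: recf_decide recp_less rec_code_pos)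
    next
      case Add
      with False E show ?thesis by (auto simp: small_atom_def simp del: nth_map intro!: recf_decide recp_eq rec_add rec_code_pos)
    next
      case Mult
      with False E show ?thesis by (auto simp: small_atom_def simp del: nth_map intro!: recf_decide recp_eq rec_mult rec_code_pos)
    next
      case (Sym r i)
      have 1: "recp n (\<lambda>xs. \<forall>t\<in>set ts. E (tvar t) xs < N xs)" "recp n (\<lambda>xs. \<forall>t\<in>set ts. N xs \<le> E (tvar t) xs)"
        by (intro recp_finite_all recp_less recp_le; blast)+
      have 2: "recp n (\<lambda>xs. map (\<lambda>a. a xs) (map (\<lambda>t xs. E (tvar t) xs - N xs) ts) \<in> rel (pre (K xs)) R)"
        by (rule recp_rel) (auto intro!: rec_diff)
      have 3: "recf n (\<lambda>xs. Rel R (map (\<lambda>T. T xs) (map (\<lambda>t xs. Const (E (tvar t) xs)) ts)))"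
        by (rule recf_Rel) (auto intro!: rect_Const)
      have "recf n (\<lambda>xs. Or (if R \<in> \<tau> \<and> (\<forall>t\<in>set ts. E (tvar t) xs < N xs)
          then Rel R (map (\<lambda>T. T xs) (map (\<lambda>t xs. Const (E (tvar t) xs)) ts)) else decide False)
        (decide ((\<forall>t\<in>set ts. N xs \<le> E (tvar t) xs) \<and>
          map (\<lambda>a. a xs) (map (\<lambda>t xs. E (tvar t) xs - N xs) ts) \<in> rel (pre (K xs)) R)))"
        by (intro recf_Or recf_if recf_decide recp_conj recp_const 1 2 3)
      then show ?thesis using False unfolding Sym by (simp add: small_atom_def comp_def cong: if_cong)
    qed
  qed
  then show ?case by simp
next
  case (Neg \<phi>)
  then show ?case by (simp add: recf_Neg)
next
  case (Or \<phi> \<psi>)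
  then show ?case by (simp add: recf_Or)
next
  case (Ex x \<phi>)
  have IH: "recf (Suc n) (\<lambda>ys. small \<tau> U (pre (K (tl ys))) (u (tl ys)) (N (tl ys))
      ((\<lambda>y. E y (tl ys))(x := v ys)) \<phi>)" if v: "rec (Suc n) v" for v
  proof -
    have "recf (Suc n) (\<lambda>ys. small \<tau> U (pre (K (tl ys))) (u (tl ys)) (N (tl ys))
        (\<lambda>y. (if y = x then v else (\<lambda>ys. E y (tl ys))) ys) \<phi>)"
      by (rule Ex.IH) (use Ex.prems v in \<open>auto intro: rec_weaken\<close>)
    moreover have "(\<lambda>y. (if y = x then v else (\<lambda>ys. E y (tl ys))) ys) = (\<lambda>y. E y (tl ys))(x := v ys)" for ys
      by auto
    ultimately show ?thesis by simp
  qed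
  have "recf (Suc n) (\<lambda>ys. if hd ys \<in> universe (pre (K (tl ys)))
      then small \<tau> U (pre (K (tl ys))) (u (tl ys)) (N (tl ys)) ((\<lambda>y. E y (tl ys))(x := N (tl ys) + hd ys)) \<phi>
      else decide False)"
    by (intro recf_if recp_universe recf_const IH rec_add rec_hd rec_weaken Ex.prems)
  moreover have "recf (Suc n) (\<lambda>ys. small \<tau> U (pre (K (tl ys))) (u (tl ys)) (N (tl ys))
      ((\<lambda>y. E y (tl ys))(x := hd ys)) \<phi>)" by (rule IH[OF rec_hd])
  ultimately show ?case unfolding small.simps by (intro recf_Or recf_BigOr Ex.prems)
qed

lemma recf_sum_formula: "rec n l \<Longrightarrow> recf n (\<lambda>xs. sum_formula x y (l xs))"
  unfolding sum_formula_def Let_def by (intro recf_intros rec_Suc)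

lemma recf_prod_formula: "rec n l \<Longrightarrow> recf n (\<lambda>xs. prod_formula x y (l xs))"
  unfolding prod_formula_def Let_def by (intro recf_intros recf_sum_formula rec_const)

lemma recf_big:
  assumes "rec n K" "rec n u" "\<And>x. rec n (E x)" "fm_over \<sigma> 0 \<phi>"
  shows "recf n (\<lambda>xs. big \<tau> U (pre (K xs)) (u xs) (\<lambda>x. E x xs) \<phi>)"
  using assms
proof (induction \<phi> arbitrary: n K u E)
  case (Eq s t)
  then show ?case unfolding big.simps
    by (intro recf_if recf_decide recp_conj recp_eq recf_const rec_const) blast+
next
  case (Rel R ts)
  note [intro] = Rel(1-3)
  define vs where "vs = map tvar ts"
  have p: "rec n (\<lambda>xs. arith_pos (pre (K xs)) (E v xs - 1))" for v
    by (intro rec_arith_pos rec_diff rec_const Rel)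
  have "recf n (\<lambda>xs. big_atom \<tau> U (pre (K xs)) (\<lambda>x. E x xs) R vs)"
  proof (cases "R = U")
    case True
    then show ?thesis unfolding big_atom_def by (auto intro!: recf_decide recp_less rec_const)
  next
    case False
    show ?thesis
    proof (cases R)
      case Less
      have "recf n (\<lambda>xs. if E (vs ! 0) xs = 0 \<and> E (vs ! 1) xs = 0 then Rel Less [Var (vs ! 0), Var (vs ! 1)]
        else decide (E (vs ! 1) xs \<noteq> 0 \<and> (E (vs ! 0) xs = 0 \<or>
          arith_pos (pre (K xs)) (E (vs ! 0) xs - 1) < arith_pos (pre (K xs)) (E (vs ! 1) xs - 1))))"
        by (intro recf_if recf_decide recp_conj recp_disj recp_not recp_eq recp_less recf_const rec_const p Rel)
      with False Less show ?thesis by (simp add: big_atom_def)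
    next
      case Add
      have "recf n (\<lambda>xs. big_add (pre (K xs)) (\<lambda>x. E x xs) x y z)" for x y z
        unfolding big_add_def Let_def
        by (intro recf_if recf_decide recp_conj recp_not recp_eq recp_le recf_const rec_const p Rel
            recf_sum_formula recf_Eq rect_Var rect_Const rec_diff)
      with False Add show ?thesis by (simp add: big_atom_def)
    next
      case Mult
      have "recf n (\<lambda>xs. big_mult (pre (K xs)) (\<lambda>x. E x xs) x y z)" for x y z
        unfolding big_mult_def Let_def
        by (intro recf_if recf_decide recp_conj recp_not recp_eq recp_le recf_const rec_const p Rel
            recf_prod_formula recf_Or recf_And)
      with False Mult show ?thesis by (simp add: big_atom_def)
    next
      case (Sym r i)
      have 1: "recp n (\<lambda>xs. \<forall>v\<in>set vs. E v xs = 0)" "recp n (\<lambda>xs. \<forall>v\<in>set vs. E v xs \<noteq> 0)"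
        by (intro recp_finite_all recp_not recp_eq rec_const Rel)+
      have 2: "recp n (\<lambda>xs. map (\<lambda>a. a xs) (map (\<lambda>v xs. E v xs - 1) vs) \<in> rel (pre (K xs)) R)"
        by (rule recp_rel) (auto intro!: rec_diff rec_const simp del: One_nat_def)
      have "recf n (\<lambda>xs. Or (if R \<in> \<tau> \<and> (\<forall>v\<in>set vs. E v xs = 0) then Rel R (map Var vs) else decide False)
        (decide ((\<forall>v\<in>set vs. E v xs \<noteq> 0) \<and>
          map (\<lambda>a. a xs) (map (\<lambda>v xs. E v xs - 1) vs) \<in> rel (pre (K xs)) R)))"
        by (intro recf_Or recf_if recf_decide recp_conj recp_const 1 2 recf_const)
      then show ?thesis using False unfolding Sym by (simp add: big_atom_def comp_def)
    qed
  qed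
  then show ?case by (simp add: vs_def)
next
  case (Neg \<phi>)
  then show ?case by (simp add: recf_Neg)
next
  case (Or \<phi> \<psi>)
  then show ?case by (simp add: recf_Or)
next
  case (Ex x \<phi>)
  have 1: "recf n (\<lambda>xs. big \<tau> U (pre (K xs)) (u xs) ((\<lambda>y. E y xs)(x := 0)) \<phi>)"
  proof -
    have "recf n (\<lambda>xs. big \<tau> U (pre (K xs)) (u xs) (\<lambda>y. (if y = x then (\<lambda>xs. 0) else E y) xs) \<phi>)"
      by (rule Ex.IH) (use Ex.prems in \<open>auto intro: rec_const\<close>)
    moreover have "(\<lambda>y. (if y = x then (\<lambda>xs. 0) else E y) xs) = (\<lambda>y. E y xs)(x := 0)" for xs
      by auto
    ultimately show ?thesis by simp
  qed
  have 2: "recf (Suc n) (\<lambda>ys. big \<tau> U (pre (K (tl ys))) (u (tl ys)) ((\<lambda>y. E y (tl ys))(x := Suc (hd ys))) \<phi>)"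
  proof -
    have "recf (Suc n) (\<lambda>ys. big \<tau> U (pre (K (tl ys))) (u (tl ys))
        (\<lambda>y. (if y = x then (\<lambda>ys. Suc (hd ys)) else (\<lambda>ys. E y (tl ys))) ys) \<phi>)"
      by (rule Ex.IH) (use Ex.prems in \<open>auto intro: rec_weaken rec_Suc rec_hd\<close>)
    moreover have "(\<lambda>y. (if y = x then (\<lambda>ys. Suc (hd ys)) else (\<lambda>ys. E y (tl ys))) ys) =
        (\<lambda>y. E y (tl ys))(x := Suc (hd ys))" for ys by auto
    ultimately show ?thesis by simp
  qed
  show ?case unfolding big.simps
    by (intro recf_Or recf_Ex recf_BigOr 1 2 recf_if recp_universe recf_const rec_hd rec_weaken Ex.prems)
qed

end

text \<open>The constants from the last element on all have the same value.\<close>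

definition size_ge :: "nat \<Rightarrow> fm" where
  "size_ge j = (if j \<le> 1 then decide True else Neg (Eq (Const (j - 1)) (Const (j - 2))))"

lemma sat_size_ge:
  assumes A: "A \<in> ARITHM \<tau>" and j: "j \<le> h"
  shows "sat (expand_consts h A) s (size_ge j) \<longleftrightarrow> j \<le> card (universe A)"
proof -
  let ?n = "card (universe A)"
  have n: "1 \<le> ?n" using ARITHM_universe[OF A] by (simp add: Suc_le_eq card_gt_0_iff)
  consider "j \<le> 1" | "2 \<le> j" "j \<le> ?n" | "2 \<le> j" "?n < j" by linarith
  then show ?thesis
  proof cases
    case 1
    then show ?thesis using n by (simp add: size_ge_def)
  next
    case 2
    then have "j - 1 < ?n" "j - 2 < ?n" "j - 1 \<noteq> j - 2" by auto
    then have "arith_elem A (j - 1) \<noteq> arith_elem A (j - 2)" using arith_elem_in(2)[OF A] by metis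
    then show ?thesis using 2 j by (simp add: size_ge_def expand_consts_simps)
  next
    case 3
    then have "the (con (expand_consts h A) i) = arith_elem A (?n - 1)" if "i = j - 1 \<or> i = j - 2" for i
      using that j n by (cases "i < ?n") (auto simp: expand_consts_def intro!: arg_cong[where f = "arith_elem A"])
    then show ?thesis using 3 by (simp add: size_ge_def)
  qed
qed

lemma para_FO_subset_XFO_qr: "para_FO \<subseteq> XFO_qr"
proof (rule subrelI)
  fix \<tau> Q assume "(\<tau>, Q) \<in> para_FO"
  then obtain \<tau>' U \<phi> and pre :: "nat \<Rightarrow> nat struct" where
    Q: "param_problem \<tau> Q" and \<tau>': "vocabulary \<tau>'" and voc: "\<tau> \<inter> \<tau>' = arith_voc" and
    U: "arity U = 1" "U \<notin> \<tau> \<union> \<tau>'" and pre: "\<And>k. pre k \<in> ARITHM \<tau>'" and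
    comp: "computable (\<lambda>k. struct_encode (pre k))" and \<phi>: "\<phi> \<in> sentences (\<tau> \<union> \<tau>' \<union> {U}) 0" and
    iff: "\<And>A k. A \<in> ARITHM \<tau> \<Longrightarrow> (A, k) \<in> Q \<longleftrightarrow> models (struct_sum U A (pre k)) \<phi>"
    unfolding para_FO_def mem_Collect_eq prod.case by blast
  have fin: "finite \<tau>'" using \<tau>' by (simp add: vocabulary_def)
  have over: "fm_over (\<tau> \<union> \<tau>' \<union> {U}) 0 \<phi>" and free: "free_vars \<phi> = {}"
    using \<phi> by (auto simp: sentences_def)
  have av: "arith_voc \<subseteq> \<tau>" using voc by blast
  define u where "u k = set_encode (universe (pre k))" for k
  define N where "N k = (u k + 2) * (u k + 2)" for k
  define h where "h k = N k + 2" for k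
  define f where "f k = Or (And (size_ge (N k)) (big \<tau> U (pre k) (u k) (\<lambda>x. 0) \<phi>))
    (BigOr (N k) (\<lambda>n. And (And (size_ge n) (Neg (size_ge (Suc n)))) (small \<tau> U (pre k) (u k) n (\<lambda>x. 0) \<phi>)))" for k
  have u: "universe (pre k) \<subseteq> {..<u k}" for k
    using less_set_encode[OF ARITHM_universe(1)[OF pre]] by (auto simp: u_def)
  have pos: "arith_pos (pre k) l < u k" if "l \<in> universe (pre k)" for k l
    using arith_pos_less[OF pre that] card_mono[OF _ u[of k]] by simp
  have uh: "Suc (u k) < h k" for k
  proof -
    have "u k + 2 \<le> N k" unfolding N_def by simp
    then show ?thesis unfolding h_def by simp
  qed
  have rec_u: "rec n (\<lambda>xs. u (K xs))" if "rec n K" for n K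
    unfolding u_def by (rule rec_universe_code[OF pre fin comp that])
  have rec_N: "rec n (\<lambda>xs. N (K xs))" if "rec n K" for n K
    unfolding N_def by (intro rec_mult rec_add rec_const rec_u that)
  have K: "rec 1 (\<lambda>xs. xs ! 0)" by (rule rec_nth) simp
  have "computable h" unfolding computable_iff_rec h_def by (intro rec_add rec_N K rec_const)
  moreover have "computable (\<lambda>k. fm_encode (f k))"
  proof -
    have ge: "recf n (\<lambda>xs. size_ge (a xs))" if "rec n a" for n a
      unfolding size_ge_def by (intro recf_intros recp_le rec_const rec_diff that)
    have "recf 1 (\<lambda>xs. f (xs ! 0))"
      unfolding f_def
      by (intro recf_Or recf_And recf_BigOr recf_Neg ge rec_N rec_Suc rec_hd
          recf_big[OF pre fin comp _ _ _ over] recf_small[OF pre fin comp _ _ _ _ over] rec_u rec_weaken K rec_const)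
    then show ?thesis unfolding computable_iff_rec recf_def .
  qed
  moreover have "f k \<in> FO_rank (quantifier_rank \<phi> + 5) \<tau> (h k)" for k
  proof -
    have "fm_over \<tau> (h k) (size_ge j)" if "j \<le> h k" for j
      using that by (auto simp: size_ge_def h_def)
    moreover have "fm_over \<tau> (h k) (big \<tau> U (pre k) (u k) (\<lambda>x. 0) \<phi>)"
      by (rule fm_over_big[OF over av pos uh]) auto
    moreover have "fm_over \<tau> (h k) (small \<tau> U (pre k) (u k) n (\<lambda>x. 0) \<phi>)" if "n < N k" for n
      by (rule fm_over_small[OF over]) (use that in \<open>simp add: h_def\<close>)
    ultimately have 1: "fm_over \<tau> (h k) (f k)" by (auto simp: f_def h_def)
    have "free_vars (size_ge j) = {}" for j by (simp add: size_ge_def)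
    then have 2: "free_vars (f k) = {}"
      using free_vars_big[OF over, of "pre k" "u k" "\<lambda>x. 0"] free free_vars_small by (simp add: f_def)
    have ge: "quantifier_rank (size_ge j) = 0" for j by (simp add: size_ge_def)
    have "quantifier_rank (f k) \<le> quantifier_rank \<phi> + 5"
      unfolding f_def using quantifier_rank_big
      by (auto simp: ge intro!: quantifier_rank_BigOr) (simp add: quantifier_rank_small)
    with 1 2 show ?thesis by (simp add: FO_rank_def sentences_def)
  qed
  moreover have "(A, k) \<in> Q \<longleftrightarrow> models (expand_consts (h k) A) (f k)" if A: "A \<in> ARITHM \<tau>" for A k
  proof -
    let ?n = "card (universe A)"
    obtain a where a: "a \<in> universe A" using ARITHM_universe(2)[OF A] by blast
    let ?s = "\<lambda>x::nat. a"
    have "0 < ?n" using a ARITHM_universe(1)[OF A] by (auto simp: card_gt_0_iff)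
    have ge: "sat (expand_consts (h k) A) ?s (size_ge j) \<longleftrightarrow> j \<le> ?n" if "j \<le> Suc (N k)" for j
      by (rule sat_size_ge[OF A]) (use that in \<open>simp add: h_def\<close>)
    have B: "models (struct_sum U A (pre k)) \<phi> \<longleftrightarrow> sat (struct_sum U A (pre k)) s \<phi>" for s
      by (rule models_iff_sat[OF free]) (use a in \<open>auto simp: struct_sum_simps sum_univ_def\<close>)
    have f: "free_vars (f k) = {}" using calculation(3)[of k] by (simp add: FO_rank_def sentences_def)
    have "models (expand_consts (h k) A) (f k) \<longleftrightarrow> sat (expand_consts (h k) A) ?s (f k)"
      by (rule models_iff_sat[OF f]) (use a in \<open>auto simp: expand_consts_simps\<close>)
    also have "\<dots> \<longleftrightarrow> models (struct_sum U A (pre k)) \<phi>"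
    proof (cases "N k \<le> ?n")
      case True
      have "sat (expand_consts (h k) A) ?s (f k) \<longleftrightarrow>
          sat (expand_consts (h k) A) ?s (big \<tau> U (pre k) (u k) (\<lambda>x. 0) \<phi>)"
        using True by (auto simp: f_def ge)
      also have "\<dots> \<longleftrightarrow> models (struct_sum U A (pre k)) \<phi>"
        unfolding B[of "\<lambda>x. if (0::nat) = 0 then Inl a else Inr (0 - 1)"]
        by (rule sat_big[OF A pre voc U u pos _ uh over, symmetric]) (use True a in \<open>auto simp: N_def\<close>)
      finally show ?thesis .
    next
      case False
      have "sat (expand_consts (h k) A) ?s (f k) \<longleftrightarrow>
          sat (expand_consts (h k) A) ?s (small \<tau> U (pre k) (u k) ?n (\<lambda>x. 0) \<phi>)"
      proof -
        have "sat (expand_consts (h k) A) ?s (f k) \<longleftrightarrow>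
            (\<exists>n<N k. n \<le> ?n \<and> \<not> Suc n \<le> ?n \<and> sat (expand_consts (h k) A) ?s (small \<tau> U (pre k) (u k) n (\<lambda>x. 0) \<phi>))"
          using False by (auto simp: f_def ge)
        also have "\<dots> \<longleftrightarrow> sat (expand_consts (h k) A) ?s (small \<tau> U (pre k) (u k) ?n (\<lambda>x. 0) \<phi>)"
          using False by (metis le_antisym not_less_eq_eq not_le order_refl)
        finally show ?thesis .
      qed
      also have "\<dots> \<longleftrightarrow> models (struct_sum U A (pre k)) \<phi>"
        unfolding B[of "\<lambda>x. if 0 < ?n then Inl (arith_elem A 0) else Inr (0 - ?n)"]
        by (rule sat_small[OF A pre voc U refl _ u over, symmetric]) (use False \<open>0 < ?n\<close> in \<open>auto simp: h_def\<close>)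
      finally show ?thesis .
    qed
    finally show ?thesis using iff[OF A] by simp
  qed
  ultimately show "(\<tau>, Q) \<in> XFO_qr" using Q unfolding XFO_qr_def slicewise_definable_def by blast
qed

section \<open>Definable relations\<close>

text \<open>The list consists of the values of the variables \<open>0, \<dots>, n - 1\<close>, so a quantifier appends an element.\<close>

definition definable :: "symb set \<Rightarrow> nat \<Rightarrow> ('a struct \<Rightarrow> 'a list \<Rightarrow> bool) \<Rightarrow> bool" where
  "definable \<sigma> n P \<longleftrightarrow> (\<exists>\<phi>. fm_over \<sigma> 0 \<phi> \<and> free_vars \<phi> \<subseteq> {..<n} \<and>
     (\<forall>B s. sat B s \<phi> \<longleftrightarrow> P B (map s [0..<n])))"

definition isvar :: "nat \<Rightarrow> ('a list \<Rightarrow> 'a) \<Rightarrow> bool" where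
  "isvar n v \<longleftrightarrow> (\<exists>i<n. \<forall>xs. length xs = n \<longrightarrow> v xs = xs ! i)"

lemma definableI:
  assumes "fm_over \<sigma> 0 \<phi>" "free_vars \<phi> \<subseteq> {..<n}" "\<And>B s. sat B s \<phi> \<longleftrightarrow> P B (map s [0..<n])"
  shows "definable \<sigma> n P"
  using assms unfolding definable_def by blast

lemma definable_cong:
  assumes "definable \<sigma> n P" "\<And>B xs. length xs = n \<Longrightarrow> P B xs \<longleftrightarrow> Q B xs"
  shows "definable \<sigma> n Q"
  using assms unfolding definable_def by (metis length_map diff_zero length_upt)

lemma isvar_last: "isvar (Suc n) last"
  unfolding isvar_def by (rule exI[of _ n]) (auto simp: last_conv_nth simp flip: length_greater_0_conv)

lemma isvar_weaken:
  assumes "isvar n v" shows "isvar (Suc n) (\<lambda>ys. v (butlast ys))"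
proof -
  obtain i where "i < n" "\<And>xs. length xs = n \<Longrightarrow> v xs = xs ! i" using assms unfolding isvar_def by blast
  then show ?thesis unfolding isvar_def by (intro exI[of _ i]) (auto simp: nth_butlast)
qed

lemma isvar_take:
  assumes "isvar n v" shows "isvar (n + r) (\<lambda>ys. v (take n ys))"
proof -
  obtain i where "i < n" "\<And>xs. length xs = n \<Longrightarrow> v xs = xs ! i" using assms unfolding isvar_def by blast
  then show ?thesis unfolding isvar_def by (intro exI[of _ i]) auto
qed

lemma isvar_drop: "j < r \<Longrightarrow> isvar (n + r) (\<lambda>ys. drop n ys ! j)"
  unfolding isvar_def by (rule exI[of _ "n + j"]) auto

lemma definable_rel:
  assumes "R \<in> \<sigma>" "length vs = arity R" "\<And>v. v \<in> set vs \<Longrightarrow> isvar n v"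
  shows "definable \<sigma> n (\<lambda>B xs. map (\<lambda>v. v xs) vs \<in> rel B R)"
proof -
  define i where "i v = (SOME i. i < n \<and> (\<forall>xs. length xs = n \<longrightarrow> v xs = xs ! i))" for v :: "'a list \<Rightarrow> 'a"
  have i: "i v < n" "length xs = n \<Longrightarrow> v xs = xs ! i v" if "v \<in> set vs" for v xs
    using someI_ex[OF assms(3)[OF that, unfolded isvar_def]] unfolding i_def by blast+
  show ?thesis
  proof (rule definableI[where \<phi> = "Rel R (map (\<lambda>v. Var (i v)) vs)"])
    show "sat B s (Rel R (map (\<lambda>v. Var (i v)) vs)) \<longleftrightarrow> map (\<lambda>v. v (map s [0..<n])) vs \<in> rel B R" for B s
    proof -
      have "v (map s [0..<n]) = s (i v)" if "v \<in> set vs" for v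
        using i(1)[OF that] i(2)[OF that, of "map s [0..<n]"] by simp
      then have "map (\<lambda>v. v (map s [0..<n])) vs = map (\<lambda>v. s (i v)) vs" by simp
      then show ?thesis by (simp add: comp_def del: map_eq_conv)
    qed
  qed (use assms i in auto)
qed

lemma definable_rel1: "R \<in> \<sigma> \<Longrightarrow> arity R = 1 \<Longrightarrow> isvar n u \<Longrightarrow> definable \<sigma> n (\<lambda>B xs. [u xs] \<in> rel B R)"
  using definable_rel[of R \<sigma> "[u]" n] by auto

lemma definable_rel2:
  "R \<in> \<sigma> \<Longrightarrow> arity R = 2 \<Longrightarrow> isvar n u \<Longrightarrow> isvar n v \<Longrightarrow> definable \<sigma> n (\<lambda>B xs. [u xs, v xs] \<in> rel B R)"
  using definable_rel[of R \<sigma> "[u, v]" n] by auto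

lemma definable_rel3:
  "R \<in> \<sigma> \<Longrightarrow> arity R = 3 \<Longrightarrow> isvar n u \<Longrightarrow> isvar n v \<Longrightarrow> isvar n w \<Longrightarrow>
    definable \<sigma> n (\<lambda>B xs. [u xs, v xs, w xs] \<in> rel B R)"
  using definable_rel[of R \<sigma> "[u, v, w]" n] by auto

lemma definable_eq:
  assumes "isvar n u" "isvar n v" shows "definable \<sigma> n (\<lambda>B xs. u xs = v xs)"
proof -
  obtain i j where "i < n" "j < n" "\<And>xs. length xs = n \<Longrightarrow> u xs = xs ! i" "\<And>xs. length xs = n \<Longrightarrow> v xs = xs ! j"
    using assms unfolding isvar_def by blast
  then show ?thesis by (intro definableI[where \<phi> = "Eq (Var i) (Var j)"]) auto
qed

lemma definable_not: "definable \<sigma> n P \<Longrightarrow> definable \<sigma> n (\<lambda>B xs. \<not> P B xs)"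
proof -
  assume "definable \<sigma> n P"
  then obtain \<phi> where "fm_over \<sigma> 0 \<phi>" "free_vars \<phi> \<subseteq> {..<n}" "\<And>B s. sat B s \<phi> \<longleftrightarrow> P B (map s [0..<n])"
    unfolding definable_def by blast
  then show ?thesis by (intro definableI[where \<phi> = "Neg \<phi>"]) auto
qed

lemma definable_disj:
  assumes "definable \<sigma> n P" "definable \<sigma> n Q" shows "definable \<sigma> n (\<lambda>B xs. P B xs \<or> Q B xs)"
proof -
  obtain \<phi> where "fm_over \<sigma> 0 \<phi>" "free_vars \<phi> \<subseteq> {..<n}" "\<And>B s. sat B s \<phi> \<longleftrightarrow> P B (map s [0..<n])"
    using assms(1) unfolding definable_def by blast
  moreover obtain \<psi> where "fm_over \<sigma> 0 \<psi>" "free_vars \<psi> \<subseteq> {..<n}" "\<And>B s. sat B s \<psi> \<longleftrightarrow> Q B (map s [0..<n])"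
    using assms(2) unfolding definable_def by blast
  ultimately show ?thesis by (intro definableI[where \<phi> = "Or \<phi> \<psi>"]) auto
qed

lemma definable_conj: "definable \<sigma> n P \<Longrightarrow> definable \<sigma> n Q \<Longrightarrow> definable \<sigma> n (\<lambda>B xs. P B xs \<and> Q B xs)"
  using definable_not[OF definable_disj[OF definable_not definable_not], of \<sigma> n P Q] by simp

lemma definable_imp: "definable \<sigma> n P \<Longrightarrow> definable \<sigma> n Q \<Longrightarrow> definable \<sigma> n (\<lambda>B xs. P B xs \<longrightarrow> Q B xs)"
  unfolding imp_conv_disj by (intro definable_disj definable_not)

lemma definable_iff: "definable \<sigma> n P \<Longrightarrow> definable \<sigma> n Q \<Longrightarrow> definable \<sigma> n (\<lambda>B xs. P B xs \<longleftrightarrow> Q B xs)"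
  unfolding iff_conv_conj_imp by (intro definable_conj definable_imp)

lemma definable_const: "definable \<sigma> n (\<lambda>B xs. c)"
proof -
  have "definable \<sigma> n (\<lambda>B xs. True)"
    by (rule definableI[where \<phi> = "Or (Ex 0 (Eq (Var 0) (Var 0))) (Neg (Ex 0 (Eq (Var 0) (Var 0))))"]) auto
  from this definable_not[OF this] show ?thesis by (cases c) auto
qed

lemma definable_ex:
  assumes "definable \<sigma> (Suc n) (\<lambda>B ys. P B (butlast ys) (last ys))"
  shows "definable \<sigma> n (\<lambda>B xs. \<exists>a\<in>universe B. P B xs a)"
proof -
  obtain \<phi> where \<phi>: "fm_over \<sigma> 0 \<phi>" "free_vars \<phi> \<subseteq> {..<Suc n}"
    "\<And>B s. sat B s \<phi> \<longleftrightarrow> P B (butlast (map s [0..<Suc n])) (last (map s [0..<Suc n]))"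
    using assms unfolding definable_def by blast
  have "butlast (map (s(n := a)) [0..<Suc n]) = map s [0..<n]" "last (map (s(n := a)) [0..<Suc n]) = a"
    for s :: "nat \<Rightarrow> 'a" and a by (auto simp: map_butlast)
  then show ?thesis using \<phi>(1,2)
    by (intro definableI[where \<phi> = "Ex n \<phi>"]) (auto simp: \<phi>(3) lessThan_Suc)
qed

lemma definable_all:
  assumes "definable \<sigma> (Suc n) (\<lambda>B ys. P B (butlast ys) (last ys))"
  shows "definable \<sigma> n (\<lambda>B xs. \<forall>a\<in>universe B. P B xs a)"
  using definable_not[OF definable_ex[OF definable_not[OF assms]]] by simp

lemma definable_ex_list:
  assumes "definable \<sigma> (n + r) (\<lambda>B ys. P B (take n ys) (drop n ys))"
  shows "definable \<sigma> n (\<lambda>B xs. \<exists>as. length as = r \<and> set as \<subseteq> universe B \<and> P B xs as)"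
  using assms
proof (induction r arbitrary: P)
  case 0
  then show ?case by (auto elim!: definable_cong)
next
  case (Suc r)
  have "definable \<sigma> (Suc (n + r)) (\<lambda>B ys. P B (take n (butlast ys)) (drop n (butlast ys) @ [last ys]))"
  proof (rule definable_cong[of _ _ "\<lambda>B ys. P B (take n ys) (drop n ys)"])
    show "definable \<sigma> (Suc (n + r)) (\<lambda>B ys. P B (take n ys) (drop n ys))" using Suc.prems by simp
    fix B and ys :: "'a list" assume l: "length ys = Suc (n + r)"
    then have "ys \<noteq> []" by auto
    then obtain zs z where "ys = zs @ [z]" by (metis append_butlast_last_id)
    then show "P B (take n ys) (drop n ys) \<longleftrightarrow> P B (take n (butlast ys)) (drop n (butlast ys) @ [last ys])"
      using l by simp
  qed
  then have "definable \<sigma> (n + r) (\<lambda>B ys. \<exists>a\<in>universe B. P B (take n ys) (drop n ys @ [a]))"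
    by (rule definable_ex)
  from Suc.IH[OF this] show ?case
  proof (rule definable_cong)
    fix B and xs :: "'a list"
    show "(\<exists>as. length as = r \<and> set as \<subseteq> universe B \<and> (\<exists>a\<in>universe B. P B xs (as @ [a]))) \<longleftrightarrow>
        (\<exists>as. length as = Suc r \<and> set as \<subseteq> universe B \<and> P B xs as)" (is "?L \<longleftrightarrow> ?R")
    proof
      assume ?L
      then obtain as a where "length as = r" "set as \<subseteq> universe B" "a \<in> universe B" "P B xs (as @ [a])" by blast
      then show ?R by (intro exI[of _ "as @ [a]"]) auto
    next
      assume ?R
      then obtain as where as: "length as = Suc r" "set as \<subseteq> universe B" "P B xs as" by blast
      then obtain zs z where "as = zs @ [z]" by (metis append_butlast_last_id list.size(3) nat.simps(3))
      with as show ?L by (intro exI[of _ zs]) auto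
    qed
  qed
qed

lemma definable_finite_all:
  assumes "finite S" "\<And>x. x \<in> S \<Longrightarrow> definable \<sigma> n (P x)" shows "definable \<sigma> n (\<lambda>B xs. \<forall>x\<in>S. P x B xs)"
  using assms by (induction S) (simp_all add: definable_const definable_conj)

lemmas definable_intros = definable_not definable_disj definable_conj definable_imp definable_iff
  definable_const definable_ex definable_all definable_eq

section \<open>Evaluation of a coded formula by a fixed sentence\<close>

inductive isenv :: "nat \<Rightarrow> ('a list \<Rightarrow> ('a \<times> 'a) list) \<Rightarrow> bool" for n where
  Nil: "isenv n (\<lambda>xs. [])"
| Cons: "isvar n u \<Longrightarrow> isvar n v \<Longrightarrow> isenv n f \<Longrightarrow> isenv n (\<lambda>xs. (u xs, v xs) # f xs)"

lemma isenv_weaken: "isenv n f \<Longrightarrow> isenv (Suc n) (\<lambda>ys. f (butlast ys))"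
  by (induction rule: isenv.induct) (auto intro: isenv.intros isvar_weaken)

lemma isenv_take: "isenv n f \<Longrightarrow> isenv (n + r) (\<lambda>ys. f (take n ys))"
  by (induction rule: isenv.induct) (auto intro: isenv.intros isvar_take)

lemma definable_rel_drop:
  assumes "R \<in> \<sigma>" shows "definable \<sigma> (n + arity R) (\<lambda>B ys. drop n ys \<in> rel B R)"
proof -
  have "definable \<sigma> (n + arity R)
      (\<lambda>B ys. map (\<lambda>v. v ys) (map (\<lambda>j ys. drop n ys ! j) [0..<arity R]) \<in> rel B R)"
    by (rule definable_rel) (use assms isvar_drop in auto)
  then show ?thesis
  proof (rule definable_cong)
    fix B :: "'a struct" and ys :: "'a list" assume "length ys = n + arity R"
    then have "map (\<lambda>v. v ys) (map (\<lambda>j ys. drop n ys ! j) [0..<arity R]) = drop n ys"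
      by (intro nth_equalityI) auto
    then show "map (\<lambda>v. v ys) (map (\<lambda>j ys. drop n ys ! j) [0..<arity R]) \<in> rel B R \<longleftrightarrow> drop n ys \<in> rel B R"
      by simp
  qed
qed

definition aux :: "nat \<Rightarrow> nat \<Rightarrow> symb" where
  "aux b j = Sym 3 (b + j)"

fun lookup :: "('a \<times> 'a) list \<Rightarrow> 'a \<Rightarrow> 'a \<Rightarrow> bool" where
  "lookup [] x a \<longleftrightarrow> False"
| "lookup ((y, c) # bs) x a \<longleftrightarrow> x = y \<and> a = c \<or> x \<noteq> y \<and> lookup bs x a"

text \<open>With \<open>z\<close> the least element of the precomputed part, at position \<open>|A|\<close>, and \<open>l\<close> at position \<open>|A| + l'\<close>, the
  built-in addition \<open>a + z = l\<close> of the sum identifies the element \<open>a\<close> of \<open>A\<close> at position \<open>l'\<close>.\<close>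

definition const_val :: "symb \<Rightarrow> 'a struct \<Rightarrow> 'a \<Rightarrow> 'a \<Rightarrow> 'a \<Rightarrow> bool" where
  "const_val U B l z a \<longleftrightarrow> [a] \<notin> rel B U \<and> ([a, z, l] \<in> rel B Add \<or>
     (\<forall>c\<in>universe B. [c] \<notin> rel B U \<longrightarrow> [c, z, l] \<notin> rel B Add \<and> [a, c] \<notin> rel B Less))"

definition term_val :: "nat \<Rightarrow> symb \<Rightarrow> 'a struct \<Rightarrow> ('a \<times> 'a) list \<Rightarrow> 'a \<Rightarrow> 'a \<Rightarrow> bool" where
  "term_val b U B bs t a \<longleftrightarrow>
     (\<exists>l\<in>universe B. \<exists>z\<in>universe B. [t, l, z] \<in> rel B (aux b 4) \<and> const_val U B l z a) \<or>
     (\<exists>x\<in>universe B. [t, x, x] \<in> rel B (aux b 5) \<and> lookup bs x a)"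

text \<open>The roles of the auxiliary symbols are fixed by \<open>aux_pred\<close> below. The element \<open>t\<close> codes the set of
  formulas true under the assignment \<open>bs\<close>, where \<open>X\<close> decides the existential ones.\<close>

definition truth_set :: "nat \<Rightarrow> symb \<Rightarrow> symb set \<Rightarrow> 'a struct \<Rightarrow> ('a \<times> 'a) list \<Rightarrow> ('a \<Rightarrow> 'a \<Rightarrow> bool) \<Rightarrow> 'a \<Rightarrow> bool" where
  "truth_set b U \<tau> B bs X t \<longleftrightarrow> [t, t, t] \<in> rel B (aux b 1) \<and>
     (\<forall>p\<in>universe B. \<forall>y\<in>universe B. \<forall>z\<in>universe B. [p, y, z] \<in> rel B (aux b 2) \<longrightarrow>
       ([p, t, t] \<in> rel B (aux b 0) \<longleftrightarrow> (\<exists>a\<in>universe B. term_val b U B bs y a \<and> term_val b U B bs z a))) \<and>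
     (\<forall>R\<in>\<tau>. \<forall>p\<in>universe B. [p, p, p] \<in> rel B (aux b (8 + 2 * symb_encode R)) \<longrightarrow>
       ([p, t, t] \<in> rel B (aux b 0) \<longleftrightarrow> (\<exists>as. length as = arity R \<and> set as \<subseteq> universe B \<and> as \<in> rel B R \<and>
         (\<forall>j\<in>{..<arity R}. \<exists>y\<in>universe B. [p, y, y] \<in> rel B (aux b (7 + 2 * j)) \<and> term_val b U B bs y (as ! j))))) \<and>
     (\<forall>p\<in>universe B. \<forall>x\<in>universe B. \<forall>c\<in>universe B. [p, x, c] \<in> rel B (aux b 3) \<longrightarrow>
       ([p, t, t] \<in> rel B (aux b 0) \<longleftrightarrow> X x c))"

text \<open>Formulas of rank larger than the first argument get arbitrary truth values, which do not affect the others.\<close>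

fun eval_code :: "nat \<Rightarrow> symb \<Rightarrow> symb set \<Rightarrow> 'a struct \<Rightarrow> nat \<Rightarrow> ('a \<times> 'a) list \<Rightarrow> 'a \<Rightarrow> bool" where
  "eval_code b U \<tau> B 0 bs p \<longleftrightarrow>
     (\<exists>t\<in>universe B. truth_set b U \<tau> B bs (\<lambda>x c. False) t \<and> [p, t, t] \<in> rel B (aux b 0))"
| "eval_code b U \<tau> B (Suc i) bs p \<longleftrightarrow>
     (\<exists>t\<in>universe B. truth_set b U \<tau> B bs
       (\<lambda>x c. \<exists>a\<in>universe B. [a] \<notin> rel B U \<and> eval_code b U \<tau> B i ((x, a) # bs) c) t \<and>
       [p, t, t] \<in> rel B (aux b 0))"

context
  fixes b L :: nat and U :: symb and \<tau> \<sigma> :: "symb set"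
  assumes aux_in: "\<And>j. j < L \<Longrightarrow> aux b j \<in> \<sigma>" and U_in: "U \<in> \<sigma>" "arity U = 1"
    and voc_in: "\<tau> \<subseteq> \<sigma>" "arith_voc \<subseteq> \<sigma>" "finite \<tau>"
    and L: "8 \<le> L" "\<And>R. R \<in> \<tau> \<Longrightarrow> 8 + 2 * symb_encode R < L" "\<And>R. R \<in> \<tau> \<Longrightarrow> 7 + 2 * arity R < L"
begin

lemma definable_aux:
  assumes "j < L" "isvar n x" "isvar n y" "isvar n z"
  shows "definable \<sigma> n (\<lambda>B xs. [x xs, y xs, z xs] \<in> rel B (aux b j))"
  by (rule definable_rel3) (use assms aux_in in \<open>auto simp: aux_def\<close>)

lemma definable_lookup:
  assumes "isenv n bs" "isvar n x" "isvar n a"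
  shows "definable \<sigma> n (\<lambda>B xs. lookup (bs xs) (x xs) (a xs))"
  using assms by induction (auto intro!: definable_intros)

lemma definable_const_val:
  assumes "isvar n l" "isvar n z" "isvar n a"
  shows "definable \<sigma> n (\<lambda>B xs. const_val U B (l xs) (z xs) (a xs))"
proof -
  have [simp]: "Less \<in> \<sigma>" "Add \<in> \<sigma>" using voc_in(2) by (auto simp: arith_voc_def)
  show ?thesis unfolding const_val_def
    by (intro definable_intros definable_rel1 definable_rel2 definable_rel3 U_in isvar_last isvar_weaken assms) simp_all
qed

lemma definable_term_val:
  assumes "isenv n bs" "isvar n t" "isvar n a"
  shows "definable \<sigma> n (\<lambda>B xs. term_val b U B (bs xs) (t xs) (a xs))"
  unfolding term_val_def using L(1)
  by (intro definable_intros definable_aux definable_const_val definable_lookup isvar_last isvar_weaken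
      isenv_weaken assms) simp_all

lemma definable_truth_set:
  assumes "isenv n bs" "isvar n t"
    and X: "definable \<sigma> (Suc (Suc (Suc n)))
      (\<lambda>B ys. X B (butlast (butlast (butlast ys))) (last (butlast ys)) (last ys))"
  shows "definable \<sigma> n (\<lambda>B xs. truth_set b U \<tau> B (bs xs) (X B xs) (t xs))"
proof -
  have "definable \<sigma> n (\<lambda>B xs. \<forall>R\<in>\<tau>. \<forall>p\<in>universe B. [p, p, p] \<in> rel B (aux b (8 + 2 * symb_encode R)) \<longrightarrow>
       ([p, t xs, t xs] \<in> rel B (aux b 0) \<longleftrightarrow>
        (\<exists>as. length as = arity R \<and> set as \<subseteq> universe B \<and> as \<in> rel B R \<and>
         (\<forall>j\<in>{..<arity R}. \<exists>y\<in>universe B. [p, y, y] \<in> rel B (aux b (7 + 2 * j)) \<and>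
           term_val b U B (bs xs) y (as ! j)))))"
  proof (rule definable_finite_all[OF voc_in(3)])
    fix R assume R: "R \<in> \<tau>"
    have j: "7 + 2 * j < L" if "j \<in> {..<arity R}" for j using L(3)[OF R] that by simp
    have "definable \<sigma> (Suc n + arity R) (\<lambda>B ys. drop (Suc n) ys \<in> rel B R \<and>
        (\<forall>j\<in>{..<arity R}. \<exists>y\<in>universe B.
          [last (take (Suc n) ys), y, y] \<in> rel B (aux b (7 + 2 * j)) \<and>
          term_val b U B (bs (butlast (take (Suc n) ys))) y (drop (Suc n) ys ! j)))"
      by (intro definable_conj definable_rel_drop definable_finite_all definable_ex definable_aux
          definable_term_val isvar_last isvar_weaken isenv_weaken[of "Suc n + arity R"] isenv_take isvar_drop
          isvar_take[of "Suc n" last] isenv_take[of "Suc n" "\<lambda>ys. bs (butlast ys)"] isenv_weaken[of n] assms j)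
        (use voc_in R in auto)
    then show "definable \<sigma> n (\<lambda>B xs. \<forall>p\<in>universe B. [p, p, p] \<in> rel B (aux b (8 + 2 * symb_encode R)) \<longrightarrow>
       ([p, t xs, t xs] \<in> rel B (aux b 0) \<longleftrightarrow>
        (\<exists>as. length as = arity R \<and> set as \<subseteq> universe B \<and> as \<in> rel B R \<and>
         (\<forall>j\<in>{..<arity R}. \<exists>y\<in>universe B. [p, y, y] \<in> rel B (aux b (7 + 2 * j)) \<and>
           term_val b U B (bs xs) y (as ! j)))))"
      using L(1) L(2)[OF R]
      by (intro definable_all definable_imp definable_iff definable_aux definable_ex_list isvar_last isvar_weaken assms) simp_all
  qed
  then show ?thesis unfolding truth_set_def using L(1)
    by (intro definable_conj definable_all definable_imp definable_iff definable_ex definable_aux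
        definable_term_val isvar_last isvar_weaken isenv_weaken assms) simp_all
qed

lemma definable_eval_code:
  assumes "isenv n bs" "isvar n p"
  shows "definable \<sigma> n (\<lambda>B xs. eval_code b U \<tau> B i (bs xs) (p xs))"
  using assms
proof (induction i arbitrary: n bs p)
  case 0
  then show ?case unfolding eval_code.simps using L(1)
    by (intro definable_ex definable_conj definable_aux isvar_last isvar_weaken isenv_weaken
      definable_truth_set[where X = "\<lambda>B xs x c. False"] definable_const) simp_all
next
  case (Suc i)
  show ?case unfolding eval_code.simps using L(1)
    by (intro definable_ex definable_conj definable_not definable_rel1 definable_aux isvar_last isvar_weaken
        isenv.Cons isenv_weaken Suc U_in
        definable_truth_set[where X = "\<lambda>B ys x c. \<exists>a\<in>universe B. [a] \<notin> rel B U \<and>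
          eval_code b U \<tau> B i ((x, a) # bs (butlast ys)) c"]) simp_all
qed

end

section \<open>The precomputed structure\<close>

fun nth_code :: "nat \<Rightarrow> nat \<Rightarrow> nat \<Rightarrow> bool" where
  "nth_code 0 w y \<longleftrightarrow> (\<exists>v<Suc w. w = Suc (prod_encode (y, v)))"
| "nth_code (Suc i) w y \<longleftrightarrow> (\<exists>a<Suc w. \<exists>v<Suc w. w = Suc (prod_encode (a, v)) \<and> nth_code i v y)"

definition consistent :: "nat \<Rightarrow> nat \<Rightarrow> bool" where
  "consistent c t \<longleftrightarrow> (\<forall>i<Suc c. \<forall>r<Suc c.
     (i = prod_encode (2, r) \<longrightarrow> (i \<in> set_decode t \<longleftrightarrow> r \<notin> set_decode t)) \<and>
     (\<forall>r'<Suc c. i = prod_encode (3, prod_encode (r, r')) \<longrightarrow>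
       (i \<in> set_decode t \<longleftrightarrow> r \<in> set_decode t \<or> r' \<in> set_decode t)))"

text \<open>Here \<open>c\<close> is the code of the formula to be evaluated, and every code of a subformula is at most \<open>c\<close>.
  The index \<open>7 + 2 * i\<close> means that \<open>y\<close> is the \<open>i\<close>-th argument of the atom \<open>x\<close>; the index \<open>8 + 2 * e\<close> means
  that \<open>x\<close> is an atom of the symbol with code \<open>e\<close>.\<close>

definition aux_pred :: "nat \<Rightarrow> nat \<Rightarrow> nat \<Rightarrow> nat \<Rightarrow> nat \<Rightarrow> bool" where
  "aux_pred j c x y z \<longleftrightarrow>
    (if j = 0 then x \<in> set_decode y
     else if j = 1 then consistent c x
     else if j = 2 then x \<le> c \<and> x = prod_encode (0, prod_encode (y, z))
     else if j = 3 then x \<le> c \<and> x = prod_encode (4, prod_encode (y, z))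
     else if j = 4 then x = 2 * y + 1 \<and> z = 0
     else if j = 5 then x = 2 * y
     else if j = 6 then x = c
     else if odd j then \<exists>e<Suc x. \<exists>w<Suc x. x = prod_encode (1, prod_encode (e, w)) \<and> nth_code ((j - 7) div 2) w y
     else x \<le> c \<and> (\<exists>w<Suc x. x = prod_encode (1, prod_encode ((j - 8) div 2, w))))"

definition pre_struct :: "nat \<Rightarrow> nat \<Rightarrow> nat \<Rightarrow> nat struct" where
  "pre_struct b L c = \<lparr>universe = {..<2 ^ Suc c},
     rel = (\<lambda>R. case R of
         Sym r i \<Rightarrow> if r = 3 \<and> b \<le> i \<and> i < b + L
           then {[x, y, z] | x y z. x < 2 ^ Suc c \<and> y < 2 ^ Suc c \<and> z < 2 ^ Suc c \<and> aux_pred (i - b) c x y z}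
           else {}
       | _ \<Rightarrow> rel (arith (2 ^ Suc c)) R),
     con = Map.empty\<rparr>"

lemma recp_nth_code: "rec n w \<Longrightarrow> rec n y \<Longrightarrow> recp n (\<lambda>xs. nth_code i (w xs) (y xs))"
proof (induction i arbitrary: n w y)
  case 0
  then show ?case unfolding nth_code.simps by (intro rec_intros rec_weaken)
next
  case (Suc i)
  show ?case unfolding nth_code.simps by (intro rec_intros rec_weaken Suc)
qed

lemma recp_aux_pred:
  assumes "rec n c" "rec n x" "rec n y" "rec n z"
  shows "recp n (\<lambda>xs. aux_pred j (c xs) (x xs) (y xs) (z xs))"
proof -
  have recp_if: "recp n (\<lambda>xs. if P then Q xs else Q' xs)" if "recp n Q" "recp n Q'" for P Q Q'
    using that by (cases P) simp_all
  show ?thesis unfolding aux_pred_def consistent_def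
    by (intro recp_if rec_intros recp_nth_code rec_weaken assms)
qed

lemma prod_encode_mono: "a \<le> a' \<Longrightarrow> b \<le> b' \<Longrightarrow> prod_encode (a, b) \<le> prod_encode (a', b')"
proof -
  assume "a \<le> a'" "b \<le> b'"
  moreover have "triangle m \<le> triangle n" if "m \<le> n" for m n
    using that unfolding triangle_def by (intro div_le_mono mult_le_mono) auto
  ultimately show ?thesis by (simp add: prod_encode_def add_mono)
qed

lemma computable_pre_struct:
  assumes "computable c" shows "computable (\<lambda>k. struct_encode (pre_struct b L (c k)))"
proof -
  define M where "M k = (2::nat) ^ Suc (c k)" for k
  define bd where "bd k = Suc (prod_encode (3 + prod_encode (3, b + L), list_encode [M k, M k, M k]))" for k
  define D where "D k i \<longleftrightarrow> (\<exists>x<M k. \<exists>y<M k.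
      i = prod_encode (0, list_encode [x, y]) \<and> x < y \<or>
      (\<exists>z<M k. i = prod_encode (1, list_encode [x, y, z]) \<and> z = x + y \<or>
        i = prod_encode (2, list_encode [x, y, z]) \<and> z = x * y \<or>
        (\<exists>j\<in>{..<L}. i = prod_encode (3 + prod_encode (3, b + j), list_encode [x, y, z]) \<and> aux_pred j (c k) x y z)))" for k i
  let ?P = "\<lambda>k. pre_struct b L (c k)"
  have c: "rec n (\<lambda>xs. c (K xs))" if "rec n K" for n K by (rule rec_computable[OF assms that])
  have M: "rec n (\<lambda>xs. M (K xs))" if "rec n K" for n K
    unfolding M_def by (intro rec_power2 rec_Suc c that)
  have bd: "rec n (\<lambda>xs. bd (K xs))" if "rec n K" for n K
    unfolding bd_def list_encode.simps by (intro rec_intros M that)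
  have D: "recp n (\<lambda>xs. D (K xs) (i xs))" if "rec n K" "rec n i" for n K i
    unfolding D_def list_encode.simps by (intro rec_intros recp_finite_ex finite_lessThan recp_aux_pred rec_weaken M c that)
  have set: "{prod_encode (symb_encode R, list_encode xs) | R xs. xs \<in> rel (?P k) R} = {i. i < bd k \<and> D k i}" for k
  proof -
    have "prod_encode (symb_encode R, list_encode xs) < bd k \<and> D k (prod_encode (symb_encode R, list_encode xs))"
      if xs: "xs \<in> rel (?P k) R" for R xs
    proof (cases R)
      case Less
      then obtain x y where "xs = [x, y]" "x < M k" "y < M k" "x < y"
        using xs by (auto simp: pre_struct_def arith_def M_def)
      then show ?thesis using Less unfolding bd_def D_def
        by (auto simp: less_Suc_eq_le intro!: prod_encode_mono)
    next
      case Add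
      then obtain x y where "xs = [x, y, x + y]" "x < M k" "y < M k" "x + y < M k"
        using xs by (auto simp: pre_struct_def arith_def M_def)
      then show ?thesis using Add unfolding bd_def D_def
        by (auto simp: less_Suc_eq_le intro!: prod_encode_mono)
    next
      case Mult
      then obtain x y where "xs = [x, y, x * y]" "x < M k" "y < M k" "x * y < M k"
        using xs by (auto simp: pre_struct_def arith_def M_def)
      then show ?thesis using Mult unfolding bd_def D_def
        by (auto simp: less_Suc_eq_le intro!: prod_encode_mono)
    next
      case (Sym r i)
      then obtain x y z where "r = 3" "b \<le> i" "i < b + L" "xs = [x, y, z]" "x < M k" "y < M k" "z < M k"
        "aux_pred (i - b) (c k) x y z"
        using xs by (auto simp: pre_struct_def M_def split: if_splits)
      note i = this
      have "prod_encode (symb_encode R, list_encode xs) < bd k"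
        using Sym i unfolding bd_def by (auto simp: less_Suc_eq_le intro!: prod_encode_mono)
      moreover have "D k (prod_encode (symb_encode R, list_encode xs))"
        unfolding D_def
        by (intro exI[of _ x] exI[of _ y] exI[of _ z] bexI[of _ "i - b"] conjI disjI2) (use Sym i in auto)
      ultimately show ?thesis ..
    qed
    moreover have "\<exists>R xs. i = prod_encode (symb_encode R, list_encode xs) \<and> xs \<in> rel (?P k) R" if Dki: "D k i" for i
    proof -
      obtain x y where xy: "x < M k" "y < M k" and d: "i = prod_encode (0, list_encode [x, y]) \<and> x < y \<or>
        (\<exists>z<M k. i = prod_encode (1, list_encode [x, y, z]) \<and> z = x + y \<or>
        i = prod_encode (2, list_encode [x, y, z]) \<and> z = x * y \<or>
        (\<exists>j\<in>{..<L}. i = prod_encode (3 + prod_encode (3, b + j), list_encode [x, y, z]) \<and> aux_pred j (c k) x y z))"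
        using Dki unfolding D_def by blast
      from d consider "i = prod_encode (0, list_encode [x, y])" "x < y"
        | z where "z < M k" "i = prod_encode (1, list_encode [x, y, z])" "z = x + y"
        | z where "z < M k" "i = prod_encode (2, list_encode [x, y, z])" "z = x * y"
        | z j where "z < M k" "j \<in> {..<L}" "i = prod_encode (3 + prod_encode (3, b + j), list_encode [x, y, z])"
            "aux_pred j (c k) x y z"
        by blast
      then show ?thesis
      proof cases
        case 1
        then show ?thesis using xy by (intro exI[of _ Less] exI[of _ "[x, y]"]) (auto simp: pre_struct_def arith_def M_def)
      next
        case 2
        then show ?thesis using xy by (intro exI[of _ Add] exI[of _ "[x, y, z]"]) (auto simp: pre_struct_def arith_def M_def)
      next
        case 3
        then show ?thesis using xy by (intro exI[of _ Mult] exI[of _ "[x, y, z]"]) (auto simp: pre_struct_def arith_def M_def)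
      next
        case 4
        then show ?thesis using xy
          by (intro exI[of _ "Sym 3 (b + j)"] exI[of _ "[x, y, z]"]) (auto simp: pre_struct_def M_def)
      qed
    qed
    ultimately show ?thesis by blast
  qed
  have "struct_encode (?P k) = prod_encode (\<Sum>i<M k. 2 ^ i, \<Sum>i<bd k. if D k i then 2 ^ i else 0)" for k
  proof -
    have "set_encode {i. i < bd k \<and> D k i} = (\<Sum>i<bd k. if D k i then 2 ^ i else 0)"
      unfolding set_encode_def by (subst sum.inter_filter[symmetric]) (auto intro!: sum.cong)
    then show ?thesis unfolding struct_encode_def set
      by (simp add: pre_struct_def set_encode_def M_def)
  qed
  moreover have "computable (\<lambda>k. prod_encode (\<Sum>i<M k. 2 ^ i, \<Sum>i<bd k. if D k i then 2 ^ i else 0))"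
    unfolding computable_iff_rec
    by (intro rec_intros M bd D rec_weaken rec_nth) simp_all
  ultimately show ?thesis by simp
qed

lemma pre_struct_ARITHM:
  "pre_struct b L c \<in> ARITHM (arith_voc \<union> Sym 3 ` {b..<b + L})"
proof -
  have "pre_struct b L c \<in> structures (arith_voc \<union> Sym 3 ` {b..<b + L})"
    unfolding structures_def pre_struct_def arith_voc_def arith_def
    by (auto simp: lessThan_empty_iff split: symb.splits if_splits)
  moreover have "struct_iso id (reduct arith_voc (pre_struct b L c)) (arith (2 ^ Suc c))"
    unfolding struct_iso_def
  proof (intro conjI allI impI)
    fix R xs
    show "xs \<in> rel (reduct arith_voc (pre_struct b L c)) R \<longleftrightarrow> map id xs \<in> rel (arith (2 ^ Suc c)) R"
      by (cases R) (auto simp: reduct_def pre_struct_def arith_voc_def arith_def)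
  qed (auto simp: reduct_def pre_struct_def arith_def)
  ultimately show ?thesis unfolding ARITHM_def isomorphic_def by blast
qed

section \<open>Correctness of the evaluation\<close>

lemma nth_code_list_encode: "nth_code i (list_encode ys) y \<longleftrightarrow> i < length ys \<and> ys ! i = y"
proof (induction i arbitrary: ys)
  case 0
  show ?case
  proof (cases ys)
    case (Cons z zs)
    have "list_encode zs < Suc (list_encode ys)" using prod_encode_ge(2)[of "list_encode zs" z] Cons by simp
    then show ?thesis using Cons by auto
  qed simp
next
  case (Suc i)
  show ?case
  proof (cases ys)
    case (Cons z zs)
    have "list_encode zs < Suc (list_encode ys)" "z < Suc (list_encode ys)"
      using prod_encode_ge(2)[of "list_encode zs" z] prod_encode_ge(1)[of z "list_encode zs"] Cons by simp_all
    then have "nth_code (Suc i) (list_encode ys) y \<longleftrightarrow> nth_code i (list_encode zs) y" using Cons by auto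
    then show ?thesis using Cons Suc by simp
  qed simp
qed

lemma prod_encode_leD: "prod_encode (a, b) \<le> c \<Longrightarrow> a \<le> c \<and> b \<le> c"
  using prod_encode_ge(1)[of a b] prod_encode_ge(2)[of b a] by linarith

lemma le_list_encode: "x \<in> set xs \<Longrightarrow> x \<le> list_encode xs"
proof (induction xs)
  case (Cons y ys)
  then show ?case using prod_encode_ge(1)[of y "list_encode ys"] prod_encode_ge(2)[of "list_encode ys" y] by auto
qed simp

lemma exists_consistent_set:
  obtains t where "t < 2 ^ Suc c" "consistent c t"
    "\<And>p i r. p \<le> c \<Longrightarrow> p = prod_encode (i, r) \<Longrightarrow> i \<noteq> 2 \<Longrightarrow> i \<noteq> 3 \<Longrightarrow> p \<in> set_decode t \<longleftrightarrow> V p"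
proof -
  define S where "S = wfrec less_than (\<lambda>S p. case prod_decode p of (i, r) \<Rightarrow>
    if i = 2 then \<not> S r else if i = 3 then S (fst (prod_decode r)) \<or> S (snd (prod_decode r)) else V p)"
  have less: "r < prod_encode (i, r)" if "i \<noteq> 0" for i r
    using that by (simp add: prod_encode_def triangle_def) (cases i; simp)
  have S: "S p \<longleftrightarrow> (case prod_decode p of (i, r) \<Rightarrow>
    if i = 2 then \<not> S r else if i = 3 then S (fst (prod_decode r)) \<or> S (snd (prod_decode r)) else V p)" for p
  proof -
    obtain i r where ir: "prod_decode p = (i, r)" by (cases "prod_decode p")
    then have p: "p = prod_encode (i, r)" by (metis prod_decode_inverse)
    have "fst (prod_decode r) < p" "snd (prod_decode r) < p" "r < p" if "i \<noteq> 0"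
      using prod_decode_bound[of r] less[OF that, of r] unfolding p by simp_all
    then show ?thesis
      by (subst S_def, subst wfrec[OF wf_less_than]) (auto simp: ir cut_def S_def)
  qed
  define t where "t = set_encode {p. p \<le> c \<and> S p}"
  have fin: "finite {p. p \<le> c \<and> S p}" by simp
  have dec: "set_decode t = {p. p \<le> c \<and> S p}" unfolding t_def by (rule set_encode_inverse[OF fin])
  have "t \<le> set_encode {..<Suc c}" unfolding t_def set_encode_def by (rule sum_mono2) auto
  also have "\<dots> < 2 ^ Suc c" unfolding set_encode_def by (induction c) auto
  finally have "t < 2 ^ Suc c" .
  moreover have "consistent c t"
    unfolding consistent_def dec using S by (auto simp: less_Suc_eq_le)
  moreover have "p \<in> set_decode t \<longleftrightarrow> V p"
    if "p \<le> c" "p = prod_encode (i, r)" "i \<noteq> 2" "i \<noteq> 3" for p i r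
    using that S[of p] unfolding dec by auto
  ultimately show ?thesis by (rule that)
qed

context
  fixes A P :: "nat struct" and B :: "(nat + nat) struct" and U :: symb and \<tau> :: "symb set" and b L c h M :: nat
  assumes P_eq: "P = pre_struct b L c" and U_eq: "U = Sym 1 b" and B_eq: "B = struct_sum U A P"
    and M_eq: "M = 2 ^ Suc c" and A: "A \<in> ARITHM \<tau>" and voc: "arith_voc \<subseteq> \<tau>" and fresh: "\<And>r i. Sym r i \<in> \<tau> \<Longrightarrow> i < b"
    and L: "8 \<le> L" "\<And>R. R \<in> \<tau> \<Longrightarrow> 8 + 2 * symb_encode R < L" "\<And>R. R \<in> \<tau> \<Longrightarrow> 7 + 2 * arity R < L"
begin

lemma P_ARITHM: "P \<in> ARITHM (arith_voc \<union> Sym 3 ` {b..<b + L})"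
  unfolding P_eq by (rule pre_struct_ARITHM)

lemma arity_U: "arity U = 1"
  by (simp add: U_eq)

lemma voc_Int: "\<tau> \<inter> (arith_voc \<union> Sym 3 ` {b..<b + L}) = arith_voc"
  using voc fresh by force

lemma le_c_less: "x \<le> c \<Longrightarrow> x < M"
  using less_exp[of "Suc c"] unfolding M_eq by linarith

lemma universe_P: "universe P = {..<M}"
  by (simp add: P_eq M_eq pre_struct_def)

lemma arith_pos_P: "l < M \<Longrightarrow> arith_pos P l = l"
proof -
  assume "l < M"
  then have "{x \<in> universe P. [x, l] \<in> rel P Less} = {..<l}"
    by (auto simp: P_eq M_eq pre_struct_def arith_def)
  then show ?thesis by (simp add: arith_pos_def)
qed

lemma U_iff: "[a] \<in> rel B U \<longleftrightarrow> (\<exists>l<M. a = Inr l)"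
  by (auto simp: B_eq struct_sum_simps universe_P)

lemma universe_B: "a \<in> universe B \<longleftrightarrow> (\<exists>a'\<in>universe A. a = Inl a') \<or> (\<exists>l<M. a = Inr l)"
  by (auto simp: B_eq struct_sum_simps sum_univ_def universe_P)

lemma ball_not_U: "(\<forall>a\<in>universe B. [a] \<notin> rel B U \<longrightarrow> Q a) \<longleftrightarrow> (\<forall>a\<in>universe A. Q (Inl a))"
  by (auto simp: U_iff universe_B)

lemma aux_iff:
  assumes "j < L"
  shows "[X, Y, Z] \<in> rel B (aux b j) \<longleftrightarrow>
    (\<exists>x y z. X = Inr x \<and> Y = Inr y \<and> Z = Inr z \<and> x < M \<and> y < M \<and> z < M \<and> aux_pred j c x y z)"
proof -
  have "aux b j \<notin> \<tau>" using fresh unfolding aux_def by force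
  then have "rel A (aux b j) = {}" using ARITHM_rel[OF A] by blast
  moreover have "rel P (aux b j) = {[x, y, z] | x y z. x < M \<and> y < M \<and> z < M \<and> aux_pred j c x y z}"
    using assms by (simp add: P_eq M_eq pre_struct_def aux_def)
  moreover have "rel B (aux b j) = map Inl ` rel A (aux b j) \<union> map Inr ` rel P (aux b j)"
    unfolding aux_def B_eq by (rule struct_sum_simps) (simp add: U_eq)
  ultimately show ?thesis by (auto simp: image_iff Cons_eq_map_conv)
qed

lemma rel_Inl_iff:
  assumes "R \<in> \<tau>" "set as \<subseteq> universe A" "length as = arity R"
  shows "map Inl as \<in> rel B R \<longleftrightarrow> as \<in> rel A R"
proof -
  note ar = struct_sum_arith_rel[OF A P_ARITHM voc_Int arity_U, folded B_eq, of "Inl x" "Inl y" for x y]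
  have u: "Inl x \<in> sum_univ A P \<longleftrightarrow> x \<in> universe A" for x by (auto simp: sum_univ_def)
  show ?thesis
  proof (cases R)
    case Less
    then obtain x y where "as = [x, y]" using assms(3) by (auto simp: numeral_2_eq_2 length_Suc_conv)
    then show ?thesis using Less assms(2) ar(1) arith_rel_iff(1)[OF A] by (simp add: u sum_pos_Inl)
  next
    case Add
    then obtain x y z where "as = [x, y, z]" using assms(3) by (auto simp: numeral_3_eq_3 length_Suc_conv)
    then show ?thesis using Add assms(2) ar(2) arith_rel_iff(2)[OF A] by (simp add: u sum_pos_Inl)
  next
    case Mult
    then obtain x y z where "as = [x, y, z]" using assms(3) by (auto simp: numeral_3_eq_3 length_Suc_conv)
    then show ?thesis using Mult assms(2) ar(3) arith_rel_iff(3)[OF A] by (simp add: u sum_pos_Inl)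
  next
    case (Sym r i)
    have "R \<notin> arith_voc \<union> Sym 3 ` {b..<b + L}" using fresh assms(1) unfolding Sym arith_voc_def by force
    then have "rel P R = {}" using ARITHM_rel[OF P_ARITHM] by blast
    moreover have "Sym r i \<noteq> U" using fresh[of r i] assms(1) Sym by (auto simp: U_eq)
    ultimately have "rel B R = map Inl ` rel A R" using Sym by (simp add: B_eq struct_sum_simps)
    then show ?thesis by (simp add: inj_image_mem_iff)
  qed
qed

lemma const_val_iff:
  assumes l: "l < M" "l < h" and a: "a \<in> universe B"
  shows "const_val U B (Inr l) (Inr 0) a \<longleftrightarrow> a = Inl (the (con (expand_consts h A) l))"
proof (cases a)
  case (Inr k)
  then show ?thesis using a by (auto simp: const_val_def U_iff universe_B)
next
  case (Inl x)
  let ?n = "card (universe A)"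
  have x: "x \<in> universe A" using a Inl by (auto simp: universe_B)
  have n: "0 < ?n" using ARITHM_universe[OF A] by (simp add: card_gt_0_iff)
  note ar = struct_sum_arith_rel[OF A P_ARITHM voc_Int arity_U, folded B_eq]
  have u: "Inl y \<in> sum_univ A P \<longleftrightarrow> y \<in> universe A" "Inr l \<in> sum_univ A P" "Inr 0 \<in> sum_univ A P" for y :: nat
    using l by (auto simp: sum_univ_def universe_P)
  have pos: "sum_pos A P (Inr l) = ?n + l" "sum_pos A P (Inr 0) = ?n"
    using l sum_pos_Inr[OF ARITHM_universe(1)[OF A] ARITHM_universe(1)[OF P_ARITHM]] arith_pos_P[of l] arith_pos_P[of 0]
    by (simp_all add: universe_P)
  have add: "[Inl y, Inr 0, Inr l] \<in> rel B Add \<longleftrightarrow> arith_pos A y = l" if "y \<in> universe A" for y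
    using that ar(2)[OF _ u(3,2)] by (simp add: u pos sum_pos_Inl) auto
  have less: "[Inl x, Inl y] \<in> rel B Less \<longleftrightarrow> arith_pos A x < arith_pos A y" if "y \<in> universe A" for y
    using that x ar(1) by (simp add: u sum_pos_Inl)
  have "const_val U B (Inr l) (Inr 0) a \<longleftrightarrow> arith_pos A x = l \<or>
      (\<forall>y\<in>universe A. arith_pos A y \<noteq> l \<and> \<not> arith_pos A x < arith_pos A y)"
    unfolding const_val_def Inl ball_not_U using add[OF x] add less by (simp add: U_iff)
  also have "\<dots> \<longleftrightarrow> x = the (con (expand_consts h A) l)"
  proof (cases "l < ?n")
    case True
    note el = arith_elem_in[OF A True]
    have "x = the (con (expand_consts h A) l) \<longleftrightarrow> arith_pos A x = l"
      using True l arith_elem_pos[OF A x] el by (auto simp: expand_consts_simps)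
    then show ?thesis using el by auto
  next
    case False
    then have el: "arith_elem A (?n - 1) \<in> universe A" "arith_pos A (arith_elem A (?n - 1)) = ?n - 1"
      using arith_elem_in[OF A, of "?n - 1"] n by auto
    have "x = the (con (expand_consts h A) l) \<longleftrightarrow> arith_pos A x = ?n - 1"
      using False l arith_elem_pos[OF A x] el by (auto simp: expand_consts_simps)
    also have "\<dots> \<longleftrightarrow> (\<forall>y\<in>universe A. \<not> arith_pos A x < arith_pos A y)"
    proof
      assume "\<forall>y\<in>universe A. \<not> arith_pos A x < arith_pos A y"
      then have "\<not> arith_pos A x < ?n - 1" using el by metis
      then show "arith_pos A x = ?n - 1" using arith_pos_less[OF A x] by simp
    next
      assume "arith_pos A x = ?n - 1"
      then show "\<forall>y\<in>universe A. \<not> arith_pos A x < arith_pos A y" using arith_pos_less[OF A] by fastforce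
    qed
    finally show ?thesis using False arith_pos_less[OF A] by (metis x)
  qed
  finally show ?thesis using Inl by simp
qed

lemma term_val_iff:
  assumes t: "tm_encode t \<le> c" "tm_consts t \<subseteq> {..<h}" and a: "a \<in> universe B"
    and bs: "\<And>x. x \<in> tm_vars t \<Longrightarrow> lookup bs (Inr x) a \<longleftrightarrow> a = Inl (s x)"
  shows "term_val b U B bs (Inr (tm_encode t)) a \<longleftrightarrow> a = Inl (tm_val (expand_consts h A) s t)"
proof -
  have j: "4 < L" "5 < L" using L(1) by auto
  show ?thesis
  proof (cases t)
    case (Var x)
    have x: "x < M" "2 * x < M" using t(1) le_c_less Var by auto
    have "term_val b U B bs (Inr (tm_encode t)) a \<longleftrightarrow> lookup bs (Inr x) a"
    proof -
      have "[Inr (2 * x), l, z] \<notin> rel B (aux b 4)" for l z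
        unfolding aux_iff[OF j(1)] by (auto simp: aux_pred_def) presburger
      moreover have "[Inr (2 * x), y, y] \<in> rel B (aux b 5) \<longleftrightarrow> y = Inr x" for y
        unfolding aux_iff[OF j(2)] using x by (auto simp: aux_pred_def)
      ultimately show ?thesis using Var x by (auto simp: term_val_def universe_B)
    qed
    then show ?thesis using bs Var by simp
  next
    case (Const l)
    have l: "l < M" "Suc (2 * l) < M" "l < h" using t le_c_less Const by auto
    have "term_val b U B bs (Inr (tm_encode t)) a \<longleftrightarrow> const_val U B (Inr l) (Inr 0) a"
    proof -
      have "[Inr (2 * l + 1), y, y] \<notin> rel B (aux b 5)" for y
        unfolding aux_iff[OF j(2)] by (auto simp: aux_pred_def) presburger
      moreover have "[Inr (2 * l + 1), y, z] \<in> rel B (aux b 4) \<longleftrightarrow> y = Inr l \<and> z = Inr 0" for y z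
        unfolding aux_iff[OF j(1)] using l by (auto simp: aux_pred_def)
      ultimately show ?thesis using Const l by (auto simp: term_val_def universe_B)
    qed
    then show ?thesis using const_val_iff[OF l(1,3) a] Const by simp
  qed
qed

lemma exists_truth_set: "\<exists>t<M. truth_set b U \<tau> B bs X (Inr t)"
proof -
  define EqV where "EqV p \<longleftrightarrow> (\<exists>y<M. \<exists>z<M. p = prod_encode (0, prod_encode (y, z)) \<and>
    (\<exists>a\<in>universe B. term_val b U B bs (Inr y) a \<and> term_val b U B bs (Inr z) a))" for p
  define RelV where "RelV R p \<longleftrightarrow> (\<exists>as. length as = arity R \<and> set as \<subseteq> universe B \<and> as \<in> rel B R \<and>
    (\<forall>j\<in>{..<arity R}. \<exists>y\<in>universe B. [Inr p, y, y] \<in> rel B (aux b (7 + 2 * j)) \<and>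
      term_val b U B bs y (as ! j)))" for R p
  define ExV where "ExV p \<longleftrightarrow> (\<exists>x q. p = prod_encode (4, prod_encode (x, q)) \<and> X (Inr x) (Inr q))" for p
  define V where "V p \<longleftrightarrow> EqV p \<or> ExV p \<or>
    (\<exists>R w. p = prod_encode (1, prod_encode (symb_encode R, w)) \<and> RelV R p)" for p
  obtain t where t: "t < M" "consistent c t"
    "\<And>p i r. p \<le> c \<Longrightarrow> p = prod_encode (i, r) \<Longrightarrow> i \<noteq> 2 \<Longrightarrow> i \<noteq> 3 \<Longrightarrow> p \<in> set_decode t \<longleftrightarrow> V p"
    using exists_consistent_set[of c V] unfolding M_eq by blast
  have j: "0 < L" "1 < L" "2 < L" "3 < L" using L(1) by auto
  have "truth_set b U \<tau> B bs X (Inr t)"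
    unfolding truth_set_def
  proof (intro conjI ballI impI)
    show "[Inr t, Inr t, Inr t] \<in> rel B (aux b 1)"
      unfolding aux_iff[OF j(2)] using t by (simp add: aux_pred_def)
  next
    fix P Y Z assume "[P, Y, Z] \<in> rel B (aux b 2)"
    then obtain p y z where p: "P = Inr p" "Y = Inr y" "Z = Inr z" "p < M" "y < M" "z < M" "p \<le> c"
      "p = prod_encode (0, prod_encode (y, z))" unfolding aux_iff[OF j(3)] by (auto simp: aux_pred_def)
    have "[P, Inr t, Inr t] \<in> rel B (aux b 0) \<longleftrightarrow> p \<in> set_decode t"
      unfolding aux_iff[OF j(1)] using p t(1) by (auto simp: aux_pred_def)
    also have "\<dots> \<longleftrightarrow> V p" by (rule t(3)[OF p(7,8)]) auto
    also have "\<dots> \<longleftrightarrow> (\<exists>a\<in>universe B. term_val b U B bs Y a \<and> term_val b U B bs Z a)"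
      unfolding V_def EqV_def ExV_def using p by auto
    finally show "[P, Inr t, Inr t] \<in> rel B (aux b 0) \<longleftrightarrow>
        (\<exists>a\<in>universe B. term_val b U B bs Y a \<and> term_val b U B bs Z a)" .
  next
    fix R P assume R: "R \<in> \<tau>" and "[P, P, P] \<in> rel B (aux b (8 + 2 * symb_encode R))"
    then obtain p where p: "P = Inr p" "p < M" "p \<le> c"
      and pred: "aux_pred (8 + 2 * symb_encode R) c p p p" unfolding aux_iff[OF L(2)[OF R]]
      by (auto simp: aux_pred_def)
    obtain w where w: "p = prod_encode (1, prod_encode (symb_encode R, w))"
      using pred by (auto simp: aux_pred_def)
    have "[P, Inr t, Inr t] \<in> rel B (aux b 0) \<longleftrightarrow> p \<in> set_decode t"
      unfolding aux_iff[OF j(1)] using p t(1) by (auto simp: aux_pred_def)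
    also have "\<dots> \<longleftrightarrow> V p" by (rule t(3)[OF p(3) w]) auto
    also have "\<dots> \<longleftrightarrow> RelV R p" unfolding V_def EqV_def ExV_def using w by (auto simp: inj_symb_encode)
    finally show "[P, Inr t, Inr t] \<in> rel B (aux b 0) \<longleftrightarrow>
      (\<exists>as. length as = arity R \<and> set as \<subseteq> universe B \<and> as \<in> rel B R \<and>
        (\<forall>j\<in>{..<arity R}. \<exists>y\<in>universe B. [P, y, y] \<in> rel B (aux b (7 + 2 * j)) \<and> term_val b U B bs y (as ! j)))"
      unfolding RelV_def p(1) .
  next
    fix P Y Z assume "[P, Y, Z] \<in> rel B (aux b 3)"
    then obtain p y z where p: "P = Inr p" "Y = Inr y" "Z = Inr z" "p < M" "y < M" "z < M" "p \<le> c"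
      "p = prod_encode (4, prod_encode (y, z))" unfolding aux_iff[OF j(4)] by (auto simp: aux_pred_def)
    have "[P, Inr t, Inr t] \<in> rel B (aux b 0) \<longleftrightarrow> p \<in> set_decode t"
      unfolding aux_iff[OF j(1)] using p t(1) by (auto simp: aux_pred_def)
    also have "\<dots> \<longleftrightarrow> V p" by (rule t(3)[OF p(7,8)]) auto
    also have "\<dots> \<longleftrightarrow> X Y Z" unfolding V_def EqV_def ExV_def using p by auto
    finally show "[P, Inr t, Inr t] \<in> rel B (aux b 0) \<longleftrightarrow> X Y Z" .
  qed
  then show ?thesis using t(1) by blast
qed

lemma truth_set_iff:
  assumes t: "truth_set b U \<tau> B bs X (Inr t)" "t < M"
    and X: "\<And>x \<chi>. fm_encode (Ex x \<chi>) \<le> c \<Longrightarrow> quantifier_rank (Ex x \<chi>) \<le> q \<Longrightarrow> fm_over \<tau> h (Ex x \<chi>) \<Longrightarrow>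
      (\<And>y a. y \<in> free_vars (Ex x \<chi>) \<Longrightarrow> a \<in> universe B \<Longrightarrow> lookup bs (Inr y) a \<longleftrightarrow> a = Inl (s y)) \<Longrightarrow>
      X (Inr x) (Inr (fm_encode \<chi>)) \<longleftrightarrow> sat (expand_consts h A) s (Ex x \<chi>)"
    and s: "range s \<subseteq> universe A"
    and "fm_encode \<psi> \<le> c" "quantifier_rank \<psi> \<le> q" "fm_over \<tau> h \<psi>"
    and "\<And>y a. y \<in> free_vars \<psi> \<Longrightarrow> a \<in> universe B \<Longrightarrow> lookup bs (Inr y) a \<longleftrightarrow> a = Inl (s y)"
  shows "fm_encode \<psi> \<in> set_decode t \<longleftrightarrow> sat (expand_consts h A) s \<psi>"
  using assms(5-8)
proof (induction \<psi>)
  have j: "0 < L" "1 < L" "2 < L" "3 < L" using L(1) by auto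
  note T = t(1)[unfolded truth_set_def]
  have E: "[Inr p, Inr t, Inr t] \<in> rel B (aux b 0) \<longleftrightarrow> p \<in> set_decode t" if "p \<le> c" for p
    unfolding aux_iff[OF j(1)] using that t(2) le_c_less by (auto simp: aux_pred_def)
  have univ: "Inr p \<in> universe B" if "p \<le> c" for p using le_c_less[OF that] by (auto simp: universe_B)
  have tmv: "tm_val (expand_consts h A) s v \<in> universe A" if "tm_consts v \<subseteq> {..<h}" for v
  proof (cases v)
    case (Const l)
    have n: "0 < card (universe A)" using ARITHM_universe[OF A] by (simp add: card_gt_0_iff)
    then show ?thesis using that Const arith_elem_in(1)[OF A] by (simp add: expand_consts_def)
  qed (use s in auto)
  have cons: "consistent c t" using T unfolding aux_iff[OF j(2)] by (auto simp: aux_pred_def)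
  {
    case (Eq u v)
    let ?p = "fm_encode (Eq u v)"
    have uv: "tm_encode u \<le> c" "tm_encode v \<le> c"
      using Eq(1) by (auto dest!: prod_encode_leD)
    have over: "tm_consts u \<subseteq> {..<h}" "tm_consts v \<subseteq> {..<h}" using Eq(3) by auto
    have "[Inr ?p, Inr (tm_encode u), Inr (tm_encode v)] \<in> rel B (aux b 2)"
      unfolding aux_iff[OF j(3)] using Eq(1) uv le_c_less by (auto simp: aux_pred_def)
    then have "?p \<in> set_decode t \<longleftrightarrow> (\<exists>a\<in>universe B. term_val b U B bs (Inr (tm_encode u)) a \<and>
        term_val b U B bs (Inr (tm_encode v)) a)"
      using T[THEN conjunct2, THEN conjunct1, rule_format, OF univ[OF Eq(1)] univ[OF uv(1)] univ[OF uv(2)]]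
      unfolding E[OF Eq(1)] by blast
    also have "\<dots> \<longleftrightarrow> (\<exists>a\<in>universe B. a = Inl (tm_val (expand_consts h A) s u) \<and> a = Inl (tm_val (expand_consts h A) s v))"
      using Eq(4) by (intro bex_cong refl arg_cong2[where f = "(\<and>)"] term_val_iff uv over) auto
    also have "\<dots> \<longleftrightarrow> sat (expand_consts h A) s (Eq u v)"
      using tmv[OF over(1)] by (auto simp: universe_B)
    finally show ?case .
  next
    case (Rel R ts)
    let ?p = "fm_encode (Rel R ts)" and ?v = "tm_val (expand_consts h A) s"
    have R: "R \<in> \<tau>" and len: "length ts = arity R" using Rel(3) by auto
    let ?l = "list_encode (map tm_encode ts)"
    have p: "?p = prod_encode (1, prod_encode (symb_encode R, ?l))" by simp
    have le: "symb_encode R \<le> ?p" "?l \<le> ?p"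
      using prod_encode_leD[OF order.refl[of ?p, unfolded p]] unfolding p by (auto dest!: prod_encode_leD)
    have ts: "tm_encode v \<le> c" "tm_consts v \<subseteq> {..<h}" "tm_vars v \<subseteq> free_vars (Rel R ts)" if "v \<in> set ts" for v
      using that le_list_encode[of "tm_encode v" "map tm_encode ts"] le(2) Rel(1,3) by (auto simp del: fm_encode.simps)
    have 1: "[Inr ?p, Inr ?p, Inr ?p] \<in> rel B (aux b (8 + 2 * symb_encode R))"
      unfolding aux_iff[OF L(2)[OF R]] using Rel(1) le_c_less[OF Rel(1)] le(2)
      by (auto simp: aux_pred_def less_Suc_eq_le simp del: fm_encode.simps) (auto simp: less_Suc_eq_le)
    have 2: "[Inr ?p, y, y] \<in> rel B (aux b (7 + 2 * j)) \<longleftrightarrow> y = Inr (tm_encode (ts ! j))" if "j \<in> {..<arity R}" for j y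
    proof -
      have jL: "7 + 2 * j < L" using L(3)[OF R] that by simp
      have pred: "aux_pred (7 + 2 * j) c ?p y' z \<longleftrightarrow> y' = tm_encode (ts ! j)" for y' z
      proof -
        have "aux_pred (7 + 2 * j) c ?p y' z \<longleftrightarrow>
            (\<exists>e<Suc ?p. \<exists>w<Suc ?p. ?p = prod_encode (1, prod_encode (e, w)) \<and> nth_code j w y')"
          by (simp add: aux_pred_def del: fm_encode.simps)
        also have "\<dots> \<longleftrightarrow> nth_code j ?l y'" using le by (auto simp: p less_Suc_eq_le simp del: fm_encode.simps)
        finally show ?thesis using that len by (auto simp: nth_code_list_encode)
      qed
      have "tm_encode (ts ! j) < M" using ts(1) that len le_c_less by simp
      then show ?thesis unfolding aux_iff[OF jL] using pred le_c_less[OF Rel(1)]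
        by (auto simp del: fm_encode.simps)
    qed
    have 3: "Inr (tm_encode (ts ! j)) \<in> universe B" if "j \<in> {..<arity R}" for j
      using ts(1)[of "ts ! j"] that len univ by simp
    have 4: "term_val b U B bs (Inr (tm_encode (ts ! j))) a \<longleftrightarrow> a = Inl (?v (ts ! j))"
      if "j \<in> {..<arity R}" "a \<in> universe B" for j a
    proof -
      have "ts ! j \<in> set ts" using that len by simp
      note ts = ts[OF this]
      show ?thesis by (rule term_val_iff[OF ts(1,2) that(2)]) (use Rel(4) ts(3) that(2) in blast)
    qed
    have "?p \<in> set_decode t \<longleftrightarrow> (\<exists>as. length as = arity R \<and> set as \<subseteq> universe B \<and> as \<in> rel B R \<and>
        (\<forall>j\<in>{..<arity R}. \<exists>y\<in>universe B. [Inr ?p, y, y] \<in> rel B (aux b (7 + 2 * j)) \<and> term_val b U B bs y (as ! j)))"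
      using T[THEN conjunct2, THEN conjunct2, THEN conjunct1, rule_format, OF R univ[OF Rel(1)] 1]
      unfolding E[OF Rel(1)] .
    also have "\<dots> \<longleftrightarrow> (\<exists>as. length as = arity R \<and> set as \<subseteq> universe B \<and> as \<in> rel B R \<and>
        (\<forall>j\<in>{..<arity R}. as ! j = Inl (?v (ts ! j))))"
    proof (intro ex_cong1 conj_cong refl ball_cong)
      fix as :: "(nat + nat) list" and j
      assume "length as = arity R" "set as \<subseteq> universe B" and j: "j \<in> {..<arity R}"
      then have "as ! j \<in> universe B" by (auto simp: subset_iff)
      then show "(\<exists>y\<in>universe B. [Inr ?p, y, y] \<in> rel B (aux b (7 + 2 * j)) \<and> term_val b U B bs y (as ! j)) \<longleftrightarrow>
          as ! j = Inl (?v (ts ! j))" unfolding 2[OF j] using 3[OF j] 4[OF j] by auto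
    qed
    also have "\<dots> \<longleftrightarrow> (\<exists>as. set as \<subseteq> universe B \<and> as \<in> rel B R \<and> as = map Inl (map ?v ts))"
      using len by (auto simp: list_eq_iff_nth_eq)
    also have "\<dots> \<longleftrightarrow> map Inl (map ?v ts) \<in> rel B R"
      using tmv ts(2) by (auto simp: universe_B)
    also have "\<dots> \<longleftrightarrow> map ?v ts \<in> rel A R"
      by (rule rel_Inl_iff[OF R]) (use tmv ts(2) len in auto)
    finally show ?case by (simp add: expand_consts_simps)
  next
    case (Neg \<phi>)
    let ?p = "fm_encode (Neg \<phi>)"
    have le: "fm_encode \<phi> \<le> c" using Neg.prems(1) by (auto dest!: prod_encode_leD)
    have "?p < Suc c" "fm_encode \<phi> < Suc c" "?p = prod_encode (2, fm_encode \<phi>)" using Neg.prems(1) le by auto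
    then have "?p \<in> set_decode t \<longleftrightarrow> fm_encode \<phi> \<notin> set_decode t" using cons unfolding consistent_def by blast
    moreover have "fm_encode \<phi> \<in> set_decode t \<longleftrightarrow> sat (expand_consts h A) s \<phi>"
      by (rule Neg.IH[OF le]) (use Neg.prems in auto)
    ultimately show ?case by simp
  next
    case (Or \<phi> \<phi>')
    let ?p = "fm_encode (Or \<phi> \<phi>')"
    have le: "fm_encode \<phi> \<le> c" "fm_encode \<phi>' \<le> c"
      using Or.prems(1) by (auto dest!: prod_encode_leD)
    have "?p < Suc c" "fm_encode \<phi> < Suc c" "fm_encode \<phi>' < Suc c"
      "?p = prod_encode (3, prod_encode (fm_encode \<phi>, fm_encode \<phi>'))" using Or.prems(1) le by auto
    then have "?p \<in> set_decode t \<longleftrightarrow> fm_encode \<phi> \<in> set_decode t \<or> fm_encode \<phi>' \<in> set_decode t"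
      using cons unfolding consistent_def by blast
    moreover have "fm_encode \<phi> \<in> set_decode t \<longleftrightarrow> sat (expand_consts h A) s \<phi>"
      by (rule Or.IH(1)[OF le(1)]) (use Or.prems in auto)
    moreover have "fm_encode \<phi>' \<in> set_decode t \<longleftrightarrow> sat (expand_consts h A) s \<phi>'"
      by (rule Or.IH(2)[OF le(2)]) (use Or.prems in auto)
    ultimately show ?case by simp
  next
    case (Ex x \<phi>)
    let ?p = "fm_encode (Ex x \<phi>)"
    have le: "x \<le> c" "fm_encode \<phi> \<le> c"
      using Ex.prems(1) by (auto dest!: prod_encode_leD)
    have "[Inr ?p, Inr x, Inr (fm_encode \<phi>)] \<in> rel B (aux b 3)"
      unfolding aux_iff[OF j(4)] using Ex.prems(1) le le_c_less by (auto simp: aux_pred_def)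
    then have "?p \<in> set_decode t \<longleftrightarrow> X (Inr x) (Inr (fm_encode \<phi>))"
      using T[THEN conjunct2, THEN conjunct2, THEN conjunct2, rule_format, OF univ[OF Ex.prems(1)] univ[OF le(1)] univ[OF le(2)]]
      unfolding E[OF Ex.prems(1)] by blast
    also have "\<dots> \<longleftrightarrow> sat (expand_consts h A) s (Ex x \<phi>)"
      by (rule X) (use Ex.prems in blast)+
    finally show ?case .
  }
qed

lemma eval_code_iff:
  assumes "range s \<subseteq> universe A" "fm_encode \<psi> \<le> c" "quantifier_rank \<psi> \<le> q" "fm_over \<tau> h \<psi>"
    and "\<And>y a. y \<in> free_vars \<psi> \<Longrightarrow> a \<in> universe B \<Longrightarrow> lookup bs (Inr y) a \<longleftrightarrow> a = Inl (s y)"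
  shows "eval_code b U \<tau> B q bs (Inr (fm_encode \<psi>)) \<longleftrightarrow> sat (expand_consts h A) s \<psi>"
  using assms
proof (induction q arbitrary: s \<psi> bs)
  have j: "0 < L" "1 < L" using L(1) by auto
  have step: "(\<exists>t\<in>universe B. truth_set b U \<tau> B bs X t \<and> [Inr (fm_encode \<psi>), t, t] \<in> rel B (aux b 0)) \<longleftrightarrow>
      sat (expand_consts h A) s \<psi>"
    if "\<And>t. t < M \<Longrightarrow> truth_set b U \<tau> B bs X (Inr t) \<Longrightarrow>
        fm_encode \<psi> \<in> set_decode t \<longleftrightarrow> sat (expand_consts h A) s \<psi>" "fm_encode \<psi> \<le> c" for bs X s \<psi>
  proof -
    have "(\<exists>t\<in>universe B. truth_set b U \<tau> B bs X t \<and> [Inr (fm_encode \<psi>), t, t] \<in> rel B (aux b 0)) \<longleftrightarrow>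
        (\<exists>t<M. truth_set b U \<tau> B bs X (Inr t) \<and> fm_encode \<psi> \<in> set_decode t)"
      unfolding aux_iff[OF j(1)] using le_c_less[OF that(2)] by (auto simp: aux_pred_def universe_B)
    then show ?thesis using that(1) exists_truth_set[of bs X] by blast
  qed
  {
    case 0
    show ?case unfolding eval_code.simps
      by (rule step, rule truth_set_iff[where q = 0 and X = "\<lambda>x c. False"]) (use 0 in auto)
  next
    case (Suc q)
    let ?X = "\<lambda>x c. \<exists>a\<in>universe B. [a] \<notin> rel B U \<and> eval_code b U \<tau> B q ((x, a) # bs) c"
    have X: "?X (Inr x) (Inr (fm_encode \<chi>)) \<longleftrightarrow> sat (expand_consts h A) s (Ex x \<chi>)"
      if x: "fm_encode (Ex x \<chi>) \<le> c" "quantifier_rank (Ex x \<chi>) \<le> Suc q" "fm_over \<tau> h (Ex x \<chi>)"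
        "\<And>y a. y \<in> free_vars (Ex x \<chi>) \<Longrightarrow> a \<in> universe B \<Longrightarrow> lookup bs (Inr y) a \<longleftrightarrow> a = Inl (s y)" for x \<chi>
    proof -
      have le: "fm_encode \<chi> \<le> c"
        using x(1) by (auto dest!: prod_encode_leD)
      have "eval_code b U \<tau> B q ((Inr x, Inl a) # bs) (Inr (fm_encode \<chi>)) \<longleftrightarrow>
          sat (expand_consts h A) (s(x := a)) \<chi>" if a: "a \<in> universe A" for a
      proof (rule Suc.IH[OF _ le])
        show "range (s(x := a)) \<subseteq> universe A" using Suc.prems(1) a by auto
        fix y d assume "y \<in> free_vars \<chi>" "d \<in> universe B"
        then show "lookup ((Inr x, Inl a) # bs) (Inr y) d \<longleftrightarrow> d = Inl ((s(x := a)) y)"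
          using x(4)[of y d] by auto
      qed (use x in auto)
      moreover have "?X (Inr x) p \<longleftrightarrow> (\<exists>a\<in>universe A. eval_code b U \<tau> B q ((Inr x, Inl a) # bs) p)" for p
        by (auto simp: U_iff universe_B)
      ultimately show ?thesis by (simp add: expand_consts_simps)
    qed
    show ?case unfolding eval_code.simps
    proof (rule step[OF _ Suc.prems(2)])
      fix t assume "t < M" "truth_set b U \<tau> B bs ?X (Inr t)"
      then show "fm_encode \<psi> \<in> set_decode t \<longleftrightarrow> sat (expand_consts h A) s \<psi>"
        by (intro truth_set_iff[where X = ?X and q = "Suc q", OF _ _ X Suc.prems])
    qed
  }
qed

end

lemma XFO_qr_subset_para_FO: "XFO_qr \<subseteq> para_FO"
proof (rule subrelI)
  fix \<tau> Q assume "(\<tau>, Q) \<in> XFO_qr"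
  then obtain q h f where Q: "param_problem \<tau> Q" and comp: "computable (\<lambda>k. fm_encode (f k))"
    and f: "\<And>k. f k \<in> FO_rank q \<tau> (h k)"
    and iff: "\<And>A k. A \<in> ARITHM \<tau> \<Longrightarrow> (A, k) \<in> Q \<longleftrightarrow> models (expand_consts (h k) A) (f k)"
    unfolding XFO_qr_def slicewise_definable_def mem_Collect_eq prod.case by blast
  have fin: "finite \<tau>" and voc: "arith_voc \<subseteq> \<tau>" using Q by (auto simp: param_problem_def vocabulary_def)
  define b where "b = Suc (\<Sum>R\<in>\<tau>. case R of Sym r i \<Rightarrow> i | _ \<Rightarrow> 0)"
  define L where "L = 9 + (\<Sum>R\<in>\<tau>. 2 * symb_encode R + 2 * arity R)"
  have fresh: "i < b" if "Sym r i \<in> \<tau>" for r i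
    using member_le_sum[of "Sym r i" \<tau> "\<lambda>R. case R of Sym r i \<Rightarrow> i | _ \<Rightarrow> 0"] that fin by (simp add: b_def)
  have "2 * symb_encode R + 2 * arity R \<le> (\<Sum>R\<in>\<tau>. 2 * symb_encode R + 2 * arity R)" if "R \<in> \<tau>" for R
    using member_le_sum[of R \<tau> "\<lambda>R. 2 * symb_encode R + 2 * arity R"] that fin by simp
  then have L: "8 \<le> L" "\<And>R. R \<in> \<tau> \<Longrightarrow> 8 + 2 * symb_encode R < L" "\<And>R. R \<in> \<tau> \<Longrightarrow> 7 + 2 * arity R < L"
    unfolding L_def by fastforce+
  define \<tau>' where "\<tau>' = arith_voc \<union> Sym 3 ` {b..<b + L}"
  define U where "U = Sym 1 b"
  define pre where "pre k = pre_struct b L (fm_encode (f k))" for k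
  let ?\<sigma> = "\<tau> \<union> \<tau>' \<union> {U}"
  have "definable ?\<sigma> 0 (\<lambda>B :: (nat + nat) struct. \<lambda>xs. \<exists>p\<in>universe B. [p, p, p] \<in> rel B (aux b 6) \<and>
      eval_code b U \<tau> B q [] p)"
  proof (intro definable_ex definable_conj)
    have aux: "aux b j \<in> ?\<sigma>" if "j < L" for j using that by (auto simp: aux_def \<tau>'_def)
    have U: "U \<in> ?\<sigma>" "arity U = 1" by (auto simp: U_def)
    have sub: "\<tau> \<subseteq> ?\<sigma>" "arith_voc \<subseteq> ?\<sigma>" by (auto simp: \<tau>'_def)
    show "definable ?\<sigma> (Suc 0) (\<lambda>B ys. [last ys, last ys, last ys] \<in> rel B (aux b 6))"
      using L(1) by (intro definable_aux[OF aux U sub fin L] isvar_last) auto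
    show "definable ?\<sigma> (Suc 0) (\<lambda>B ys. eval_code b U \<tau> B q [] (last ys))"
      by (rule definable_eval_code[OF aux U sub fin L isenv.Nil isvar_last])
  qed
  then obtain \<phi> where \<phi>: "fm_over ?\<sigma> 0 \<phi>" "free_vars \<phi> = {}"
    "\<And>(B :: (nat + nat) struct) s. sat B s \<phi> \<longleftrightarrow> (\<exists>p\<in>universe B. [p, p, p] \<in> rel B (aux b 6) \<and> eval_code b U \<tau> B q [] p)"
    unfolding definable_def by auto
  have "(A, k) \<in> Q \<longleftrightarrow> models (struct_sum U A (pre k)) \<phi>" if A: "A \<in> ARITHM \<tau>" for A k
  proof -
    let ?B = "struct_sum U A (pre k)" and ?c = "fm_encode (f k)"
    obtain a where a: "a \<in> universe A" using ARITHM_universe(2)[OF A] by blast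
    have fk: "fm_over \<tau> (h k) (f k)" "free_vars (f k) = {}" "quantifier_rank (f k) \<le> q"
      using f[of k] by (auto simp: FO_rank_def sentences_def)
    note ctx = pre_def[of k] U_def refl[of ?B] refl[of "2 ^ Suc ?c :: nat"] A voc fresh L
    have "models ?B \<phi> \<longleftrightarrow> sat ?B (\<lambda>x. Inl a) \<phi>"
      by (rule models_iff_sat[OF \<phi>(2)]) (use a in \<open>auto simp: struct_sum_simps sum_univ_def\<close>)
    also have "\<dots> \<longleftrightarrow> eval_code b U \<tau> ?B q [] (Inr ?c)"
    proof -
      have c: "?c < 2 ^ Suc ?c" using less_exp[of "Suc ?c"] by linarith
      have root: "[p, p, p] \<in> rel ?B (aux b 6) \<longleftrightarrow> p = Inr ?c" for p
      proof -
        have "[p, p, p] \<in> rel ?B (aux b 6) \<longleftrightarrow> (\<exists>x y z. p = Inr x \<and> p = Inr y \<and> p = Inr z \<and>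
            x < 2 ^ Suc ?c \<and> y < 2 ^ Suc ?c \<and> z < 2 ^ Suc ?c \<and> aux_pred 6 ?c x y z)"
          by (rule aux_iff[OF ctx]) (use L(1) in auto)
        then show ?thesis using c by (auto simp: aux_pred_def simp del: power_Suc)
      qed
      have "Inr ?c \<in> universe ?B" using c by (auto simp: struct_sum_simps sum_univ_def pre_def pre_struct_def simp del: power_Suc)
      then show ?thesis unfolding \<phi>(3) root by blast
    qed
    also have "\<dots> \<longleftrightarrow> sat (expand_consts (h k) A) (\<lambda>x. a) (f k)"
      by (rule eval_code_iff[OF ctx]) (use a fk in auto)
    also have "\<dots> \<longleftrightarrow> models (expand_consts (h k) A) (f k)"
      by (rule models_iff_sat[OF fk(2), symmetric]) (use a in \<open>auto simp: expand_consts_simps\<close>)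
    finally show ?thesis using iff[OF A] by simp
  qed
  moreover have "\<phi> \<in> sentences ?\<sigma> 0" using \<phi> by (simp add: sentences_def)
  moreover have "vocabulary \<tau>'" by (simp add: vocabulary_def \<tau>'_def arith_voc_def)
  moreover have "\<tau> \<inter> \<tau>' = arith_voc" using voc fresh unfolding \<tau>'_def by force
  moreover have "arity U = 1" "U \<notin> \<tau> \<union> \<tau>'" using fresh by (auto simp: U_def \<tau>'_def arith_voc_def)
  moreover have "pre k \<in> ARITHM \<tau>'" for k unfolding pre_def \<tau>'_def by (rule pre_struct_ARITHM)
  moreover have "computable (\<lambda>k. struct_encode (pre k))" unfolding pre_def by (rule computable_pre_struct[OF comp])
  ultimately show "(\<tau>, Q) \<in> para_FO" using Q unfolding para_FO_def mem_Collect_eq prod.case by blast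
qed

theorem theorem5p3:
  shows "para_FO = XFO_qr"
  using para_FO_subset_XFO_qr XFO_qr_subset_para_FO by (rule equalityI)

end
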